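(* Let $\Gamma$ be a finitely generated linear group over an arbitrary field. If $\Gamma$ satisfies a coset identity with respect to some subgroup $\Delta$ of finite index in $\Gamma$, then $\Gamma$ is virtually solvable.
   Context: For a subgroup $H$ of a group $G$, $G$ satisfies a coset identity with respect to $H$ if there exist a non-trivial reduced word $W$ in $l$ letters and $l$ fixed elements $g_1,\dots,g_l\in G$ such that $W(g_1h_1,\dots,g_lh_l)=1$ for all $h_1,\dots,h_l\in H$. *)

theory Defs
  imports "HOL-Analysis.Cartesian_Space" "HOL-Algebra.Solvable_Groups" "HOL-Algebra.Generated_Groups"
begin

definition GL :: "('k::field ^'n::finite ^'n) monoid" where
  "GL = \<lparr>carrier = {A. invertible A}, mult = (\<lambda>A B. A ** B), one = mat 1\<rparr>"

text \<open>Words in the letters x_0, x_1, ...: a letter is (i, True) for x_i and (i, False) for x_i^-1.\<close>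
type_synonym word = "(nat \<times> bool) list"

definition reduced_word :: "word \<Rightarrow> bool" where
  "reduced_word w \<longleftrightarrow> successively (\<lambda>(i,b) (j,c). \<not> (i = j \<and> b \<noteq> c)) w"

definition word_eval :: "('a, 'b) monoid_scheme \<Rightarrow> word \<Rightarrow> (nat \<Rightarrow> 'a) \<Rightarrow> 'a" where
  "word_eval G w x = foldr (\<lambda>(i,b) acc. (if b then x i else inv\<^bsub>G\<^esub> (x i)) \<otimes>\<^bsub>G\<^esub> acc) w \<one>\<^bsub>G\<^esub>"

definition coset_identity :: "('a, 'b) monoid_scheme \<Rightarrow> 'a set \<Rightarrow> bool" where
  "coset_identity G H \<longleftrightarrow>
     (\<exists>l W g. W \<noteq> [] \<and> reduced_word W \<and> (\<forall>(i,b)\<in>set W. i < l) \<and>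
        (\<forall>i<l. g i \<in> carrier G) \<and>
        (\<forall>h. (\<forall>i<l. h i \<in> H) \<longrightarrow> word_eval G W (\<lambda>i. g i \<otimes>\<^bsub>G\<^esub> h i) = \<one>\<^bsub>G\<^esub>))"

definition finite_index :: "('a, 'b) monoid_scheme \<Rightarrow> 'a set \<Rightarrow> bool" where
  "finite_index G H \<longleftrightarrow> subgroup H G \<and> finite (rcosets\<^bsub>G\<^esub> H)"

definition virtually_solvable :: "('a, 'b) monoid_scheme \<Rightarrow> bool" where
  "virtually_solvable G \<longleftrightarrow> (\<exists>N. finite_index G N \<and> solvable (G\<lparr>carrier := N\<rparr>))"

end

theory Submission
  imports Defs "HOL-Algebra.Algebraic_Closure_Type" "HOL-Library.Function_Algebras"
begin

unbundle no Formal_Power_Series.fps_syntax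

text \<open>Let \<open>K\<close> be an algebraic closure of the ground field. Choose a finite-index subgroup and a
  composition factor \<open>U/U'\<close> of \<open>K\<^sup>n\<close> that stays irreducible under all further finite-index subgroups.
  If on every such factor a finite-index subgroup acts by scalars, some finite-index subgroup is
  solvable. Otherwise let \<open>N\<close> be a normal finite-index subgroup contained in \<open>\<Delta>\<close>, with image \<open>\<rho> N\<close>
  on \<open>U/U'\<close>. Pulling the \<open>g_i\<close> through the word turns the coset identity into a law of \<open>N\<close>,
  a product of conjugates \<open>t h_i\<^bsup>\<plusminus>1\<^esup> t\<inverse>\<close> with fixed \<open>t \<in> \<Gamma>\<close>.

  As \<open>\<rho> N\<close> is infinite modulo scalars, there is a sequence \<open>x\<close> in \<open>N\<close> for which some product of
  an entry of \<open>\<rho> x\<close> and an entry of \<open>\<rho> x\<inverse>\<close> takes distinct values. A maximal \<open>K\<close>-valued place of the ring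
  of sequences \<open>\<nat> \<rightarrow> K\<close> sending these values to infinity assigns to every sequence in \<open>N\<close> a nonzero
  limit matrix, up to scaling; limits are multiplicative up to a possibly vanishing scalar, and
  the limits of \<open>x\<close> and \<open>x\<inverse>\<close> multiply to zero. Substituting \<open>h_i = a_i z b_i\<close>, where \<open>z\<close> is a sequence
  all of whose relevant conjugates have limits of minimal rank, makes the law a product of
  such limits. It does not vanish for generic constants \<open>a_i\<close>, \<open>b_i\<close> in \<open>N\<close>, by irreducibility and a
  Zariski-topology argument, although it should be a scalar while its factors are singular.\<close>

section \<open>Places of the ring of sequences\<close>

text \<open>Limits are taken along a place because the ground field comes with no absolute value.
  The residue field of the place is again K, thanks to algebraic closedness, so constants in
  \<open>N\<close> keep their matrices up to scaling and irreducibility still controls them. As the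
  ring of sequences has zero divisors, a place also has to decide which sets of indices are large.

  The factor \<open>U/U'\<close> is preserved by \<open>N\<close> but in general not by \<Gamma>. A
  conjugating element \<open>t\<close> thus has no matrix there: each map from \<open>x\<close> to
  \<open>\<rho> (t x t^-1)\<close> is a separate representation of \<open>N\<close>, whose limits
  are not determined by those of \<rho>. Nor is the limit of an inverse determined by the limit.
  Hence one \<open>z\<close> has to serve finitely many pairs of a twist and a sign at once.
  Normality of \<open>N\<close> and irreducibility under every finite-index subgroup make each
  twisted representation as good as \<rho>.

  The generic choice works with zero loci of a translation-stable finite-dimensional space of
  functions; a stabiliser of finite index plays the role of the identity component of an algebraic
  group.\<close>

lemma power_fun_apply: "(f ^ n) x = (f x :: 'a::monoid_mult) ^ n"
  by (induction n) auto

text \<open>A place is given by its graph: a homomorphism of \<open>K\<close>-algebras to \<open>K\<close>, defined on a subalgebra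
  of the ring of sequences.\<close>

definition place :: "((nat \<Rightarrow> 'k::field) \<times> 'k) set \<Rightarrow> bool" where
  "place G \<longleftrightarrow> (\<forall>c. ((\<lambda>_. c), c) \<in> G) \<and>
     (\<forall>f a g b. (f, a) \<in> G \<longrightarrow> (g, b) \<in> G \<longrightarrow> (f + g, a + b) \<in> G \<and> (f * g, a * b) \<in> G) \<and>
     (\<forall>a. (0, a) \<in> G \<longrightarrow> a = 0)"

lemma place_const: "place G \<Longrightarrow> ((\<lambda>_. c), c) \<in> G"
  and place_add: "place G \<Longrightarrow> (f, a) \<in> G \<Longrightarrow> (g, b) \<in> G \<Longrightarrow> (f + g, a + b) \<in> G"
  and place_mult: "place G \<Longrightarrow> (f, a) \<in> G \<Longrightarrow> (g, b) \<in> G \<Longrightarrow> (f * g, a * b) \<in> G"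
  and place_zeroD: "place G \<Longrightarrow> (0, a) \<in> G \<Longrightarrow> a = 0"
  unfolding place_def by blast+

lemma place_0: "place G \<Longrightarrow> (0, 0) \<in> G"
  using place_const[of G 0] by (simp add: zero_fun_def)

lemma place_1: "place G \<Longrightarrow> (1, 1) \<in> G"
  using place_const[of G 1] by (simp add: one_fun_def)

lemma place_uminus:
  assumes "place G" "(f, a) \<in> G" shows "(- f, - a) \<in> G"
  using place_mult[OF assms(1) place_const[OF assms(1), of "-1"] assms(2)]
  by (simp add: fun_eq_iff times_fun_def fun_Compl_def)

lemma place_diff:
  assumes "place G" "(f, a) \<in> G" "(g, b) \<in> G" shows "(f - g, a - b) \<in> G"
  using place_add[OF assms(1,2) place_uminus[OF assms(1,3)]] by simp

lemma place_unique:
  assumes "place G" "(f, a) \<in> G" "(f, b) \<in> G" shows "a = b"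
  using place_zeroD[OF assms(1), of "a - b"] place_diff[OF assms] by simp

lemma place_sum:
  assumes "place G" "\<And>i. i \<in> I \<Longrightarrow> (f i, a i) \<in> G"
  shows "(sum f I, sum a I) \<in> G"
  using assms(2) by (induction I rule: infinite_finite_induct)
    (auto simp: place_0[OF assms(1)] intro: place_add[OF assms(1)])

section \<open>Extending a place by one element\<close>

definition coeffs_in :: "((nat \<Rightarrow> 'k::field) \<times> 'k) set \<Rightarrow> (nat \<Rightarrow> 'k) poly \<Rightarrow> 'k poly \<Rightarrow> bool" where
  "coeffs_in G p q \<longleftrightarrow> (\<forall>i. (coeff p i, coeff q i) \<in> G)"

lemma coeffs_in_add:
  "place G \<Longrightarrow> coeffs_in G p q \<Longrightarrow> coeffs_in G p' q' \<Longrightarrow> coeffs_in G (p + p') (q + q')"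
  by (simp add: coeffs_in_def place_add)

lemma coeffs_in_diff:
  "place G \<Longrightarrow> coeffs_in G p q \<Longrightarrow> coeffs_in G p' q' \<Longrightarrow> coeffs_in G (p - p') (q - q')"
  by (simp add: coeffs_in_def place_diff)

lemma coeffs_in_mult:
  "place G \<Longrightarrow> coeffs_in G p q \<Longrightarrow> coeffs_in G p' q' \<Longrightarrow> coeffs_in G (p * p') (q * q')"
  by (auto simp: coeffs_in_def coeff_mult intro!: place_sum place_mult)

lemma coeffs_in_const:
  "place G \<Longrightarrow> (f, a) \<in> G \<Longrightarrow> coeffs_in G [:f:] [:a:]"
  by (auto simp: coeffs_in_def place_0 coeff_pCons split: nat.split)

lemma coeffs_in_X: "place G \<Longrightarrow> coeffs_in G [:0, 1:] [:0, 1:]"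
  by (auto simp: coeffs_in_def place_0 place_1 coeff_pCons split: nat.split)

lemma coeffs_in_lift:
  assumes "place G"
  shows "coeffs_in G (map_poly (\<lambda>c. (\<lambda>_. c)) q) q"
  by (auto simp: coeffs_in_def coeff_map_poly zero_fun_def place_const[OF assms])

text \<open>The value at \<open>poly p x\<close> has to be \<open>poly q c\<close>. By additivity,
  well-definedness reduces to one condition: relations satisfied by \<open>x\<close> must reduce to
  polynomials vanishing at \<open>c\<close>.\<close>

lemma place_adjoin:
  assumes G: "place G"
    and root: "\<And>p q. coeffs_in G p q \<Longrightarrow> poly p x = 0 \<Longrightarrow> poly q c = 0"
  obtains G' where "place G'" "G \<subseteq> G'" "(x, c) \<in> G'"
proof
  let ?G = "{(poly p x, poly q c) | p q. coeffs_in G p q}"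
  show sub: "G \<subseteq> ?G"
  proof safe
    fix f a assume "(f, a) \<in> G"
    then show "\<exists>p q. (f, a) = (poly p x, poly q c) \<and> coeffs_in G p q"
      by (intro exI[of _ "[:f:]"] exI[of _ "[:a:]"]) (auto intro: coeffs_in_const G)
  qed
  have "(x, c) = (poly [:0, 1:] x, poly [:0, 1:] c)" by simp
  then show "(x, c) \<in> ?G" using coeffs_in_X[OF G] by blast
  show "place ?G"
    unfolding place_def
  proof (intro conjI allI impI)
    fix c show "((\<lambda>_. c), c) \<in> ?G" using place_const[OF G, of c] sub by blast
  next
    fix f a g b assume "(f, a) \<in> ?G" "(g, b) \<in> ?G"
    then obtain p q p' q' where "f = poly p x" "a = poly q c" "coeffs_in G p q"
      "g = poly p' x" "b = poly q' c" "coeffs_in G p' q'" by blast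
    then show "(f + g, a + b) \<in> ?G" "(f * g, a * b) \<in> ?G"
      using coeffs_in_add[OF G, of p q p' q'] coeffs_in_mult[OF G, of p q p' q']
      by (auto simp flip: poly_add poly_mult)
  next
    fix a assume "(0, a) \<in> ?G"
    then show "a = 0" using root by force
  qed
qed

text \<open>A nonzero element of least degree generates the ideal and is not constant since the
  ideal is proper, so it has a root. This keeps the values of places inside the ground
  field.\<close>

lemma poly_ideal_common_root:
  fixes J :: "'k::alg_closed_field poly set"
  assumes diff: "\<And>p q. p \<in> J \<Longrightarrow> q \<in> J \<Longrightarrow> p - q \<in> J"
    and mult: "\<And>p q. p \<in> J \<Longrightarrow> q * p \<in> J" and "1 \<notin> J"
  obtains c where "\<And>q. q \<in> J \<Longrightarrow> poly q c = 0"
proof (cases "\<exists>q. q \<in> J \<and> q \<noteq> 0")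
  case False
  then show ?thesis using that by fastforce
next
  case True
  define q0 where "q0 = arg_min degree (\<lambda>q. q \<in> J \<and> q \<noteq> 0)"
  have q0: "q0 \<in> J" "q0 \<noteq> 0" and min: "\<And>q. q \<in> J \<Longrightarrow> q \<noteq> 0 \<Longrightarrow> degree q0 \<le> degree q"
    using arg_min_nat_lemma[of "\<lambda>q. q \<in> J \<and> q \<noteq> 0" _ degree] True unfolding q0_def by blast+
  have "degree q0 > 0"
  proof (rule ccontr)
    assume "\<not> degree q0 > 0"
    then obtain c where "q0 = [:c:]" "c \<noteq> 0" using q0 by (auto elim: degree_eq_zeroE)
    then show False using mult[OF q0(1), of "[:inverse c:]"] \<open>1 \<notin> J\<close> by (simp add: one_pCons)
  qed
  then obtain c where c: "poly q0 c = 0" using alg_closed_imp_poly_has_root by blast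
  have "poly q c = 0" if "q \<in> J" for q
  proof -
    have "q mod q0 = q - (q div q0) * q0" by (simp add: minus_div_mult_eq_mod)
    then have "q mod q0 \<in> J" using diff[OF that mult[OF q0(1)]] by simp
    then have "q mod q0 = 0"
      using min[of "q mod q0"] degree_mod_less[OF q0(2), of q] by linarith
    then have "q = (q div q0) * q0" by (metis div_mult_mod_eq add.right_neutral)
    then show ?thesis using c by (metis poly_mult mult_zero_right)
  qed
  then show ?thesis using that by blast
qed

section \<open>Maximal places: finite and infinite elements\<close>

definition max_place :: "((nat \<Rightarrow> 'k::field) \<times> 'k) set \<Rightarrow> bool" where
  "max_place G \<longleftrightarrow> place G \<and> (\<forall>G'. place G' \<longrightarrow> G \<subseteq> G' \<longrightarrow> G' = G)"

lemma max_placeD: "max_place G \<Longrightarrow> place G"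
  by (simp add: max_place_def)

text \<open>Such a relation exists for some \<open>n\<close> iff the kernel of the place generates the unit ideal in the
  extension of its domain by \<open>x\<close>; this is the only obstruction to extending the place to \<open>x\<close>.\<close>

definition unit_rel :: "((nat \<Rightarrow> 'k::field) \<times> 'k) set \<Rightarrow> nat \<Rightarrow> (nat \<Rightarrow> 'k) \<Rightarrow> bool" where
  "unit_rel G n x \<longleftrightarrow> (\<exists>a. (a 0, 1) \<in> G \<and> (\<forall>i>0. (a i, 0) \<in> G) \<and> (\<forall>i>n. a i = 0) \<and>
     (\<Sum>i\<le>n. a i * x ^ i) = 0)"

text \<open>The reductions \<open>J\<close> of the relations satisfied by \<open>x\<close> form an
  ideal. If it is proper, a common root is an admissible value for \<open>x\<close>, and maximality
  puts it into \<open>G\<close>; otherwise 1 is the reduction of a relation.\<close>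

lemma max_place_dichotomy:
  fixes G :: "((nat \<Rightarrow> 'k::alg_closed_field) \<times> 'k) set"
  assumes max: "max_place G"
  shows "(\<exists>c. (x, c) \<in> G) \<or> (\<exists>n. unit_rel G n x)"
proof -
  have G: "place G" using max by (rule max_placeD)
  define J where "J = {q. \<exists>p. coeffs_in G p q \<and> poly p x = 0}"
  show ?thesis
  proof (cases "1 \<in> J")
    case True
    then obtain p where p: "coeffs_in G p 1" "poly p x = 0" unfolding J_def by blast
    have c: "(coeff p i, coeff 1 i) \<in> G" for i
      using p(1) by (simp add: coeffs_in_def)
    have "(coeff p 0, 1) \<in> G" using c[of 0] by simp
    moreover have "(coeff p i, 0) \<in> G" if "i > 0" for i using c[of i] that by simp
    ultimately
    have "unit_rel G (degree p) x"
      unfolding unit_rel_def using p(2)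
      by (intro exI[of _ "coeff p"]) (auto simp: poly_altdef coeff_eq_0)
    then show ?thesis by blast
  next
    case False
    have "p - q \<in> J" if "p \<in> J" "q \<in> J" for p q
    proof -
      obtain p' q' where "coeffs_in G p' p" "poly p' x = 0" "coeffs_in G q' q" "poly q' x = 0"
        using \<open>p \<in> J\<close> \<open>q \<in> J\<close> unfolding J_def by blast
      then show ?thesis
        using coeffs_in_diff[OF G, of p' p q' q] unfolding J_def
        by (intro CollectI exI[of _ "p' - q'"]) auto
    qed
    moreover have "r * q \<in> J" if "q \<in> J" for q r
    proof -
      obtain p where "coeffs_in G p q" "poly p x = 0" using \<open>q \<in> J\<close> unfolding J_def by blast
      then show ?thesis
        using coeffs_in_mult[OF G coeffs_in_lift[OF G, of r]] unfolding J_def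
        by (intro CollectI exI[of _ "map_poly (\<lambda>c _. c) r * p"]) auto
    qed
    ultimately obtain c where c: "\<And>q. q \<in> J \<Longrightarrow> poly q c = 0"
      using poly_ideal_common_root False by metis
    obtain G' where "place G'" "G \<subseteq> G'" "(x, c) \<in> G'"
      using place_adjoin[OF G, of x c] c unfolding J_def by blast
    then show ?thesis using max unfolding max_place_def by blast
  qed
qed

text \<open>The exchange step of Chevalley's extension theorem: multiplied by \<open>x ^ n\<close>,
  the relation for the inverse \<open>y\<close> becomes one for \<open>x\<close> with leading
  coefficient \<open>b 0\<close>, which can cancel the top term of the relation for
  \<open>x\<close>.\<close>

lemma unit_rel_descend:
  assumes G: "place G" and xy: "x * y = 1" and x: "unit_rel G n x" and y: "unit_rel G m y"
    and "m \<le> n" "0 < n"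
  shows "unit_rel G (n - 1) x"
proof -
  obtain a where a: "(a 0, 1) \<in> G" "\<And>i. i > 0 \<Longrightarrow> (a i, 0) \<in> G" "\<And>i. i > n \<Longrightarrow> a i = 0"
    "(\<Sum>i\<le>n. a i * x ^ i) = 0" using x unfolding unit_rel_def by blast
  obtain b where b: "(b 0, 1) \<in> G" "\<And>i. i > 0 \<Longrightarrow> (b i, 0) \<in> G" "\<And>i. i > m \<Longrightarrow> b i = 0"
    "(\<Sum>i\<le>m. b i * y ^ i) = 0" using y unfolding unit_rel_def by blast
  have bn: "(\<Sum>i\<le>n. b i * y ^ i) = 0"
    using b(4) sum.mono_neutral_right[of "{..n}" "{..m}" "\<lambda>i. b i * y ^ i"] \<open>m \<le> n\<close> b(3) by auto
  have yx: "y ^ i * x ^ n = x ^ (n - i)" if "i \<le> n" for i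
  proof -
    have "x ^ n = x ^ i * x ^ (n - i)" using that by (simp flip: power_add)
    then have "y ^ i * x ^ n = (x * y) ^ i * x ^ (n - i)" by (simp add: power_mult_distrib mult_ac)
    then show ?thesis by (simp add: xy)
  qed
  have "(\<Sum>i\<le>n. b (n - i) * x ^ i) = (\<Sum>i\<le>n. b i * x ^ (n - i))"
    by (rule sum.reindex_bij_witness[of _ "\<lambda>i. n - i" "\<lambda>i. n - i"]) auto
  also have "\<dots> = (\<Sum>i\<le>n. b i * y ^ i) * x ^ n"
    by (simp add: sum_distrib_right yx mult.assoc)
  finally have rev: "(\<Sum>i\<le>n. b (n - i) * x ^ i) = 0" using bn by simp
  \<comment> \<open>The coefficient of \<open>x ^ n\<close> would be
    \<open>b 0 * a n - a n * b 0 = 0\<close>. Multiplying by \<open>b 0\<close> replaces a division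
    and is harmless, since \<open>b 0\<close> has value 1; \<open>0 < n\<close> ensures that
    \<open>a n\<close> and \<open>b n\<close> have value 0, so \<open>c 0\<close> has value
    1.\<close>
  define c where "c i = (if i < n then b 0 * a i - a n * b (n - i) else 0)" for i
  have "(\<Sum>i\<le>n - 1. c i * x ^ i) = (\<Sum>i<n. (b 0 * a i - a n * b (n - i)) * x ^ i)"
    using \<open>0 < n\<close> by (intro sum.cong) (auto simp: c_def)
  also have "\<dots> = (\<Sum>i\<le>n. (b 0 * a i - a n * b (n - i)) * x ^ i)"
    by (simp add: ivl_disj_un_singleton(2)[symmetric])
  also have "\<dots> = b 0 * (\<Sum>i\<le>n. a i * x ^ i) - a n * (\<Sum>i\<le>n. b (n - i) * x ^ i)"
    by (simp add: algebra_simps sum_subtractf sum_distrib_left)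
  finally have sum0: "(\<Sum>i\<le>n - 1. c i * x ^ i) = 0" using a(4) rev by simp
  have "(b 0 * a 0 - a n * b (n - 0), 1 * 1 - 0 * 0) \<in> G"
    using \<open>0 < n\<close> by (intro place_diff place_mult G a b) auto
  then have "(c 0, 1) \<in> G" using \<open>0 < n\<close> by (simp add: c_def)
  moreover have "(c i, 0) \<in> G" if "i > 0" for i
  proof -
    have "(b 0 * a i - a n * b (n - i), 1 * 0 - 0 * 0) \<in> G" if "i < n"
      using \<open>0 < n\<close> that \<open>i > 0\<close> by (intro place_diff place_mult G a b) auto
    then show ?thesis by (auto simp: c_def place_0[OF G])
  qed
  ultimately show ?thesis
    unfolding unit_rel_def using sum0 by (intro exI[of _ c]) (auto simp: c_def)
qed

text \<open>Descent on \<open>n + m\<close>: the longer relation is shortened until one of them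
  reads \<open>a 0 = 0\<close>, although \<open>a 0\<close> has value 1.\<close>

lemma unit_rel_False:
  assumes G: "place G" and xy: "x * y = 1"
  shows "unit_rel G n x \<Longrightarrow> unit_rel G m y \<Longrightarrow> False"
proof (induction "n + m" arbitrary: n m rule: less_induct)
  case less
  have no0: False if "unit_rel G 0 z" for z
    using that place_zeroD[OF G, of 1] unfolding unit_rel_def by auto
  have pos: "n > 0" "m > 0" using less.prems no0 by (auto intro!: gr0I)
  show ?case
  proof (cases "m \<le> n")
    case True
    then show ?thesis
      using unit_rel_descend[OF G xy less.prems True pos(1)] less.hyps[of "n - 1" m] less.prems pos
      by auto
  next
    case False
    have "y * x = 1" using xy by (simp add: mult.commute)
    then show ?thesis
      using unit_rel_descend[OF G _ less.prems(2,1) _ pos(2)] less.hyps[of n "m - 1"] less.prems pos False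
      by auto
  qed
qed

text \<open>The valuation ring property, for units of the ring of sequences: an element and its
  inverse cannot both be infinite.\<close>

lemma max_place_unit:
  fixes G :: "((nat \<Rightarrow> 'k::alg_closed_field) \<times> 'k) set"
  assumes "max_place G" "x * y = 1"
  shows "(\<exists>c. (x, c) \<in> G) \<or> (\<exists>c. (y, c) \<in> G)"
  using max_place_dichotomy[OF assms(1)] unit_rel_False[OF max_placeD[OF assms(1)] assms(2)] by blast

text \<open>Under a maximal place, the sets whose indicator has value 1 form an ultrafilter on the
  indices; it compensates for the zero divisors.\<close>

abbreviation ind :: "nat set \<Rightarrow> nat \<Rightarrow> 'k::field" where
  "ind S \<equiv> (\<lambda>i. if i \<in> S then 1 else 0)"

lemma max_place_indicator:
  fixes G :: "((nat \<Rightarrow> 'k::alg_closed_field) \<times> 'k) set"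
  assumes max: "max_place G"
  shows "(ind S, 0) \<in> G \<or> (ind S, 1) \<in> G"
proof -
  have G: "place G" using max by (rule max_placeD)
  let ?e = "ind S :: nat \<Rightarrow> 'k"
  have ee: "?e * ?e = ?e" by (auto simp: fun_eq_iff)
  have "\<exists>c. (?e, c) \<in> G"
  proof (rule ccontr)
    assume "\<nexists>c. (?e, c) \<in> G"
    then obtain n where "unit_rel G n ?e"
      using max_place_dichotomy[OF max, of ?e] by blast
    then obtain a where a: "(a 0, 1) \<in> G" "\<And>i. i > 0 \<Longrightarrow> (a i, 0) \<in> G"
      "(\<Sum>i\<le>n. a i * ?e ^ i) = 0"
      unfolding unit_rel_def by (elim exE conjE) simp
    define m where "m = (\<Sum>i\<in>{0<..n}. a i)"
    have m: "(m, 0) \<in> G"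
      using place_sum[OF G, of "{0<..n}" a "\<lambda>_. 0"] a(2) unfolding m_def by auto
    have pw: "?e ^ i = ?e" if "i > 0" for i
      using that by (auto simp: fun_eq_iff power_fun_apply)
    have "{..n} = insert 0 {0<..n}" by auto
    then have "(\<Sum>i\<le>n. a i * ?e ^ i) = a 0 + (\<Sum>i\<in>{0<..n}. a i * ?e ^ i)" by simp
    also have "\<dots> = a 0 + m * ?e"
      unfolding m_def sum_distrib_right by (simp add: pw)
    finally have rel: "a 0 + m * ?e = 0" using a(3) by simp
    \<comment> \<open>On \<open>S\<close> the relation says \<open>a 0 + m = 0\<close>, off
      \<open>S\<close> it says \<open>a 0 = 0\<close>. So the product vanishes everywhere, although
      its value would be 1.\<close>
    have "a 0 * (a 0 + m) = 0"
    proof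
      fix i show "(a 0 * (a 0 + m)) i = 0 i"
        using fun_cong[OF rel, of i] by (cases "i \<in> S") simp_all
    qed
    moreover have "(a 0 * (a 0 + m), 1 * (1 + 0)) \<in> G" by (intro place_mult place_add G a m)
    ultimately show False using place_zeroD[OF G, of "1 * (1 + 0)"] by simp
  qed
  then obtain c where c: "(?e, c) \<in> G" by blast
  have "c * c = c" by (rule place_unique[OF G place_mult[OF G c c, unfolded ee] c])
  then have "c = 0 \<or> c = 1" by (metis mult_cancel_left2)
  then show ?thesis using c by auto
qed

text \<open>Multiplying a relation for \<open>x\<close> by the complementary idempotent, which has
  value 1 and annihilates \<open>x\<close>, leaves only the constant term, whose value is 1 as
  well.\<close>

lemma max_place_null:
  fixes G :: "((nat \<Rightarrow> 'k::alg_closed_field) \<times> 'k) set"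
  assumes max: "max_place G" and S: "(ind S, 0) \<in> G" and x: "\<And>i. i \<notin> S \<Longrightarrow> x i = 0"
  shows "\<exists>c. (x, c) \<in> G"
proof (rule ccontr)
  have G: "place G" using max by (rule max_placeD)
  assume "\<nexists>c. (x, c) \<in> G"
  then obtain n where "unit_rel G n x"
    using max_place_dichotomy[OF max, of x] by blast
  then obtain a where a: "(a 0, 1) \<in> G" "(\<Sum>i\<le>n. a i * x ^ i) = 0"
    unfolding unit_rel_def by (elim exE conjE) simp
  let ?d = "1 - ind S :: nat \<Rightarrow> 'k"
  have d: "(?d, 1) \<in> G" using place_diff[OF G place_1[OF G] S] by simp
  have "x * ?d = 0" using x by (auto simp: fun_eq_iff)
  then have "x ^ i * ?d = 0" if pos: "i > 0" for i
  proof -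
    obtain j where "i = Suc j" using pos by (cases i) auto
    then have "x ^ i * ?d = x ^ j * (x * ?d)" by (simp only: power_Suc mult_ac)
    then show ?thesis using \<open>x * ?d = 0\<close> by simp
  qed
  then have "(\<Sum>i\<in>{0<..n}. a i * x ^ i * ?d) = 0"
    by (intro sum.neutral) (auto simp only: mult.assoc mult_zero_right greaterThanAtMost_iff)
  moreover have "{..n} = insert 0 {0<..n}" by auto
  then have "(\<Sum>i\<le>n. a i * x ^ i) * ?d = a 0 * ?d + (\<Sum>i\<in>{0<..n}. a i * x ^ i * ?d)"
    by (simp add: distrib_right sum_distrib_right)
  ultimately have "a 0 * ?d = 0" using a(2) by simp
  moreover have "(a 0 * ?d, 1 * 1) \<in> G" by (intro place_mult G a d)
  ultimately show False using place_zeroD[OF G, of "1 * 1"] by simp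
qed

text \<open>An injective sequence takes infinitely many values, so it satisfies no nontrivial
  polynomial relation over the constants and may be given the value 0. Zorn's lemma then yields a
  maximal extension.\<close>

lemma max_place_exists:
  fixes b :: "nat \<Rightarrow> 'k::alg_closed_field"
  assumes "inj b"
  obtains G where "max_place G" "(b, 0) \<in> G"
proof -
  let ?G0 = "{((\<lambda>_. c), c) | c. True} :: ((nat \<Rightarrow> 'k) \<times> 'k) set"
  have G0: "place ?G0"
    unfolding place_def by (auto simp: plus_fun_def times_fun_def zero_fun_def fun_eq_iff)
  have "poly q 0 = 0" if pq: "coeffs_in ?G0 p q" and p: "poly p b = 0" for p q
  proof -
    have c: "coeff p i = (\<lambda>_. coeff q i)" for i
      using pq unfolding coeffs_in_def by fastforce
    have "degree p \<le> degree q"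
      by (intro degree_le allI impI) (simp add: c coeff_eq_0 zero_fun_def)
    moreover have "coeff q i = 0" if "i > degree p" for i
      using fun_cong[OF c[of i], of 0] coeff_eq_0[OF that] by simp
    then have "degree q \<le> degree p" by (intro degree_le) blast
    ultimately have deg: "degree p = degree q" by simp
    have "(\<Sum>i\<in>A. coeff p i * b ^ i) j = (\<Sum>i\<in>A. coeff q i * b j ^ i)" if "finite A" for A j
      using that by (induction A rule: finite_induct) (auto simp: c power_fun_apply)
    then have "poly q (b j) = 0" for j
      using fun_cong[OF p, of j] by (simp add: poly_altdef deg)
    then have "range b \<subseteq> {x. poly q x = 0}" by auto
    then have "infinite {x. poly q x = 0}"
      using range_inj_infinite[OF assms] finite_subset by blast
    then show ?thesis using poly_roots_finite[of q] by fastforce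
  qed
  then obtain G1 where G1: "place G1" "(b, 0) \<in> G1"
    using place_adjoin[OF G0, of b 0] by blast
  define A where "A = {G. place G \<and> (b, 0) \<in> G}"
  have "\<exists>M\<in>A. \<forall>Z\<in>A. M \<subseteq> Z \<longrightarrow> Z = M"
  proof (rule subset_Zorn_nonempty)
    show "A \<noteq> {}" using G1 unfolding A_def by blast
  next
    fix C assume C: "C \<noteq> {}" "subset.chain A C"
    have sub: "C \<subseteq> A" and lin: "\<And>Z Y. Z \<in> C \<Longrightarrow> Y \<in> C \<Longrightarrow> Z \<subseteq> Y \<or> Y \<subseteq> Z"
      using C(2) by (auto simp: subset_chain_def)
    have pl: "\<And>Z. Z \<in> C \<Longrightarrow> place Z" using sub by (auto simp: A_def)
    have "place (\<Union>C)"
      unfolding place_def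
    proof (intro conjI allI impI)
      fix c show "((\<lambda>_. c), c) \<in> \<Union>C" using C(1) pl place_const by blast
    next
      fix f a g b' assume "(f, a) \<in> \<Union>C" "(g, b') \<in> \<Union>C"
      then obtain Z where "Z \<in> C" "(f, a) \<in> Z" "(g, b') \<in> Z" using lin by blast
      then show "(f + g, a + b') \<in> \<Union>C" "(f * g, a * b') \<in> \<Union>C"
        using pl place_add place_mult by blast+
    next
      fix a assume "(0, a) \<in> \<Union>C"
      then show "a = 0" using pl place_zeroD by blast
    qed
    then show "\<Union>C \<in> A" using C(1) sub unfolding A_def by blast
  qed
  then obtain M where "M \<in> A" "\<forall>Z\<in>A. M \<subseteq> Z \<longrightarrow> Z = M" by blast
  then have "max_place M" "(b, 0) \<in> M" unfolding max_place_def A_def by blast+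
  then show ?thesis using that by blast
qed

section \<open>Limits of sequences of matrices\<close>

definition smat :: "'k::times \<Rightarrow> 'k^'n^'m \<Rightarrow> 'k^'n^'m" (infixr "*\<^sub>m" 75) where
  "c *\<^sub>m A = (\<chi> i j. c * A $ i $ j)"

lemma place_prod:
  assumes "place G" "\<And>i. i \<in> I \<Longrightarrow> (f i, a i) \<in> G"
  shows "(prod f I, prod a I) \<in> G"
  using assms(2) by (induction I rule: infinite_finite_induct)
    (auto simp: place_1[OF assms(1)] intro: place_mult[OF assms(1)])

text \<open>By \<open>max_place_unit\<close>, finiteness of quotients is a total preorder on units,
  so a finite family has a largest member.\<close>

lemma max_place_dominant:
  fixes G :: "((nat \<Rightarrow> 'k::alg_closed_field) \<times> 'k) set"
  assumes max: "max_place G" and "finite E" "E \<noteq> {}" and nz: "\<And>e i. u e i \<noteq> 0"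
  shows "\<exists>e0\<in>E. \<forall>e\<in>E. \<exists>c. ((\<lambda>i. u e i / u e0 i), c) \<in> G"
  using assms(2,3)
proof (induction E rule: finite_ne_induct)
  case (singleton e)
  have "(\<lambda>i. u e i / u e i) = (\<lambda>_. 1)" using nz by auto
  then show ?case using place_const[OF max_placeD[OF max], of 1] by auto
next
  case (insert e E)
  then obtain e0 where e0: "e0 \<in> E" "\<And>e. e \<in> E \<Longrightarrow> \<exists>c. ((\<lambda>i. u e i / u e0 i), c) \<in> G" by blast
  have "(\<lambda>i. u e i / u e0 i) * (\<lambda>i. u e0 i / u e i) = 1"
    using nz by (auto simp: fun_eq_iff)
  then consider "\<exists>c. ((\<lambda>i. u e i / u e0 i), c) \<in> G" | c where "((\<lambda>i. u e0 i / u e i), c) \<in> G"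
    using max_place_unit[OF max] by blast
  then show ?case
  proof cases
    case 1
    then show ?thesis using e0 by blast
  next
    case 2
    have "\<exists>c. ((\<lambda>i. u e' i / u e i), c) \<in> G" if "e' \<in> insert e E" for e'
    proof (cases "e' = e")
      case True
      have "(\<lambda>i. u e i / u e i) = (\<lambda>_. 1)" using nz by auto
      then show ?thesis using place_const[OF max_placeD[OF max], of 1] True by auto
    next
      case False
      then obtain d where d: "((\<lambda>i. u e' i / u e0 i), d) \<in> G" using e0(2) \<open>e' \<in> insert e E\<close> by blast
      have "(\<lambda>i. u e' i / u e0 i) * (\<lambda>i. u e0 i / u e i) = (\<lambda>i. u e' i / u e i)"
        using nz by (auto simp: fun_eq_iff)
      then show ?thesis using place_mult[OF max_placeD[OF max] d 2] by auto
    qed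
    then show ?thesis by blast
  qed
qed

text \<open>Division by a dominant entry makes all entries finite. Entries may vanish at some
  indices, so only those in \<open>E\<close>, nonzero on a large set, compete for dominance; the
  others are supported on a null set and stay finite under any scaling.\<close>

lemma max_place_scale:
  fixes G :: "((nat \<Rightarrow> 'k::alg_closed_field) \<times> 'k) set" and f :: "'e::finite \<Rightarrow> nat \<Rightarrow> 'k"
  assumes max: "max_place G" and nz: "\<forall>i. \<exists>e. f e i \<noteq> 0"
  obtains s v where "\<forall>i. s i \<noteq> 0" "\<forall>e. ((\<lambda>i. s i * f e i), v e) \<in> G" "\<exists>e. v e \<noteq> 0"
proof -
  have G: "place G" using max by (rule max_placeD)
  define S where "S e = {i. f e i \<noteq> 0}" for e
  define u where "u e i = (if f e i \<noteq> 0 then f e i else 1)" for e i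
  define E where "E = {e. (ind (S e), 1) \<in> G}"
  have "E \<noteq> {}"
  proof
    assume "E = {}"
    then have "(ind (S e), 0) \<in> G" for e
      using max_place_indicator[OF max, of "S e"] unfolding E_def by blast
    \<comment> \<open>At every index some entry is nonzero, so the product of these complementary
      idempotents is 0, while each of them would have value 1.\<close>
    then have "(1 - ind (S e), 1 - 0) \<in> G" for e by (intro place_diff G place_1)
    then have "((\<Prod>e\<in>UNIV. 1 - ind (S e)), (\<Prod>e::'e\<in>UNIV. 1 - 0)) \<in> G"
      by (intro place_prod G)
    moreover have prod_apply: "(\<Prod>e\<in>F. 1 - ind (S e)) i = (\<Prod>e\<in>F. 1 - ind (S e) i :: 'k)" if "finite F" for i F
      using that by (induction F) auto
    have "(\<Prod>e\<in>UNIV. 1 - ind (S e)) i = (0 :: 'k)" for i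
    proof -
      obtain e where "i \<in> S e" using nz by (auto simp: S_def)
      then show ?thesis unfolding prod_apply[OF finite] by (intro prod_zero bexI[of _ e]) auto
    qed
    then have "(\<Prod>e\<in>UNIV. 1 - ind (S e)) = (0 :: nat \<Rightarrow> 'k)" by auto
    ultimately have "(0, 1) \<in> G" by simp
    then show False using place_zeroD[OF G, of 1] by simp
  qed
  have unz: "u e i \<noteq> 0" for e i by (simp add: u_def)
  obtain e0 where e0: "e0 \<in> E" and dom: "\<And>e. e \<in> E \<Longrightarrow> \<exists>c. ((\<lambda>i. u e i / u e0 i), c) \<in> G"
    using max_place_dominant[OF max finite \<open>E \<noteq> {}\<close>, of u, OF unz] by blast
  have f_eq: "f e i = u e i * ind (S e) i" for e i by (simp add: u_def S_def)
  have "\<exists>c. ((\<lambda>i. 1 / u e0 i * f e i), c) \<in> G" for e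
  proof (cases "e \<in> E")
    case True
    then obtain c where c: "((\<lambda>i. u e i / u e0 i), c) \<in> G" using dom by blast
    have "(ind (S e), 1) \<in> G" using True by (simp add: E_def)
    then have "((\<lambda>i. u e i / u e0 i) * ind (S e), c * 1) \<in> G" by (intro place_mult G c)
    moreover have "(\<lambda>i. u e i / u e0 i) * ind (S e) = (\<lambda>i. 1 / u e0 i * f e i)"
      by (simp add: f_eq fun_eq_iff)
    ultimately show ?thesis by auto
  next
    case False
    then have "(ind (S e), 0) \<in> G" using max_place_indicator[OF max, of "S e"] by (auto simp: E_def)
    then show ?thesis by (rule max_place_null[OF max]) (simp add: S_def)
  qed
  then obtain v where v: "\<And>e. ((\<lambda>i. 1 / u e0 i * f e i), v e) \<in> G" by metis
  have "(\<lambda>i. 1 / u e0 i * f e0 i) = ind (S e0)"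
    by (auto simp: fun_eq_iff S_def u_def)
  then have "v e0 = 1" using place_unique[OF G v[of e0]] e0 by (simp add: E_def)
  then show ?thesis using that[of "\<lambda>i. 1 / u e0 i" v] v unz by fastforce
qed

text \<open>The reduction of a point of projective space: the scaling makes all entries finite and
  some entry nonzero in the limit.\<close>

definition scaled_limit ::
    "((nat \<Rightarrow> 'k::field) \<times> 'k) set \<Rightarrow> (nat \<Rightarrow> 'k^'n^'n) \<Rightarrow> (nat \<Rightarrow> 'k) \<Rightarrow> 'k^'n^'n \<Rightarrow> bool" where
  "scaled_limit G S s M \<longleftrightarrow> (\<forall>i. s i \<noteq> 0) \<and> M \<noteq> 0 \<and>
     (\<forall>p q. ((\<lambda>i. s i * S i $ p $ q), M $ p $ q) \<in> G)"

lemma scaled_limit_exists: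
  fixes G :: "((nat \<Rightarrow> 'k::alg_closed_field) \<times> 'k) set" and S :: "nat \<Rightarrow> 'k^'n::finite^'n"
  assumes "max_place G" "\<forall>i. S i \<noteq> 0"
  shows "\<exists>s M. scaled_limit G S s M"
proof -
  define f where "f e i = S i $ fst e $ snd e" for e i
  have "\<forall>i. \<exists>e. f e i \<noteq> 0"
    using assms(2) by (simp add: f_def vec_eq_iff)
  then obtain s v where sv: "\<forall>i. s i \<noteq> 0" "\<forall>e. ((\<lambda>i. s i * f e i), v e) \<in> G" "\<exists>e. v e \<noteq> 0"
    by (rule max_place_scale[OF assms(1), of f])
  have "scaled_limit G S s (\<chi> p q. v (p, q))"
    unfolding scaled_limit_def using sv(1,3) sv(2)[rule_format, of "(_, _)"] by (auto simp: f_def vec_eq_iff)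
  then show ?thesis by blast
qed

lemma scaled_limit_mult_entries:
  assumes G: "place G" and S: "scaled_limit G S s M" and Y: "scaled_limit G Y t N"
  shows "((\<lambda>i. s i * t i * (S i ** Y i) $ p $ q), (M ** N) $ p $ q) \<in> G"
proof -
  have "((\<Sum>r\<in>UNIV. (\<lambda>i. s i * S i $ p $ r) * (\<lambda>i. t i * Y i $ r $ q)),
      (\<Sum>r\<in>UNIV. M $ p $ r * N $ r $ q)) \<in> G"
    using S Y by (intro place_sum place_mult G) (auto simp: scaled_limit_def)
  moreover have "(\<Sum>r\<in>F. (\<lambda>i. s i * S i $ p $ r) * (\<lambda>i. t i * Y i $ r $ q)) =
      (\<lambda>i. s i * t i * (\<Sum>r\<in>F. S i $ p $ r * Y i $ r $ q))" if "finite F" for F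
    using that by (induction F) (auto simp: fun_eq_iff algebra_simps)
  ultimately show ?thesis by (simp add: matrix_matrix_mult_def)
qed

text \<open>The scalar is the value of \<open>s * t / u\<close> if this is finite. Otherwise the
  inverse ratio is finite, with a nonzero value because \<open>P\<close> is nonzero. A product can
  thus degenerate to 0 but not change direction.\<close>

lemma scaled_limit_mult:
  fixes G :: "((nat \<Rightarrow> 'k::alg_closed_field) \<times> 'k) set"
  assumes max: "max_place G" and S: "scaled_limit G S s M" and Y: "scaled_limit G Y t N"
    and XY: "scaled_limit G (\<lambda>i. S i ** Y i) u P"
  shows "\<exists>c. M ** N = c *\<^sub>m P"
proof -
  have G: "place G" using max by (rule max_placeD)
  note MN = scaled_limit_mult_entries[OF G S Y]
  have P: "((\<lambda>i. u i * (S i ** Y i) $ p $ q), P $ p $ q) \<in> G" for p q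
    using XY by (simp add: scaled_limit_def)
  have nz: "s i \<noteq> 0" "t i \<noteq> 0" "u i \<noteq> 0" for i using S Y XY by (auto simp: scaled_limit_def)
  have "(\<lambda>i. s i * t i / u i) * (\<lambda>i. u i / (s i * t i)) = 1" using nz by (auto simp: fun_eq_iff)
  then consider c where "((\<lambda>i. s i * t i / u i), c) \<in> G" | c where "((\<lambda>i. u i / (s i * t i)), c) \<in> G"
    using max_place_unit[OF max] by blast
  then show ?thesis
  proof cases
    case 1
    have "(M ** N) $ p $ q = c * P $ p $ q" for p q
    proof -
      have "(\<lambda>i. s i * t i / u i) * (\<lambda>i. u i * (S i ** Y i) $ p $ q) =
          (\<lambda>i. s i * t i * (S i ** Y i) $ p $ q)" using nz by (auto simp: fun_eq_iff)
      then show ?thesis using place_unique[OF G MN] place_mult[OF G 1 P[of p q]] by simp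
    qed
    then show ?thesis by (intro exI[of _ c]) (simp add: vec_eq_iff smat_def)
  next
    case 2
    have *: "P $ p $ q = c * (M ** N) $ p $ q" for p q
    proof -
      have "(\<lambda>i. u i / (s i * t i)) * (\<lambda>i. s i * t i * (S i ** Y i) $ p $ q) =
          (\<lambda>i. u i * (S i ** Y i) $ p $ q)" using nz by (auto simp: fun_eq_iff)
      then show ?thesis using place_unique[OF G P] place_mult[OF G 2 MN[of p q]] by simp
    qed
    have "P \<noteq> 0" using XY by (simp add: scaled_limit_def)
    then have "c \<noteq> 0" using * by (auto simp: vec_eq_iff)
    then show ?thesis using *
      by (intro exI[of _ "inverse c"]) (simp add: vec_eq_iff smat_def)
  qed
qed

lemma scaled_limit_const:
  assumes G: "place G" and S: "scaled_limit G (\<lambda>_. A) s M"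
  shows "\<exists>c. c \<noteq> 0 \<and> M = c *\<^sub>m A"
proof (cases "A = 0")
  case True
  obtain p q where "M $ p $ q \<noteq> 0" using S by (auto simp: scaled_limit_def vec_eq_iff)
  moreover have "((\<lambda>i. s i * A $ p $ q), M $ p $ q) \<in> G" using S by (simp add: scaled_limit_def)
  ultimately show ?thesis using True place_zeroD[OF G, of "M $ p $ q"] by (simp add: zero_fun_def)
next
  case False
  have s: "((\<lambda>i. s i * A $ p $ q), M $ p $ q) \<in> G" for p q using S by (simp add: scaled_limit_def)
  obtain p q where pq: "A $ p $ q \<noteq> 0" using False by (auto simp: vec_eq_iff)
  have "((\<lambda>i. s i * A $ p $ q) * (\<lambda>_. inverse (A $ p $ q)), M $ p $ q * inverse (A $ p $ q)) \<in> G"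
    by (intro place_mult G place_const s)
  moreover have "(\<lambda>i. s i * A $ p $ q) * (\<lambda>_. inverse (A $ p $ q)) = s"
    using pq by (auto simp: fun_eq_iff)
  ultimately obtain c where c: "(s, c) \<in> G" by auto
  have "M $ p' $ q' = c * A $ p' $ q'" for p' q'
    using place_unique[OF G s] place_mult[OF G c place_const[OF G, of "A $ p' $ q'"]]
    by (simp add: times_fun_def)
  then have M: "M = c *\<^sub>m A" by (simp add: vec_eq_iff smat_def)
  moreover have "M \<noteq> 0" using S by (simp add: scaled_limit_def)
  ultimately have "c \<noteq> 0" by (auto simp: vec_eq_iff smat_def)
  then show ?thesis using M by blast
qed

text \<open>The scaled entries are finite while the product of the unscaled ones is infinite, so
  \<open>s * t\<close> has value 0; the unscaled matrix product is constant, hence its scaled form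
  tends to 0.\<close>

lemma scaled_limit_degenerate:
  assumes G: "place G" and S: "scaled_limit G S s M" and Y: "scaled_limit G Y t N"
    and XY: "\<And>i. S i ** Y i = A" and nz: "\<And>i. S i $ p $ q * Y i $ p' $ q' \<noteq> 0"
    and pole: "((\<lambda>i. inverse (S i $ p $ q * Y i $ p' $ q')), 0) \<in> G"
  shows "M ** N = 0"
proof -
  have "((\<lambda>i. s i * S i $ p $ q) * (\<lambda>i. t i * Y i $ p' $ q') * (\<lambda>i. inverse (S i $ p $ q * Y i $ p' $ q')),
      M $ p $ q * N $ p' $ q' * 0) \<in> G"
    using S Y by (intro place_mult G pole) (auto simp: scaled_limit_def)
  moreover have "(\<lambda>i. s i * S i $ p $ q) * (\<lambda>i. t i * Y i $ p' $ q') * (\<lambda>i. inverse (S i $ p $ q * Y i $ p' $ q'))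
      = (\<lambda>i. s i * t i)" using nz by (auto simp: fun_eq_iff field_simps)
  ultimately have st: "((\<lambda>i. s i * t i), 0) \<in> G" by simp
  have "(M ** N) $ a $ b = 0" for a b
    using place_unique[OF G scaled_limit_mult_entries[OF G S Y, of a b]]
      place_mult[OF G st place_const[OF G, of "A $ a $ b"]] by (simp add: XY times_fun_def)
  then show ?thesis by (simp add: vec_eq_iff)
qed

lemma place_lincomb:
  assumes G: "place G" and "\<And>r. r \<in> R \<Longrightarrow> ((\<lambda>i. f i r), v r) \<in> G"
  shows "((\<lambda>i. \<Sum>r\<in>R. f i r * c r), (\<Sum>r\<in>R. v r * c r)) \<in> G"
proof -
  have "((\<Sum>r\<in>R. (\<lambda>i. f i r) * (\<lambda>_. c r)), (\<Sum>r\<in>R. v r * c r)) \<in> G"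
    using assms(2) by (intro place_sum place_mult G place_const)
  moreover have "(\<Sum>r\<in>R. (\<lambda>i. f i r) * (\<lambda>_. c r)) = (\<lambda>i. \<Sum>r\<in>R. f i r * c r)"
    by (induction R rule: infinite_finite_induct) (auto simp: fun_eq_iff)
  ultimately show ?thesis by simp
qed

lemma scaled_limit_fixed_right:
  assumes G: "place G" and S: "scaled_limit G S s M" and B: "\<And>i. S i ** B = S i"
  shows "M ** B = M"
proof -
  have s: "((\<lambda>i. s i * S i $ p $ q), M $ p $ q) \<in> G" for p q using S by (simp add: scaled_limit_def)
  have "(M ** B) $ p $ q = M $ p $ q" for p q
  proof -
    have "S i $ p $ q = (\<Sum>r\<in>UNIV. S i $ p $ r * B $ r $ q)" for i
      using arg_cong[OF B[of i], of "\<lambda>Z. Z $ p $ q"] by (simp add: matrix_matrix_mult_def)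
    then have "(\<lambda>i. \<Sum>r\<in>UNIV. s i * S i $ p $ r * B $ r $ q) = (\<lambda>i. s i * S i $ p $ q)"
      by (simp add: sum_distrib_left mult.assoc)
    moreover have "((\<lambda>i. \<Sum>r\<in>UNIV. s i * S i $ p $ r * B $ r $ q), \<Sum>r\<in>UNIV. M $ p $ r * B $ r $ q) \<in> G"
      by (intro place_lincomb G s)
    ultimately show ?thesis
      using place_unique[OF G s[of p q]] by (simp add: matrix_matrix_mult_def)
  qed
  then show ?thesis by (simp add: vec_eq_iff)
qed

lemma scaled_limit_fixed_left:
  assumes G: "place G" and S: "scaled_limit G S s M" and B: "\<And>i. B ** S i = S i"
  shows "B ** M = M"
proof -
  have s: "((\<lambda>i. s i * S i $ p $ q), M $ p $ q) \<in> G" for p q using S by (simp add: scaled_limit_def)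
  have "(B ** M) $ p $ q = M $ p $ q" for p q
  proof -
    have "S i $ p $ q = (\<Sum>r\<in>UNIV. B $ p $ r * S i $ r $ q)" for i
      using arg_cong[OF B[of i], of "\<lambda>Z. Z $ p $ q"] by (simp add: matrix_matrix_mult_def)
    then have "(\<lambda>i. \<Sum>r\<in>UNIV. s i * S i $ r $ q * B $ p $ r) = (\<lambda>i. s i * S i $ p $ q)"
      by (simp add: sum_distrib_left mult_ac)
    moreover have "((\<lambda>i. \<Sum>r\<in>UNIV. s i * S i $ r $ q * B $ p $ r), \<Sum>r\<in>UNIV. M $ r $ q * B $ p $ r) \<in> G"
      by (intro place_lincomb G s)
    ultimately show ?thesis
      using place_unique[OF G s[of p q]] by (simp add: matrix_matrix_mult_def mult.commute)
  qed
  then show ?thesis by (simp add: vec_eq_iff)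
qed

text \<open>Limits are only defined up to a scalar, so products are preserved up to a scalar, which may
  vanish. The last two conditions allow representations whose identity is a proper idempotent.\<close>

definition reduction :: "((nat \<Rightarrow> 'k::field^'n^'n) \<Rightarrow> 'k^'n^'n) \<Rightarrow> bool" where
  "reduction red \<longleftrightarrow>
    (\<forall>Z. (\<forall>i. Z i \<noteq> 0) \<longrightarrow> red Z \<noteq> 0) \<and>
    (\<forall>Z W. (\<forall>i. Z i ** W i \<noteq> 0) \<longrightarrow> (\<exists>c. red Z ** red W = c *\<^sub>m red (\<lambda>i. Z i ** W i))) \<and>
    (\<forall>Z. Z \<noteq> 0 \<longrightarrow> (\<exists>c. c \<noteq> 0 \<and> red (\<lambda>_. Z) = c *\<^sub>m Z)) \<and>
    (\<forall>Z B. (\<forall>i. Z i \<noteq> 0) \<longrightarrow> (\<forall>i. Z i ** B = Z i) \<longrightarrow> red Z ** B = red Z) \<and>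
    (\<forall>Z B. (\<forall>i. Z i \<noteq> 0) \<longrightarrow> (\<forall>i. B ** Z i = Z i) \<longrightarrow> B ** red Z = red Z)"

theorem degeneration:
  fixes S Y :: "nat \<Rightarrow> 'k::alg_closed_field^'n::finite^'n"
  assumes XY: "\<And>i. S i ** Y i = A" and inj: "inj (\<lambda>i. S i $ p $ q * Y i $ p' $ q')"
    and nz: "\<And>i. S i $ p $ q * Y i $ p' $ q' \<noteq> 0"
  obtains red :: "(nat \<Rightarrow> 'k^'n^'n) \<Rightarrow> 'k^'n^'n" where
    "reduction red" "red S ** red Y = 0"
proof -
  have "inj (\<lambda>i. inverse (S i $ p $ q * Y i $ p' $ q'))"
    using inj unfolding inj_def by (metis inverse_inverse_eq)
  then obtain G where max: "max_place G"
    and pole: "((\<lambda>i. inverse (S i $ p $ q * Y i $ p' $ q')), 0) \<in> G"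
    using max_place_exists by blast
  have G: "place G" using max by (rule max_placeD)
  \<comment> \<open>Limits are unique only up to a scalar, so one is chosen. Sequences containing a
    zero matrix may get an arbitrary value, which \<open>reduction\<close> never inspects.\<close>
  define red where "red Z = (SOME M. \<exists>s. scaled_limit G Z s M)" for Z :: "nat \<Rightarrow> 'k^'n^'n"
  have red: "\<exists>s. scaled_limit G Z s (red Z)" if "\<forall>i. Z i \<noteq> 0" for Z
  proof -
    have "\<exists>M s. scaled_limit G Z s M" using scaled_limit_exists[OF max that] by blast
    then show ?thesis unfolding red_def by (rule someI_ex)
  qed
  have ZW: "Z i \<noteq> 0 \<and> W i \<noteq> 0" if "\<forall>i. Z i ** W i \<noteq> 0" for Z W :: "nat \<Rightarrow> 'k^'n^'n" and i
    using that by (metis times0_left times0_right)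
  have XY0: "S i \<noteq> 0 \<and> Y i \<noteq> 0" for i using nz[of i] by auto
  have "reduction red"
    unfolding reduction_def
  proof (intro conjI allI impI)
    show "red Z \<noteq> 0" if "\<forall>i. Z i \<noteq> 0" for Z using red[OF that] by (auto simp: scaled_limit_def)
    show "\<exists>c. red Z ** red W = c *\<^sub>m red (\<lambda>i. Z i ** W i)" if ZW0: "\<forall>i. Z i ** W i \<noteq> 0" for Z W
    proof -
      have "\<forall>i. Z i \<noteq> 0" "\<forall>i. W i \<noteq> 0" using ZW[OF ZW0] by auto
      then obtain s t u where "scaled_limit G Z s (red Z)" "scaled_limit G W t (red W)"
        "scaled_limit G (\<lambda>i. Z i ** W i) u (red (\<lambda>i. Z i ** W i))"
        using red[of Z] red[of W] red[OF ZW0] by blast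
      then show ?thesis by (rule scaled_limit_mult[OF max])
    qed
    show "\<exists>c. c \<noteq> 0 \<and> red (\<lambda>_. Z) = c *\<^sub>m Z" if "Z \<noteq> 0" for Z
      using red[of "\<lambda>_. Z"] that scaled_limit_const[OF G] by metis
    show "red Z ** B = red Z" if "\<forall>i. Z i \<noteq> 0" "\<forall>i. Z i ** B = Z i" for Z B
      using red[OF that(1)] scaled_limit_fixed_right[OF G] that(2) by blast
    show "B ** red Z = red Z" if "\<forall>i. Z i \<noteq> 0" "\<forall>i. B ** Z i = Z i" for Z B
      using red[OF that(1)] scaled_limit_fixed_left[OF G] that(2) by blast
  qed
  moreover have "red S ** red Y = 0"
    using red[of S] red[of Y] XY0 scaled_limit_degenerate[OF G _ _ XY nz pole] by blast
  ultimately show ?thesis by (rule that)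
qed

section \<open>Subgroups of finite index\<close>

text \<open>The index is relative to an ambient set \<open>N\<close> and expressed by right coset
  representatives, so that chains of subgroups can be handled inside one group without changing its
  carrier.\<close>

definition fin_idx :: "('g, 'b) monoid_scheme \<Rightarrow> 'g set \<Rightarrow> 'g set \<Rightarrow> bool" where
  "fin_idx G N H \<longleftrightarrow> subgroup H G \<and> H \<subseteq> N \<and>
     (\<exists>T. finite T \<and> T \<subseteq> N \<and> (\<forall>x\<in>N. \<exists>t\<in>T. x \<otimes>\<^bsub>G\<^esub> inv\<^bsub>G\<^esub> t \<in> H))"

lemma fin_idx_subgroup: "fin_idx G N H \<Longrightarrow> subgroup H G"
  and fin_idx_subset: "fin_idx G N H \<Longrightarrow> H \<subseteq> N"
  by (auto simp: fin_idx_def)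

context group
begin

lemma inv_cancel:
  assumes "x \<in> carrier G" "y \<in> carrier G"
  shows "inv x \<otimes> (x \<otimes> y) = y" "x \<otimes> (inv x \<otimes> y) = y"
  using assms by (simp_all flip: m_assoc)

text \<open>Each of the finitely many fibres of \<open>f\<close> lies in one right coset of
  \<open>H\<close>, so one point of each fibre suffices as representative.\<close>

lemma fin_idxI:
  assumes "subgroup H G" "H \<subseteq> N" "finite (f ` N)"
    and "\<And>x y. x \<in> N \<Longrightarrow> y \<in> N \<Longrightarrow> f x = f y \<Longrightarrow> x \<otimes> inv y \<in> H"
  shows "fin_idx G N H"
proof -
  define t where "t v = (SOME y. y \<in> N \<and> f y = v)" for v
  have t: "t (f x) \<in> N \<and> f (t (f x)) = f x" if "x \<in> N" for x
    unfolding t_def by (rule someI[of "\<lambda>y. y \<in> N \<and> f y = f x" x]) (use that in simp)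
  show ?thesis
    unfolding fin_idx_def
    using assms(1,2,3) assms(4) t by (intro conjI exI[of _ "t ` f ` N"]) (auto, metis)
qed

lemma fin_idxE:
  assumes "fin_idx G N H" "subgroup N G"
  obtains f :: "'a \<Rightarrow> 'a" where "finite (f ` N)"
    "\<forall>x\<in>N. \<forall>y\<in>N. f x = f y \<longrightarrow> x \<otimes> inv y \<in> H"
proof -
  obtain T where T: "finite T" "T \<subseteq> N" "\<And>x. x \<in> N \<Longrightarrow> \<exists>t\<in>T. x \<otimes> inv t \<in> H"
    using assms(1) unfolding fin_idx_def by blast
  then obtain f where f: "\<And>x. x \<in> N \<Longrightarrow> f x \<in> T \<and> x \<otimes> inv (f x) \<in> H" by metis
  have H: "subgroup H G" using assms(1) by (rule fin_idx_subgroup)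
  have N: "N \<subseteq> carrier G" using assms(2) by (rule subgroup.subset)
  have "finite (f ` N)" using f T(1) by (meson finite_subset image_subsetI)
  moreover have "x \<otimes> inv y \<in> H" if "x \<in> N" "y \<in> N" "f x = f y" for x y
  proof -
    have c: "x \<in> carrier G" "y \<in> carrier G" "f y \<in> carrier G" using that f T(2) N by auto
    have "(x \<otimes> inv (f y)) \<otimes> inv (y \<otimes> inv (f y)) \<in> H"
      using subgroup.m_closed[OF H] subgroup.m_inv_closed[OF H] f[OF that(1)] f[OF that(2)] that(3)
      by metis
    also have "(x \<otimes> inv (f y)) \<otimes> inv (y \<otimes> inv (f y)) = x \<otimes> inv y"
      using c by (simp add: inv_mult_group m_assoc inv_cancel)
    finally show ?thesis .
  qed
  ultimately show ?thesis using that by blast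
qed

lemma fin_idx_refl: "subgroup N G \<Longrightarrow> fin_idx G N N"
  by (rule fin_idxI[where f = "\<lambda>_. undefined"])
    (auto simp: subgroup.m_closed subgroup.m_inv_closed intro: finite_subset[of _ "{undefined}"])

lemma fin_idx_trans:
  assumes "fin_idx G N M" "fin_idx G M H" "subgroup N G"
  shows "fin_idx G N H"
proof -
  obtain S T where T: "finite T" "T \<subseteq> N" "\<And>x. x \<in> N \<Longrightarrow> \<exists>t\<in>T. x \<otimes> inv t \<in> M"
    and S: "finite S" "S \<subseteq> M" "\<And>x. x \<in> M \<Longrightarrow> \<exists>t\<in>S. x \<otimes> inv t \<in> H"
    using assms unfolding fin_idx_def by metis
  have N: "N \<subseteq> carrier G" using assms(3) by (rule subgroup.subset)
  have M: "M \<subseteq> N" "H \<subseteq> M" "subgroup H G" using assms by (auto simp: fin_idx_def)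
  show ?thesis
    unfolding fin_idx_def
  proof (intro conjI exI[of _ "(\<lambda>(s, t). s \<otimes> t) ` (S \<times> T)"] ballI)
    show "(\<lambda>(s, t). s \<otimes> t) ` (S \<times> T) \<subseteq> N"
      using S(2) T(2) M assms(3) by (auto intro!: subgroup.m_closed)
    fix x assume x: "x \<in> N"
    obtain t where t: "t \<in> T" "x \<otimes> inv t \<in> M" using T(3)[OF x] by blast
    obtain s where s: "s \<in> S" "x \<otimes> inv t \<otimes> inv s \<in> H" using S(3)[OF t(2)] by blast
    have "x \<in> carrier G" "t \<in> carrier G" "s \<in> carrier G" using x t s S T M N by auto
    then have "x \<otimes> inv (s \<otimes> t) = x \<otimes> inv t \<otimes> inv s" by (simp add: inv_mult_group m_assoc)
    then show "\<exists>r\<in>(\<lambda>(s, t). s \<otimes> t) ` (S \<times> T). x \<otimes> inv r \<in> H" using s t by force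
  qed (use S(1) T(1) M in auto)
qed

lemma fin_idx_Int:
  assumes "fin_idx G N H" "fin_idx G N H'" "subgroup N G"
  shows "fin_idx G N (H \<inter> H')"
proof -
  obtain f :: "'a \<Rightarrow> 'a" where f: "finite (f ` N)" "\<forall>x\<in>N. \<forall>y\<in>N. f x = f y \<longrightarrow> x \<otimes> inv y \<in> H"
    by (rule fin_idxE[OF assms(1,3)])
  obtain f' :: "'a \<Rightarrow> 'a" where f': "finite (f' ` N)" "\<forall>x\<in>N. \<forall>y\<in>N. f' x = f' y \<longrightarrow> x \<otimes> inv y \<in> H'"
    by (rule fin_idxE[OF assms(2,3)])
  show ?thesis
  proof (rule fin_idxI[where f = "\<lambda>x. (f x, f' x)"])
    show "subgroup (H \<inter> H') G"
      using assms by (auto intro: subgroups_Inter_pair dest: fin_idx_subgroup)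
    show "finite ((\<lambda>x. (f x, f' x)) ` N)"
      by (rule finite_subset[of _ "f ` N \<times> f' ` N"]) (use f(1) f'(1) in auto)
    show "H \<inter> H' \<subseteq> N" using fin_idx_subset[OF assms(1)] by blast
    show "x \<otimes> inv y \<in> H \<inter> H'" if "x \<in> N" "y \<in> N" "(f x, f' x) = (f y, f' y)" for x y
      using f(2) f'(2) that by simp
  qed
qed

lemma fin_idx_mono:
  "fin_idx G N H \<Longrightarrow> H \<subseteq> M \<Longrightarrow> M \<subseteq> N \<Longrightarrow> subgroup M G \<Longrightarrow> fin_idx G N M"
  unfolding fin_idx_def by (elim conjE exE, intro conjI exI) (assumption | fast)+

lemma conj_preimage_subgroup:
  assumes "subgroup H G" "t \<in> carrier G"
  shows "subgroup {x \<in> carrier G. t \<otimes> x \<otimes> inv t \<in> H} G"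
proof
  fix x y assume x: "x \<in> {x \<in> carrier G. t \<otimes> x \<otimes> inv t \<in> H}" and y: "y \<in> {x \<in> carrier G. t \<otimes> x \<otimes> inv t \<in> H}"
  have "(t \<otimes> x \<otimes> inv t) \<otimes> (t \<otimes> y \<otimes> inv t) = t \<otimes> (x \<otimes> y) \<otimes> inv t"
    using x y assms(2) by (simp add: m_assoc inv_cancel)
  then show "x \<otimes> y \<in> {x \<in> carrier G. t \<otimes> x \<otimes> inv t \<in> H}"
    using x y subgroup.m_closed[OF assms(1), of "t \<otimes> x \<otimes> inv t" "t \<otimes> y \<otimes> inv t"] by auto
  have "inv (t \<otimes> x \<otimes> inv t) = t \<otimes> inv x \<otimes> inv t"
    using x assms(2) by (simp add: inv_mult_group m_assoc)
  then show "inv x \<in> {x \<in> carrier G. t \<otimes> x \<otimes> inv t \<in> H}"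
    using x subgroup.m_inv_closed[OF assms(1), of "t \<otimes> x \<otimes> inv t"] by auto
qed (use assms in \<open>auto simp: subgroup.one_closed\<close>)

lemma fin_idx_conj:
  assumes "fin_idx G (carrier G) H" "t \<in> carrier G"
  shows "fin_idx G (carrier G) {x \<in> carrier G. t \<otimes> x \<otimes> inv t \<in> H}"
proof -
  obtain f :: "'a \<Rightarrow> 'a" where f: "finite (f ` carrier G)"
    "\<forall>x\<in>carrier G. \<forall>y\<in>carrier G. f x = f y \<longrightarrow> x \<otimes> inv y \<in> H"
    by (rule fin_idxE[OF assms(1) subgroup_self])
  show ?thesis
  proof (rule fin_idxI[where f = "\<lambda>x. f (t \<otimes> x \<otimes> inv t)"])
    show "finite ((\<lambda>x. f (t \<otimes> x \<otimes> inv t)) ` carrier G)"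
      by (rule finite_subset[OF _ f(1)]) (use assms(2) in auto)
    fix x y assume xy: "x \<in> carrier G" "y \<in> carrier G" "f (t \<otimes> x \<otimes> inv t) = f (t \<otimes> y \<otimes> inv t)"
    have "(t \<otimes> x \<otimes> inv t) \<otimes> inv (t \<otimes> y \<otimes> inv t) \<in> H"
      using f(2) xy assms(2) by blast
    also have "(t \<otimes> x \<otimes> inv t) \<otimes> inv (t \<otimes> y \<otimes> inv t) = t \<otimes> (x \<otimes> inv y) \<otimes> inv t"
      using xy assms(2) by (simp add: inv_mult_group m_assoc inv_cancel)
    finally show "x \<otimes> inv y \<in> {x \<in> carrier G. t \<otimes> x \<otimes> inv t \<in> H}"
      using xy by simp
  qed (use assms in \<open>auto intro: conj_preimage_subgroup dest: fin_idx_subgroup\<close>)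
qed

lemma fin_idx_iff_finite_rcosets:
  assumes H: "subgroup H G"
  shows "fin_idx G (carrier G) H \<longleftrightarrow> finite (rcosets H)"
proof
  assume "finite (rcosets H)"
  moreover have "rcosets H = (\<lambda>x. H #> x) ` carrier G" by (auto simp: RCOSETS_def)
  moreover have "x \<otimes> inv y \<in> H" if xy: "x \<in> carrier G" "y \<in> carrier G" "H #> x = H #> y" for x y
  proof -
    have "x \<in> H #> y" using rcos_self[OF xy(1) H] xy(3) by simp
    then obtain h where "h \<in> H" "x = h \<otimes> y" by (auto simp: r_coset_def)
    then show ?thesis using xy subgroup.mem_carrier[OF H] by (simp add: m_assoc)
  qed
  ultimately show "fin_idx G (carrier G) H"
    by (intro fin_idxI[where f = "\<lambda>x. H #> x"] H) (auto simp: subgroup.subset[OF H])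
next
  assume "fin_idx G (carrier G) H"
  then obtain T where T: "finite T" "T \<subseteq> carrier G"
    "\<And>x. x \<in> carrier G \<Longrightarrow> \<exists>t\<in>T. x \<otimes> inv t \<in> H"
    unfolding fin_idx_def by blast
  have "rcosets H \<subseteq> (\<lambda>x. H #> x) ` T"
  proof
    fix C assume "C \<in> rcosets H"
    then obtain x where x: "x \<in> carrier G" "C = H #> x" by (auto simp: RCOSETS_def)
    then obtain t where t: "t \<in> T" "x \<otimes> inv t \<in> H" using T by blast
    have tc: "t \<in> carrier G" using t T by blast
    have "x = (x \<otimes> inv t) \<otimes> t" using x tc by (simp add: m_assoc)
    then have "x \<in> H #> t" using t(2) unfolding r_coset_def by blast
    then have "H #> x = H #> t" using repr_independence[OF _ tc H] by metis
    then show "C \<in> (\<lambda>x. H #> x) ` T" using t(1) x(2) by blast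
  qed
  then show "finite (rcosets H)" using T(1) finite_surj by blast
qed

text \<open>The conjugation condition for \<open>g\<close> depends only on the coset of
  \<open>g\<close> modulo \<open>H\<close>, so the intersection of all conjugates is one of finitely
  many.\<close>

lemma fin_idx_normal_core:
  assumes "fin_idx G (carrier G) H"
  obtains N where "fin_idx G (carrier G) N" "N \<subseteq> H"
    "\<And>x t. x \<in> N \<Longrightarrow> t \<in> carrier G \<Longrightarrow> t \<otimes> x \<otimes> inv t \<in> N"
proof
  have H: "subgroup H G" using assms by (rule fin_idx_subgroup)
  let ?N = "{x \<in> carrier G. \<forall>t\<in>carrier G. t \<otimes> x \<otimes> inv t \<in> H}"
  have N_eq: "?N = (\<Inter>t\<in>carrier G. {x \<in> carrier G. t \<otimes> x \<otimes> inv t \<in> H})" by auto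
  have sN: "subgroup ?N G"
    unfolding N_eq by (rule subgroups_Inter) (auto intro: conj_preimage_subgroup H)
  obtain T where T: "finite T" "T \<subseteq> carrier G"
    "\<And>x. x \<in> carrier G \<Longrightarrow> \<exists>t\<in>T. x \<otimes> inv t \<in> H"
    using assms unfolding fin_idx_def by blast
  have fin: "fin_idx G (carrier G) (carrier G \<inter> (\<Inter>t\<in>S. {x \<in> carrier G. inv t \<otimes> x \<otimes> inv (inv t) \<in> H}))"
    if "finite S" "S \<subseteq> m_inv G ` T" for S
    using that
  proof (induction S)
    case empty
    then show ?case using fin_idx_refl[OF subgroup_self] by simp
  next
    case (insert t S)
    then have "t \<in> carrier G" using T(2) by auto
    then show ?case
      using fin_idx_Int[OF insert.IH fin_idx_conj[OF assms, of "inv t"] subgroup_self] insert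
      by (auto simp: Int_ac)
  qed
  show "fin_idx G (carrier G) ?N"
  proof (rule fin_idx_mono[OF fin[of "m_inv G ` T"] _ _ sN])
    show "carrier G \<inter> (\<Inter>t\<in>m_inv G ` T. {x \<in> carrier G. inv t \<otimes> x \<otimes> inv (inv t) \<in> H}) \<subseteq> ?N"
    proof safe
      fix x g assume x: "x \<in> carrier G" and g: "g \<in> carrier G"
        and *: "x \<in> (\<Inter>t\<in>m_inv G ` T. {x \<in> carrier G. inv t \<otimes> x \<otimes> inv (inv t) \<in> H})"
      obtain t where t: "t \<in> T" "g \<otimes> inv t \<in> H" using T(3)[OF g] by blast
      have tc: "t \<in> carrier G" using t T by blast
      have "inv (inv t) \<otimes> x \<otimes> inv (inv (inv t)) \<in> H" using * t(1) by blast
      then have "t \<otimes> x \<otimes> inv t \<in> H" using tc by simp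
      then have "(g \<otimes> inv t) \<otimes> (t \<otimes> x \<otimes> inv t) \<otimes> inv (g \<otimes> inv t) \<in> H"
        using t(2) subgroup.m_closed[OF H] subgroup.m_inv_closed[OF H] by metis
      also have "(g \<otimes> inv t) \<otimes> (t \<otimes> x \<otimes> inv t) \<otimes> inv (g \<otimes> inv t) = g \<otimes> x \<otimes> inv g"
        using x g tc by (simp add: inv_mult_group m_assoc inv_cancel)
      finally show "g \<otimes> x \<otimes> inv g \<in> H" .
    qed
  qed (use T in auto)
  show "?N \<subseteq> H"
  proof
    fix x assume "x \<in> ?N"
    then have x: "x \<in> carrier G" "\<forall>t\<in>carrier G. t \<otimes> x \<otimes> inv t \<in> H" by auto
    then show "x \<in> H" using bspec[OF x(2) one_closed] by simp
  qed
  fix x t assume x: "x \<in> ?N" and t: "t \<in> carrier G"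
  have "g \<otimes> (t \<otimes> x \<otimes> inv t) \<otimes> inv g \<in> H" if g: "g \<in> carrier G" for g
  proof -
    have "(g \<otimes> t) \<otimes> x \<otimes> inv (g \<otimes> t) \<in> H" using x t g by auto
    also have "(g \<otimes> t) \<otimes> x \<otimes> inv (g \<otimes> t) = g \<otimes> (t \<otimes> x \<otimes> inv t) \<otimes> inv g"
      using x t g by (simp add: inv_mult_group m_assoc)
    finally show ?thesis .
  qed
  then show "t \<otimes> x \<otimes> inv t \<in> ?N" using x t by auto
qed

end

section \<open>Noetherian families of subsets of a group\<close>

locale noetherian_translation_family = group +
  fixes N :: "'a set" and \<F> :: "'a set set" and d :: "'a set \<Rightarrow> nat"
  assumes N: "subgroup N G"
    and top: "N \<in> \<F>" and sub: "\<And>F. F \<in> \<F> \<Longrightarrow> F \<subseteq> N"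
    and inter: "\<And>E F. E \<in> \<F> \<Longrightarrow> F \<in> \<F> \<Longrightarrow> E \<inter> F \<in> \<F>"
    and translate: "\<And>F g. F \<in> \<F> \<Longrightarrow> g \<in> N \<Longrightarrow> {u \<in> N. g \<otimes> u \<in> F} \<in> \<F>"
    and dim_less: "\<And>E F. E \<in> \<F> \<Longrightarrow> F \<in> \<F> \<Longrightarrow> E \<subset> F \<Longrightarrow> d E < d F"
begin

text \<open>The members of \<open>\<F>\<close> act as basic closed sets: they are closed under
  intersections, but unions need not be members. Irreducibility is therefore tested against finite
  covers.\<close>

definition irred :: "'a set \<Rightarrow> bool" where
  "irred F \<longleftrightarrow> F \<in> \<F> \<and> F \<noteq> {} \<and> (\<forall>Q. finite Q \<longrightarrow> Q \<subseteq> \<F> \<longrightarrow> F \<subseteq> \<Union>Q \<longrightarrow> (\<exists>Z\<in>Q. F \<subseteq> Z))"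

lemma irred_decomposition:
  "F \<in> \<F> \<Longrightarrow> \<exists>P. finite P \<and> (\<forall>C\<in>P. irred C) \<and> \<Union>P = F"
proof (induction "d F" arbitrary: F rule: less_induct)
  case less
  show ?case
  proof (cases "F = {} \<or> irred F")
    case True
    then show ?thesis
    proof
      assume "F = {}" then show ?thesis by (intro exI[of _ "{}"]) auto
    next
      assume "irred F" then show ?thesis by (intro exI[of _ "{F}"]) auto
    qed
  next
    case False
    then obtain Q where Q: "finite Q" "Q \<subseteq> \<F>" "F \<subseteq> \<Union>Q" "\<And>Z. Z \<in> Q \<Longrightarrow> \<not> F \<subseteq> Z"
      using less.prems unfolding irred_def by blast
    have "\<exists>P. finite P \<and> (\<forall>C\<in>P. irred C) \<and> \<Union>P = F \<inter> Z" if "Z \<in> Q" for Z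
    proof -
      have "F \<inter> Z \<in> \<F>" using that Q(2) less.prems inter by blast
      moreover have "F \<inter> Z \<subset> F" using Q(4)[OF that] by blast
      ultimately show ?thesis using less.hyps[of "F \<inter> Z"] dim_less less.prems by blast
    qed
    then obtain P where P: "\<And>Z. Z \<in> Q \<Longrightarrow> finite (P Z) \<and> (\<forall>C\<in>P Z. irred C) \<and> \<Union>(P Z) = F \<inter> Z"
      by metis
    have "\<Union>(\<Union>Z\<in>Q. P Z) = (\<Union>Z\<in>Q. F \<inter> Z)" using P by fastforce
    also have "\<dots> = F" using Q(3) by blast
    finally show ?thesis using P Q(1) by (intro exI[of _ "\<Union>Z\<in>Q. P Z"]) auto
  qed
qed

lemma translate_translate:
  assumes "F \<subseteq> N" "g \<in> N" "h \<in> N"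
  shows "{u \<in> N. g \<otimes> u \<in> {u \<in> N. h \<otimes> u \<in> F}} = {u \<in> N. (h \<otimes> g) \<otimes> u \<in> F}"
  using assms subgroup.m_closed[OF N] subgroup.mem_carrier[OF N] by (auto simp: m_assoc)

lemma translate_one: "F \<subseteq> N \<Longrightarrow> {u \<in> N. \<one> \<otimes> u \<in> F} = F"
  using subgroup.mem_carrier[OF N] by auto

lemma translate_inv:
  assumes "F \<subseteq> N" "g \<in> N"
  shows "{u \<in> N. g \<otimes> u \<in> {u \<in> N. inv g \<otimes> u \<in> F}} = F"
    and "{u \<in> N. inv g \<otimes> u \<in> {u \<in> N. g \<otimes> u \<in> F}} = F"
  using assms subgroup.m_inv_closed[OF N] subgroup.mem_carrier[OF N, of g]
  by (simp_all add: translate_translate translate_one del: mem_Collect_eq)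

lemma irred_translate:
  assumes "irred C" "g \<in> N"
  shows "irred {u \<in> N. g \<otimes> u \<in> C}"
proof -
  have C: "C \<in> \<F>" "C \<subseteq> N" "C \<noteq> {}" using assms(1) sub unfolding irred_def by auto
  have ig: "inv g \<in> N" using assms(2) subgroup.m_inv_closed[OF N] by blast
  have ne: "{u \<in> N. g \<otimes> u \<in> C} \<noteq> {}"
    using translate_inv(2)[OF C(2) assms(2)] C(3) by force
  have "\<exists>Z\<in>Q. {u \<in> N. g \<otimes> u \<in> C} \<subseteq> Z" if Q: "finite Q" "Q \<subseteq> \<F>" "{u \<in> N. g \<otimes> u \<in> C} \<subseteq> \<Union>Q" for Q
  proof -
    let ?Q = "(\<lambda>Z. {u \<in> N. inv g \<otimes> u \<in> Z}) ` Q"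
    have "C = {u \<in> N. inv g \<otimes> u \<in> {u \<in> N. g \<otimes> u \<in> C}}" using translate_inv(2)[OF C(2) assms(2)] by simp
    also have "\<dots> \<subseteq> \<Union>?Q" using Q(3) by blast
    finally have "C \<subseteq> \<Union>?Q" .
    moreover have "?Q \<subseteq> \<F>" using Q(2) translate ig by blast
    ultimately obtain Z where Z: "Z \<in> Q" "C \<subseteq> {u \<in> N. inv g \<otimes> u \<in> Z}"
      using assms(1) Q(1) unfolding irred_def by (metis (no_types, lifting) finite_imageI imageE)
    have "{u \<in> N. g \<otimes> u \<in> C} \<subseteq> {u \<in> N. g \<otimes> u \<in> {u \<in> N. inv g \<otimes> u \<in> Z}}" using Z(2) by blast
    also have "\<dots> = Z" using translate_inv(1) assms(2) Z(1) Q(2) sub by blast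
    finally show ?thesis using Z(1) by blast
  qed
  then show ?thesis unfolding irred_def using ne translate[OF C(1) assms(2)] by blast
qed

text \<open>This is the argument that an identity component has finite index. All translates of a
  maximal component \<open>C\<close> occur in the finite set \<open>P\<close>, so the stabiliser
  \<open>S\<close> has finite index; \<open>C\<close> lies in a single \<open>Z\<close>, which then
  contains \<open>S\<close> times any point of \<open>C\<close>.\<close>

theorem finite_cover_contains_coset:
  assumes Q: "finite Q" "Q \<subseteq> \<F>" "N \<subseteq> \<Union>Q"
  obtains Z S x where "Z \<in> Q" "fin_idx G N S" "x \<in> N" "\<And>s. s \<in> S \<Longrightarrow> s \<otimes> x \<in> Z"
proof -
  obtain P where P: "finite P" "\<And>C. C \<in> P \<Longrightarrow> irred C" "\<Union>P = N"
    using irred_decomposition[OF top] by blast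
  have "P \<noteq> {}" using P(3) subgroup.one_closed[OF N] by blast
  then obtain C where C: "C \<in> P" and max: "\<And>Y. Y \<in> P \<Longrightarrow> C \<subseteq> Y \<Longrightarrow> Y = C"
    using finite_has_maximal[OF P(1)] by metis
  have Xi: "irred C" "C \<subseteq> N" "C \<in> \<F>" using P(2)[OF C] sub unfolding irred_def by auto
  have PF: "P \<subseteq> \<F>" using P(2) unfolding irred_def by blast
  let ?t = "\<lambda>g. {u \<in> N. g \<otimes> u \<in> C}"
  have t_in: "?t g \<in> P" if g: "g \<in> N" for g
  proof -
    have ig: "inv g \<in> N" using g subgroup.m_inv_closed[OF N] by blast
    have in_P: "\<exists>Y\<in>P. F \<subseteq> Y" if "irred F" for F
    proof -
      have "F \<subseteq> \<Union>P" using that sub P(3) unfolding irred_def by blast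
      then show ?thesis using that P(1) PF unfolding irred_def by blast
    qed
    \<comment> \<open>Moving \<open>C\<close> into \<open>Y\<close> and \<open>Y\<close> back into
      \<open>Y'\<close> gives \<open>C \<subseteq> Y'\<close>; maximality of \<open>C\<close> forces
      equality throughout. So the translate of \<open>C\<close> equals a member of \<open>P\<close>
      and is not merely contained in one.\<close>
    obtain Y where Y: "Y \<in> P" "?t g \<subseteq> Y" using in_P[OF irred_translate[OF Xi(1) g]] by blast
    obtain Y' where Y': "Y' \<in> P" "{u \<in> N. inv g \<otimes> u \<in> Y} \<subseteq> Y'"
      using in_P[OF irred_translate[OF P(2)[OF Y(1)] ig]] by blast
    have "C = {u \<in> N. inv g \<otimes> u \<in> ?t g}" using translate_inv(2)[OF Xi(2) g] by simp
    also have "\<dots> \<subseteq> {u \<in> N. inv g \<otimes> u \<in> Y}" using Y(2) by blast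
    finally have sub1: "C \<subseteq> {u \<in> N. inv g \<otimes> u \<in> Y}" .
    then have "Y' = C" using max Y' by blast
    then have X_eq: "C = {u \<in> N. inv g \<otimes> u \<in> Y}" using sub1 Y'(2) by blast
    have "Y \<subseteq> N" using Y(1) P(3) by blast
    then have "?t g = Y" using translate_inv(1)[OF _ g, of Y] X_eq by simp
    then show ?thesis using Y(1) by simp
  qed
  define S where "S = {g \<in> N. ?t g = C}"
  have SN: "S \<subseteq> N" by (auto simp: S_def)
  have S: "subgroup S G"
  proof
    show "S \<subseteq> carrier G" using SN subgroup.subset[OF N] by blast
    show "\<one> \<in> S" using subgroup.one_closed[OF N] translate_one[OF Xi(2)] by (simp add: S_def)
    fix g h assume gh: "g \<in> S" "h \<in> S"
    then have N2: "g \<in> N" "h \<in> N" by (auto simp: S_def)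
    have "?t (g \<otimes> h) = {u \<in> N. h \<otimes> u \<in> ?t g}"
      by (rule translate_translate[OF Xi(2) N2(2,1), symmetric])
    moreover have "?t g = C" "?t h = C" using gh by (auto simp: S_def)
    ultimately have "?t (g \<otimes> h) = C" by (simp only:)
    then show "g \<otimes> h \<in> S" using subgroup.m_closed[OF N N2] by (simp add: S_def)
  next
    fix g assume g: "g \<in> S"
    then have "?t g = C" "g \<in> N" by (auto simp: S_def)
    then have "?t (inv g) = C" using translate_inv(2)[OF Xi(2), of g] by (simp only:)
    then show "inv g \<in> S" using \<open>g \<in> N\<close> subgroup.m_inv_closed[OF N] by (simp add: S_def)
  qed
  have "fin_idx G N S"
  proof (rule fin_idxI[OF S SN])
    show "finite (?t ` N)" by (rule finite_subset[OF _ P(1)]) (use t_in in blast)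
    fix g h assume gh: "g \<in> N" "h \<in> N" "?t g = ?t h"
    have ih: "inv h \<in> N" using gh subgroup.m_inv_closed[OF N] by blast
    have "?t (g \<otimes> inv h) = {u \<in> N. inv h \<otimes> u \<in> ?t g}"
      by (rule translate_translate[OF Xi(2) ih gh(1), symmetric])
    also have "\<dots> = C" unfolding gh(3) by (rule translate_inv(2)[OF Xi(2) gh(2)])
    finally show "g \<otimes> inv h \<in> S" using subgroup.m_closed[OF N gh(1) ih] by (simp add: S_def)
  qed
  moreover obtain Z where Z: "Z \<in> Q" "C \<subseteq> Z"
    using Xi(1,2) Q unfolding irred_def by (meson subset_trans)
  moreover obtain x where x: "x \<in> C" using Xi(1) unfolding irred_def by blast
  moreover have "s \<otimes> x \<in> Z" if "s \<in> S" for s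
  proof -
    have "?t (inv s) = C" and sN: "s \<in> N" using subgroup.m_inv_closed[OF S that] that by (auto simp: S_def)
    have xN: "x \<in> N" using x Xi(2) by blast
    have "inv s \<otimes> (s \<otimes> x) = x"
      using sN xN subgroup.mem_carrier[OF N] by (simp flip: m_assoc)
    then have "s \<otimes> x \<in> ?t (inv s)" using x subgroup.m_closed[OF N sN xN] by simp
    then show ?thesis using \<open>?t (inv s) = C\<close> Z(2) by blast
  qed
  ultimately show ?thesis using that Xi(2) by blast
qed

end

section \<open>Strongly irreducible representations\<close>

lemma sum_fun_apply: "sum f I x = (\<Sum>i\<in>I. f i x)"
  by (induction I rule: infinite_finite_induct) auto

interpretation fun_space: vector_space "\<lambda>(c :: 'k::field) (f :: 'x \<Rightarrow> 'k) x. c * f x"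
  by standard (auto simp: fun_eq_iff algebra_simps)

lemma (in vector_space) dim_less_of_psubset:
  assumes "finite T" "V \<subseteq> span T" "subspace U" "subspace V" "U \<subset> V"
  shows "dim U < dim V" "dim V \<le> card T"
proof -
  obtain B where B: "B \<subseteq> U" "independent B" "U \<subseteq> span B"
    using maximal_independent_subset by blast
  obtain C where C: "B \<subseteq> C" "C \<subseteq> V" "independent C" "V \<subseteq> span C"
    using maximal_independent_subset_extend[of B V] B assms(5) by blast
  have fin: "finite C" "card C \<le> card T"
    using independent_span_bound[OF assms(1) C(3)] C(2) assms(2) by auto
  have "span B = U" "span C = V"
    using B C assms(3,4) by (auto simp: span_minimal subset_antisym)
  then have "B \<noteq> C" using assms(5) by auto
  then have "card B < card C" using C(1) fin(1) psubset_card_mono by blast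
  moreover have "dim U = card B" "dim V = card C"
    using B C basis_card_eq_dim by auto
  ultimately show "dim U < dim V" "dim V \<le> card T" using fin(2) by auto
qed

text \<open>Zero loci inside \<open>N\<close> of a finite-dimensional space of functions that is stable under
  left translation satisfy the descending chain condition, so \<open>N\<close> carries a Noetherian
  topology in which translations are homeomorphisms.\<close>

lemma (in group) zero_loci_cover:
  fixes B0 :: "('a \<Rightarrow> 'k::field) set"
  assumes N: "subgroup N G" and B0: "finite B0"
    and trans: "\<And>f g. f \<in> B0 \<Longrightarrow> g \<in> N \<Longrightarrow> \<exists>h\<in>fun_space.span B0. \<forall>u\<in>N. f (g \<otimes> u) = h u"
    and Q: "finite Q" "\<And>M. M \<in> Q \<Longrightarrow> M \<subseteq> fun_space.span B0"
    and cover: "\<And>u. u \<in> N \<Longrightarrow> \<exists>M\<in>Q. \<forall>f\<in>M. f u = 0"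
  obtains M S x where "M \<in> Q" "fin_idx G N S" "x \<in> N" "\<And>s f. s \<in> S \<Longrightarrow> f \<in> M \<Longrightarrow> f (s \<otimes> x) = 0"
proof -
  let ?L = "fun_space.span B0"
  define V where "V M = {u \<in> N. \<forall>f\<in>M. f u = 0}" for M :: "('a \<Rightarrow> 'k) set"
  \<comment> \<open>Loci and annihilators form a Galois connection: strictly larger loci have
    annihilators of strictly smaller dimension. The bound by \<open>card B0\<close> keeps the
    truncated codimension used below strictly monotone.\<close>
  define ann where "ann F = {f \<in> ?L. \<forall>u\<in>F. f u = 0}" for F
  define \<F> where "\<F> = V ` Pow ?L"
  have V_ann: "V (ann F) = F" if "F \<in> \<F>" for F
    using that unfolding \<F>_def V_def ann_def by auto
  have ann_sub: "fun_space.subspace (ann F)" for F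
    unfolding fun_space.subspace_def ann_def
    by (auto intro: fun_space.span_zero fun_space.span_add fun_space.span_scale)
  have ann_less: "fun_space.dim (ann F) < fun_space.dim (ann E)" "fun_space.dim (ann E) \<le> card B0"
    if "E \<in> \<F>" "F \<in> \<F>" "E \<subset> F" for E F
  proof -
    have "ann F \<noteq> ann E" using V_ann[OF that(1)] V_ann[OF that(2)] that(3) by auto
    then have "ann F \<subset> ann E" using that(3) unfolding ann_def by blast
    moreover have "ann E \<subseteq> ?L" unfolding ann_def by blast
    ultimately show "fun_space.dim (ann F) < fun_space.dim (ann E)" "fun_space.dim (ann E) \<le> card B0"
      using fun_space.dim_less_of_psubset[OF B0 _ ann_sub ann_sub] by blast+
  qed
  have transL: "\<exists>h\<in>?L. \<forall>u\<in>N. f (g \<otimes> u) = h u" if f: "f \<in> ?L" and g: "g \<in> N" for f g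
    using f
  proof (induction rule: fun_space.span_induct_alt)
    case base
    show ?case by (intro bexI[of _ 0]) (auto intro: fun_space.span_zero)
  next
    case (step c f f')
    obtain h where h: "h \<in> ?L" "\<forall>u\<in>N. f (g \<otimes> u) = h u" using trans[OF step(1) g] by blast
    obtain h' where h': "h' \<in> ?L" "\<forall>u\<in>N. f' (g \<otimes> u) = h' u" using step(2) by blast
    show ?case
      using h h' by (intro bexI[of _ "(\<lambda>x. c * h x) + h'"])
        (auto intro: fun_space.span_add fun_space.span_scale)
  qed
  interpret noetherian_translation_family G N \<F> "\<lambda>F. card B0 - fun_space.dim (ann F)"
  proof (intro noetherian_translation_family.intro noetherian_translation_family_axioms.intro)
    show "group G" by (rule is_group)
    show "subgroup N G" by fact
    have "V {} = N" by (auto simp: V_def)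
    then show "N \<in> \<F>" unfolding \<F>_def by blast
    show "F \<subseteq> N" if "F \<in> \<F>" for F using that unfolding \<F>_def V_def by auto
    show "E \<inter> F \<in> \<F>" if EF: "E \<in> \<F>" "F \<in> \<F>" for E F
    proof -
      obtain M M' where "M \<subseteq> ?L" "M' \<subseteq> ?L" "E = V M" "F = V M'" using EF unfolding \<F>_def by blast
      moreover have "V (M \<union> M') = V M \<inter> V M'" by (auto simp: V_def)
      ultimately show ?thesis unfolding \<F>_def by blast
    qed
    show "{u \<in> N. g \<otimes> u \<in> F} \<in> \<F>" if F: "F \<in> \<F>" and "g \<in> N" for F g
    proof -
      obtain M where M: "M \<subseteq> ?L" "F = V M" using F unfolding \<F>_def by blast
      define M' where "M' = {h \<in> ?L. \<exists>f\<in>M. \<forall>u\<in>N. f (g \<otimes> u) = h u}"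
      have "{u \<in> N. g \<otimes> u \<in> F} = V M'"
      proof safe
        fix u assume u: "u \<in> N" "g \<otimes> u \<in> F"
        then show "u \<in> V M'" unfolding M(2) V_def M'_def by force
      next
        fix u assume u: "u \<in> V M'"
        then show uN: "u \<in> N" by (simp add: V_def)
        have "f (g \<otimes> u) = 0" if "f \<in> M" for f
        proof -
          obtain h where "h \<in> ?L" "\<forall>u\<in>N. f (g \<otimes> u) = h u" using transL \<open>g \<in> N\<close> \<open>f \<in> M\<close> M(1) by blast
          then show ?thesis using u uN \<open>f \<in> M\<close> unfolding V_def M'_def by force
        qed
        then show "g \<otimes> u \<in> F" using subgroup.m_closed[OF N \<open>g \<in> N\<close> uN] unfolding M(2) V_def by blast
      qed
      moreover have "M' \<subseteq> ?L" unfolding M'_def by blast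
      ultimately show ?thesis unfolding \<F>_def by blast
    qed
    show "card B0 - fun_space.dim (ann E) < card B0 - fun_space.dim (ann F)"
      if "E \<in> \<F>" "F \<in> \<F>" "E \<subset> F" for E F
      using ann_less[OF that] by linarith
  qed
  have "finite (V ` Q)" "V ` Q \<subseteq> \<F>" using Q unfolding \<F>_def by blast+
  moreover have "N \<subseteq> \<Union>(V ` Q)" using cover unfolding V_def by blast
  ultimately obtain Z S x where Z: "Z \<in> V ` Q" "fin_idx G N S" "x \<in> N" "\<And>s. s \<in> S \<Longrightarrow> s \<otimes> x \<in> Z"
    by (rule finite_cover_contains_coset) blast
  then obtain M where "M \<in> Q" "Z = V M" by blast
  then show ?thesis using that Z unfolding V_def by blast
qed

lemma smat_simps:
  fixes A :: "'k::field^'n^'m"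
  shows "(c *\<^sub>m A) ** B = c *\<^sub>m (A ** B)"
    and "A ** (c *\<^sub>m C) = c *\<^sub>m (A ** C)"
    and "c *\<^sub>m d *\<^sub>m A = (c * d) *\<^sub>m A"
    and "1 *\<^sub>m A = A"
    and "c *\<^sub>m A = 0 \<longleftrightarrow> c = 0 \<or> A = 0"
    and "(c *\<^sub>m A) *v v = c *s (A *v v)"
proof -
  show "(c *\<^sub>m A) ** B = c *\<^sub>m (A ** B)"
    by (simp add: smat_def vec_eq_iff matrix_matrix_mult_def sum_distrib_left mult.assoc)
  show "A ** (c *\<^sub>m C) = c *\<^sub>m (A ** C)"
    by (simp add: smat_def vec_eq_iff matrix_matrix_mult_def sum_distrib_left mult.left_commute)
  show "(c *\<^sub>m A) *v v = c *s (A *v v)"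
    by (simp add: smat_def vec_eq_iff matrix_vector_mult_def sum_distrib_left mult.assoc)
  show "c *\<^sub>m d *\<^sub>m A = (c * d) *\<^sub>m A"
    by (simp only: smat_def vec_eq_iff vec_lambda_beta mult.assoc simp_thms)
  show "1 *\<^sub>m A = A"
    by (simp add: smat_def)
  show "c *\<^sub>m A = 0 \<longleftrightarrow> c = 0 \<or> A = 0"
    by (cases "c = 0") (simp_all add: smat_def vec_eq_iff)
qed

lemma smat_zero [simp]: "(0::'k::field) *\<^sub>m A = 0" "c *\<^sub>m (0 :: 'k^'n^'m) = 0"
  by (simp_all add: smat_simps(5))

lemma matrix_nonzero_vector:
  fixes A :: "'k::field^'n^'m"
  assumes "A \<noteq> 0" obtains v where "A *v v \<noteq> 0"
proof -
  have "\<exists>v. A *v v \<noteq> 0"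
  proof (rule ccontr)
    assume "\<nexists>v. A *v v \<noteq> 0"
    then have "\<forall>x. A *v x = 0 *v x" by simp
    then have "A = 0" using matrix_eq[of A 0] by simp
    then show False using assms by simp
  qed
  then show ?thesis using that by blast
qed

section \<open>Conjugation and signs of group elements\<close>

context group
begin

definition cj :: "'a \<Rightarrow> 'a \<Rightarrow> 'a" where "cj t x = t \<otimes> x \<otimes> inv t"

definition sg :: "bool \<Rightarrow> 'a \<Rightarrow> 'a" where "sg b x = (if b then x else inv x)"

lemma cj_closed [simp]: "t \<in> carrier G \<Longrightarrow> x \<in> carrier G \<Longrightarrow> cj t x \<in> carrier G"
  by (simp add: cj_def)

lemma cj_mult:
  "t \<in> carrier G \<Longrightarrow> x \<in> carrier G \<Longrightarrow> y \<in> carrier G \<Longrightarrow> cj t (x \<otimes> y) = cj t x \<otimes> cj t y"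
  by (simp add: cj_def m_assoc inv_cancel)

lemma cj_inv: "t \<in> carrier G \<Longrightarrow> x \<in> carrier G \<Longrightarrow> cj t (inv x) = inv (cj t x)"
  by (simp add: cj_def inv_mult_group m_assoc)

lemma cj_cj:
  "s \<in> carrier G \<Longrightarrow> t \<in> carrier G \<Longrightarrow> x \<in> carrier G \<Longrightarrow> cj s (cj t x) = cj (s \<otimes> t) x"
  by (simp add: cj_def inv_mult_group m_assoc)

lemma cj_cancel:
  assumes "t \<in> carrier G" "x \<in> carrier G"
  shows "cj t (cj (inv t) x) = x" "cj (inv t) (cj t x) = x"
  using assms by (simp_all add: cj_cj) (simp_all add: cj_def)

lemma sg_closed [simp]: "x \<in> carrier G \<Longrightarrow> sg b x \<in> carrier G"
  by (simp add: sg_def)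

lemma sg_sg: "x \<in> carrier G \<Longrightarrow> sg b (sg b x) = x"
  by (simp add: sg_def)

lemma sg_mult3:
  assumes "x \<in> carrier G" "u \<in> carrier G" "y \<in> carrier G"
  shows "sg b (x \<otimes> u \<otimes> y) = sg b (if b then x else y) \<otimes> sg b u \<otimes> sg b (if b then y else x)"
  using assms by (simp add: sg_def inv_mult_group m_assoc)

end

text \<open>\<open>\<rho> \<one>\<close> may be a proper idempotent, so that the action on a
  subquotient can be written with matrices of full size. The last axiom is irreducibility in
  bilinear form: the orbit under \<open>M\<close> of a nonzero vector is not contained in the kernel
  of a nonzero map. Demanding it for every finite-index \<open>M\<close> is strong
  irreducibility.\<close>

locale strongly_irreducible_rep = group G for G :: "('a, 'b) monoid_scheme" (structure) +
  fixes N :: "'a set" and \<rho> :: "'a \<Rightarrow> 'k::alg_closed_field^'n::finite^'n"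
  assumes fin_N: "fin_idx G (carrier G) N"
    and normal: "\<And>x t. x \<in> N \<Longrightarrow> t \<in> carrier G \<Longrightarrow> t \<otimes> x \<otimes> inv t \<in> N"
    and hom: "\<And>x y. x \<in> N \<Longrightarrow> y \<in> N \<Longrightarrow> \<rho> (x \<otimes> y) = \<rho> x ** \<rho> y"
    and one_nonzero: "\<rho> \<one> \<noteq> 0"
    and irreducible: "\<And>M A B. fin_idx G (carrier G) M \<Longrightarrow> M \<subseteq> N \<Longrightarrow> A ** \<rho> \<one> \<noteq> 0 \<Longrightarrow>
      \<rho> \<one> ** B \<noteq> 0 \<Longrightarrow> \<exists>x\<in>M. A ** \<rho> x ** B \<noteq> (0 :: 'k^'n^'n)"
begin

lemma N: "subgroup N G" using fin_N by (rule fin_idx_subgroup)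

lemma N_carrier [simp]: "x \<in> N \<Longrightarrow> x \<in> carrier G" using subgroup.mem_carrier[OF N] .
lemma N_mult [simp]: "x \<in> N \<Longrightarrow> y \<in> N \<Longrightarrow> x \<otimes> y \<in> N" using subgroup.m_closed[OF N] .
lemma N_inv [simp]: "x \<in> N \<Longrightarrow> inv x \<in> N" using subgroup.m_inv_closed[OF N] .
lemma N_one [simp]: "\<one> \<in> N" using subgroup.one_closed[OF N] .
lemma N_cj [simp]: "x \<in> N \<Longrightarrow> t \<in> carrier G \<Longrightarrow> cj t x \<in> N" using normal by (simp add: cj_def)
lemma N_sg [simp]: "x \<in> N \<Longrightarrow> sg b x \<in> N" by (simp add: sg_def)

lemma rho_one: "x \<in> N \<Longrightarrow> \<rho> x ** \<rho> \<one> = \<rho> x" "x \<in> N \<Longrightarrow> \<rho> \<one> ** \<rho> x = \<rho> x"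
  using hom[of x \<one>] hom[of \<one> x] by auto

lemma rho_inv: "x \<in> N \<Longrightarrow> \<rho> x ** \<rho> (inv x) = \<rho> \<one>" "x \<in> N \<Longrightarrow> \<rho> (inv x) ** \<rho> x = \<rho> \<one>"
  using hom[of x "inv x"] hom[of "inv x" x] by auto

lemma rho_nonzero: "x \<in> N \<Longrightarrow> \<rho> x \<noteq> 0"
  using rho_inv[of x] one_nonzero by auto

text \<open>The twist by \<open>t\<close> replaces \<open>M\<close> by \<open>t M t^-1\<close>,
  again of finite index and, by normality, inside \<open>N\<close>.\<close>

lemma irreducible_cj:
  assumes M: "fin_idx G (carrier G) M" "M \<subseteq> N" and t: "t \<in> carrier G"
    and "A ** \<rho> \<one> \<noteq> 0" "\<rho> \<one> ** B \<noteq> 0"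
  shows "\<exists>x\<in>M. A ** \<rho> (cj t x) ** B \<noteq> (0 :: 'k^'n^'n)"
proof -
  let ?M = "{x \<in> carrier G. inv t \<otimes> x \<otimes> inv (inv t) \<in> M}"
  have "fin_idx G (carrier G) ?M" using fin_idx_conj[OF M(1), of "inv t"] t by simp
  moreover have "?M \<subseteq> N"
  proof
    fix x assume "x \<in> ?M"
    then have "x \<in> carrier G" "cj (inv t) x \<in> N" using M(2) by (auto simp: cj_def)
    then show "x \<in> N" using cj_cancel(1)[OF t, of x] N_cj[of "cj (inv t) x" t] t by simp
  qed
  ultimately obtain x where x: "x \<in> ?M" "A ** \<rho> x ** B \<noteq> 0" using irreducible assms(4,5) by blast
  then have "cj (inv t) x \<in> M" "cj t (cj (inv t) x) = x" using cj_cancel(1)[OF t, of x] by (simp_all add: cj_def)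
  then show ?thesis using x(2) by metis
qed

text \<open>If every \<open>u\<close> violated a condition, the loci of the single conditions would
  cover \<open>N\<close>, and one of them would contain a coset \<open>S x\<close> with
  \<open>S\<close> of finite index. Absorbing \<open>x\<close> into \<open>A\<close> or
  \<open>B\<close> contradicts irreducibility under \<open>S\<close>.\<close>

lemma simultaneous_nonvanishing:
  fixes Q :: "(('k^'n^'n) \<times> ('k^'n^'n) \<times> 'a \<times> bool) set"
  assumes Q: "finite Q"
    and Q': "\<And>A B t b. (A, B, t, b) \<in> Q \<Longrightarrow> A ** \<rho> \<one> \<noteq> 0 \<and> \<rho> \<one> ** B \<noteq> 0 \<and> t \<in> carrier G"
  shows "\<exists>u\<in>N. \<forall>(A, B, t, b)\<in>Q. A ** \<rho> (cj t (sg b u)) ** B \<noteq> 0"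
proof (rule ccontr)
  assume neg: "\<not> ?thesis"
  \<comment> \<open>The entries of the twisted representations and of their inverses. Left
    translation recombines them linearly: along the row index if \<open>b\<close> holds, along the
    column index otherwise, because inversion reverses products.\<close>
  define \<phi> where "\<phi> = (\<lambda>((t, b), p, q) u. \<rho> (cj t (sg b u)) $ p $ q)"
  define TB where "TB = (\<lambda>(A, B, t, b). (t, b)) ` Q"
  define B0 where "B0 = \<phi> ` (TB \<times> UNIV \<times> UNIV)"
  have finB0: "finite B0" using Q by (simp add: B0_def TB_def)
  have TBc: "t \<in> carrier G" if "(t, b) \<in> TB" for t b using that Q' by (auto simp: TB_def)
  have \<phi>_span: "\<phi> ((t, b), p, q) \<in> fun_space.span B0" if "(t, b) \<in> TB" for t b p q
    using that by (auto intro!: fun_space.span_base simp: B0_def)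
  define M where "M = (\<lambda>(A :: 'k^'n^'n, B :: 'k^'n^'n, t, b). range (\<lambda>(i, j) u. (A ** \<rho> (cj t (sg b u)) ** B) $ i $ j))"
  have M_span: "(\<lambda>u. (A ** \<rho> (cj t (sg b u)) ** B) $ i $ j) \<in> fun_space.span B0"
    if tb: "(t, b) \<in> TB" for A B t b i j
  proof -
    have entry: "(A ** R ** B) $ i $ j = (\<Sum>q\<in>UNIV. \<Sum>p\<in>UNIV. (A $ i $ p * B $ q $ j) * R $ p $ q)"
      for R :: "'k^'n^'n"
      by (simp add: matrix_matrix_mult_def sum_distrib_left mult_ac)
    have "(\<lambda>u. (A ** \<rho> (cj t (sg b u)) ** B) $ i $ j) =
        (\<Sum>q\<in>UNIV. \<Sum>p\<in>UNIV. (\<lambda>u. (A $ i $ p * B $ q $ j) * \<phi> ((t, b), p, q) u))"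
      by (rule ext) (simp only: entry sum_fun_apply \<phi>_def prod.case)
    also have "\<dots> \<in> fun_space.span B0"
      by (intro fun_space.span_sum fun_space.span_scale \<phi>_span tb)
    finally show ?thesis .
  qed
  have trans: "\<exists>h\<in>fun_space.span B0. \<forall>u\<in>N. f (g \<otimes> u) = h u" if f: "f \<in> B0" and g: "g \<in> N" for f g
  proof -
    obtain t b p q where tb: "(t, b) \<in> TB" and f_eq: "f = \<phi> ((t, b), p, q)"
      using f by (auto simp: B0_def)
    have t: "t \<in> carrier G" using TBc[OF tb] .
    show ?thesis
    proof (cases b)
      case True
      let ?h = "\<Sum>r\<in>UNIV. (\<lambda>u. \<rho> (cj t g) $ p $ r * \<phi> ((t, b), r, q) u)"
      have "?h \<in> fun_space.span B0" by (intro fun_space.span_sum fun_space.span_scale \<phi>_span tb)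
      moreover have "f (g \<otimes> u) = ?h u" if "u \<in> N" for u
        using that g t True
        by (simp add: f_eq \<phi>_def sg_def cj_mult hom sum_fun_apply matrix_matrix_mult_def)
      ultimately show ?thesis by blast
    next
      case False
      let ?h = "\<Sum>r\<in>UNIV. (\<lambda>u. \<rho> (cj t (inv g)) $ r $ q * \<phi> ((t, b), p, r) u)"
      have "?h \<in> fun_space.span B0" by (intro fun_space.span_sum fun_space.span_scale \<phi>_span tb)
      moreover have "f (g \<otimes> u) = ?h u" if "u \<in> N" for u
        using that g t False
        by (simp add: f_eq \<phi>_def sg_def inv_mult_group cj_mult hom sum_fun_apply
            matrix_matrix_mult_def mult.commute)
      ultimately show ?thesis by blast
    qed
  qed
  have cover: "\<exists>M'\<in>M ` Q. \<forall>f\<in>M'. f u = 0" if u: "u \<in> N" for u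
  proof -
    obtain A B t b where "(A, B, t, b) \<in> Q" "A ** \<rho> (cj t (sg b u)) ** B = 0"
      using neg u by blast
    then show ?thesis by (intro bexI[of _ "M (A, B, t, b)"]) (auto simp: M_def)
  qed
  have "finite (M ` Q)" using Q by simp
  moreover have "M' \<subseteq> fun_space.span B0" if "M' \<in> M ` Q" for M'
    using that M_span unfolding M_def TB_def by force
  ultimately obtain M' S x where M': "M' \<in> M ` Q" "fin_idx G N S" "x \<in> N"
    "\<And>s f. s \<in> S \<Longrightarrow> f \<in> M' \<Longrightarrow> f (s \<otimes> x) = 0"
    using zero_loci_cover[OF N finB0 trans _ _ cover] by metis
  then obtain A B t b where q: "(A, B, t, b) \<in> Q" "M' = M (A, B, t, b)" by (metis image_iff prod_cases4)
  have zero: "A ** \<rho> (cj t (sg b (s \<otimes> x))) ** B = 0" if "s \<in> S" for s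
    using M'(4)[OF that] unfolding q(2) M_def by (force simp: vec_eq_iff)
  have AB: "A ** \<rho> \<one> \<noteq> 0" "\<rho> \<one> ** B \<noteq> 0" and t: "t \<in> carrier G" using Q'[OF q(1)] by auto
  have S: "fin_idx G (carrier G) S" using fin_idx_trans[OF fin_N M'(2) subgroup_self] .
  have SN: "S \<subseteq> N" using M'(2) by (rule fin_idx_subset)
  have x: "x \<in> N" by (fact M'(3))
  show False
  proof (cases b)
    case True
    have "\<rho> \<one> ** (\<rho> (cj t x) ** B) \<noteq> 0"
    proof
      assume "\<rho> \<one> ** (\<rho> (cj t x) ** B) = 0"
      then have "\<rho> (inv (cj t x)) ** (\<rho> (cj t x) ** B) = 0"
        using x t by (simp add: matrix_mul_assoc rho_one)
      then show False using AB(2) x t by (simp add: matrix_mul_assoc rho_inv)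
    qed
    then obtain s where s: "s \<in> S" "A ** \<rho> (cj t s) ** (\<rho> (cj t x) ** B) \<noteq> 0"
      using irreducible_cj[OF S SN t AB(1)] by blast
    then have "s \<in> N" using SN by blast
    then have "A ** \<rho> (cj t (s \<otimes> x)) ** B = A ** \<rho> (cj t s) ** (\<rho> (cj t x) ** B)"
      using x t by (simp add: cj_mult hom matrix_mul_assoc)
    then show False using zero[OF s(1)] s(2) True by (simp add: sg_def)
  next
    case False
    have "(A ** \<rho> (cj t (inv x))) ** \<rho> \<one> \<noteq> 0"
    proof
      assume "(A ** \<rho> (cj t (inv x))) ** \<rho> \<one> = 0"
      then have "A ** \<rho> (cj t (inv x)) = 0" using x t by (simp add: rho_one flip: matrix_mul_assoc)
      then have "A ** \<rho> (cj t (inv x)) ** \<rho> (cj t x) = 0" by simp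
      then show False using AB(1) x t by (simp add: cj_inv rho_inv flip: matrix_mul_assoc)
    qed
    then obtain s where s: "s \<in> S" "A ** \<rho> (cj t (inv x)) ** \<rho> (cj t s) ** B \<noteq> 0"
      using irreducible_cj[OF S SN t _ AB(2)] by blast
    have sS: "inv s \<in> S" using s(1) subgroup.m_inv_closed[OF fin_idx_subgroup[OF S]] by blast
    have sN: "s \<in> N" using s(1) SN by blast
    have "A ** \<rho> (cj t (inv (inv s \<otimes> x))) ** B = A ** \<rho> (cj t (inv x)) ** \<rho> (cj t s) ** B"
      using x t sN by (simp add: inv_mult_group cj_mult hom matrix_mul_assoc)
    then show False using zero[OF sS] s(2) False by (simp add: sg_def)
  qed
qed

text \<open>The conditions are met by choosing the values \<open>y p\<close> one after the other: as \<open>p \<noteq> q\<close>,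
  every condition is linear in the variable chosen last.\<close>

lemma choose_parameters:
  fixes C :: "(('k^'n^'n) \<times> 'a \<times> 'v \<times> 'a \<times> 'v \<times> ('k^'n^'n)) set"
  assumes C: "finite C"
    and C': "\<And>A t p t' q B. (A, t, p, t', q, B) \<in> C \<Longrightarrow>
      A ** \<rho> \<one> \<noteq> 0 \<and> \<rho> \<one> ** B \<noteq> 0 \<and> t \<in> carrier G \<and> t' \<in> carrier G \<and> p \<noteq> q"
  shows "\<exists>y. (\<forall>p. y p \<in> N) \<and>
    (\<forall>(A, t, p, t', q, B)\<in>C. A ** \<rho> (cj t (y p)) ** \<rho> (cj t' (inv (y q))) ** B \<noteq> 0)"
proof -
  have "\<exists>y. (\<forall>p. y p \<in> N) \<and>
    (\<forall>(A, t, p, t', q, B)\<in>C. p \<in> V \<longrightarrow> q \<in> V \<longrightarrow>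
      A ** \<rho> (cj t (y p)) ** \<rho> (cj t' (inv (y q))) ** B \<noteq> 0)" if "finite V" for V
    using that
  proof (induction V)
    case empty
    show ?case by (intro exI[of _ "\<lambda>_. \<one>"]) auto
  next
    case (insert v V)
    then obtain y where y: "\<And>p. y p \<in> N"
      "\<And>A t p t' q B. (A, t, p, t', q, B) \<in> C \<Longrightarrow> p \<in> V \<Longrightarrow> q \<in> V \<Longrightarrow>
        A ** \<rho> (cj t (y p)) ** \<rho> (cj t' (inv (y q))) ** B \<noteq> 0" by blast
    \<comment> \<open>The parameter other than \<open>y v\<close> is already a constant in
      \<open>N\<close> and is absorbed into \<open>A\<close> or \<open>B\<close>. Conditions not
      involving \<open>v\<close> fall into the second branch; they are satisfiable as well and do no
      harm.\<close>
    define cond where "cond = (\<lambda>(A :: 'k^'n^'n, t, p, t', q, B :: 'k^'n^'n).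
      if p = v then (A, \<rho> (cj t' (inv (y q))) ** B, t, True) else (A ** \<rho> (cj t (y p)), B, t', False))"
    have inv1: "\<rho> \<one> ** (\<rho> z ** B) \<noteq> 0" if "\<rho> \<one> ** B \<noteq> 0" "z \<in> N" for z and B :: "'k^'n^'n"
    proof
      assume "\<rho> \<one> ** (\<rho> z ** B) = 0"
      then have "\<rho> z ** B = 0" using that by (simp add: matrix_mul_assoc rho_one)
      then have "\<rho> (inv z) ** (\<rho> z ** B) = 0" by simp
      then show False using that by (simp add: matrix_mul_assoc rho_inv)
    qed
    have inv2: "A ** \<rho> z ** \<rho> \<one> \<noteq> 0" if "A ** \<rho> \<one> \<noteq> 0" "z \<in> N" for z and A :: "'k^'n^'n"
    proof
      assume "A ** \<rho> z ** \<rho> \<one> = 0"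
      then have "A ** \<rho> z = 0" using that by (simp add: rho_one flip: matrix_mul_assoc)
      then have "A ** \<rho> z ** \<rho> (inv z) = 0" by simp
      then show False using that by (simp add: rho_inv flip: matrix_mul_assoc)
    qed
    have "\<exists>u\<in>N. \<forall>(A, B, t, b)\<in>cond ` C. A ** \<rho> (cj t (sg b u)) ** B \<noteq> 0"
    proof (rule simultaneous_nonvanishing)
      show "finite (cond ` C)" using C by simp
      fix A B t b assume "(A, B, t, b) \<in> cond ` C"
      then obtain A' t1 p t2 q B' where c: "(A', t1, p, t2, q, B') \<in> C"
        "(A, B, t, b) = cond (A', t1, p, t2, q, B')" by auto
      show "A ** \<rho> \<one> \<noteq> 0 \<and> \<rho> \<one> ** B \<noteq> 0 \<and> t \<in> carrier G"
        using C'[OF c(1)] c(2) y(1) inv1 inv2 by (auto simp: cond_def split: if_splits)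
    qed
    then obtain u where u: "u \<in> N" and
      u': "\<forall>(A, B, t, b)\<in>cond ` C. A ** \<rho> (cj t (sg b u)) ** B \<noteq> 0" by blast
    have u2: "case cond c of (A, B, t, b) \<Rightarrow> A ** \<rho> (cj t (sg b u)) ** B \<noteq> 0" if "c \<in> C" for c
      using bspec[OF u' imageI[OF that]] .
    have "A ** \<rho> (cj t ((y(v := u)) p)) ** \<rho> (cj t' (inv ((y(v := u)) q))) ** B \<noteq> 0"
      if c: "(A, t, p, t', q, B) \<in> C" and pq: "p \<in> insert v V" "q \<in> insert v V" for A t p t' q B
    proof -
      have "p \<noteq> q" using C'[OF c] by blast
      consider "p = v" | "q = v" "p \<noteq> v" | "p \<noteq> v" "q \<noteq> v" by blast
      then show ?thesis
      proof cases
        case 1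
        then show ?thesis using u2[OF c] \<open>p \<noteq> q\<close>
          by (simp add: cond_def sg_def matrix_mul_assoc)
      next
        case 2
        then show ?thesis using u2[OF c] by (simp add: cond_def sg_def)
      next
        case 3
        then show ?thesis using y(2)[OF c] pq by simp
      qed
    qed
    moreover have "(y(v := u)) p \<in> N" for p using y(1) u(1) by simp
    ultimately show ?case
      by (intro exI[of _ "y(v := u)"] conjI allI ballI)
        (auto simp del: fun_upd_apply fun_upd_same split: prod.split)
  qed
  moreover define V where "V = (\<lambda>(A, t, p, t', q, B). p) ` C \<union> (\<lambda>(A, t, p, t', q, B). q) ` C"
  moreover have "finite V" using C by (simp add: V_def)
  ultimately obtain y where y: "\<forall>p. y p \<in> N" "\<forall>(A, t, p, t', q, B)\<in>C.
      p \<in> V \<longrightarrow> q \<in> V \<longrightarrow>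
      A ** \<rho> (cj t (y p)) ** \<rho> (cj t' (inv (y q))) ** B \<noteq> 0" by meson
  have "A ** \<rho> (cj t (y p)) ** \<rho> (cj t' (inv (y q))) ** B \<noteq> 0" if c: "(A, t, p, t', q, B) \<in> C" for A t p t' q B
  proof -
    have "p \<in> V" unfolding V_def by (rule UnI1, rule image_eqI[OF _ c]) simp
    moreover have "q \<in> V" unfolding V_def by (rule UnI2, rule image_eqI[OF _ c]) simp
    ultimately show ?thesis using bspec[OF y(2) c] by simp
  qed
  then show ?thesis using y(1) by (intro exI[of _ y]) auto
qed

end

section \<open>Twisted laws of degenerate representations\<close>

context group
begin

definition twisted_prod :: "('a \<times> nat \<times> bool) list \<Rightarrow> (nat \<Rightarrow> 'a) \<Rightarrow> 'a" where
  "twisted_prod w h = foldr (\<lambda>(t, i, b) z. cj t (sg b (h i)) \<otimes> z) w \<one>"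

lemma twisted_prod_simps:
  "twisted_prod [] h = \<one>"
  "twisted_prod ((t, i, b) # w) h = cj t (sg b (h i)) \<otimes> twisted_prod w h"
  by (simp_all add: twisted_prod_def)

text \<open>The twists are ignored: opposite letters with the same index may not be adjacent even if
  their conjugating elements differ. This is what reducedness of the untwisted word provides, and it
  keeps adjacent parameters distinct in \<open>no_twisted_law\<close>.\<close>

definition reduced :: "('a \<times> nat \<times> bool) list \<Rightarrow> bool" where
  "reduced w \<longleftrightarrow> successively (\<lambda>(t, i, b) (t', j, c). \<not> (i = j \<and> b \<noteq> c)) w"

lemma reduced_simps:
  "reduced ((t, i, b) # (t', j, c) # w) \<longleftrightarrow> \<not> (i = j \<and> b \<noteq> c) \<and> reduced ((t', j, c) # w)"
  by (simp add: reduced_def)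

end

locale degenerate_rep = strongly_irreducible_rep G N \<rho>
  for G :: "('a, 'b) monoid_scheme" (structure) and N
    and \<rho> :: "'a \<Rightarrow> 'k::alg_closed_field^'n::finite^'n" +
  fixes red :: "(nat \<Rightarrow> 'k^'n^'n) \<Rightarrow> 'k^'n^'n" and x0 :: "nat \<Rightarrow> 'a"
  assumes reduction: "reduction red"
    and x0: "\<And>i. x0 i \<in> N"
    and red_x0: "red (\<lambda>i. \<rho> (x0 i)) ** red (\<lambda>i. \<rho> (inv (x0 i))) = 0"
begin

lemma red_nonzero: "\<And>Z. \<forall>i. Z i \<noteq> 0 \<Longrightarrow> red Z \<noteq> 0"
  and red_mult: "\<And>Z W. \<forall>i. Z i ** W i \<noteq> 0 \<Longrightarrow> \<exists>c. red Z ** red W = c *\<^sub>m red (\<lambda>i. Z i ** W i)"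
  and red_const: "\<And>Z. Z \<noteq> 0 \<Longrightarrow> \<exists>c. c \<noteq> 0 \<and> red (\<lambda>_. Z) = c *\<^sub>m Z"
  and red_right: "\<And>Z B. \<forall>i. Z i \<noteq> 0 \<Longrightarrow> \<forall>i. Z i ** B = Z i \<Longrightarrow> red Z ** B = red Z"
  and red_left: "\<And>Z B. \<forall>i. Z i \<noteq> 0 \<Longrightarrow> \<forall>i. B ** Z i = Z i \<Longrightarrow> B ** red Z = red Z"
  using reduction unfolding reduction_def by blast+

definition r :: "(nat \<Rightarrow> 'a) \<Rightarrow> 'k^'n^'n" where "r x = red (\<lambda>i. \<rho> (x i))"

definition seqs :: "(nat \<Rightarrow> 'a) set" where "seqs = {x. \<forall>i. x i \<in> N}"

lemma seqsI: "(\<And>i. x i \<in> N) \<Longrightarrow> x \<in> seqs" and seqsD: "x \<in> seqs \<Longrightarrow> x i \<in> N"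
  by (auto simp: seqs_def)

lemma r_nonzero: "x \<in> seqs \<Longrightarrow> r x \<noteq> 0"
  unfolding r_def by (rule red_nonzero) (simp add: rho_nonzero seqs_def)

lemma r_mult:
  assumes "x \<in> seqs" "y \<in> seqs" shows "\<exists>c. r x ** r y = c *\<^sub>m r (\<lambda>i. x i \<otimes> y i)"
proof -
  have "\<forall>i. \<rho> (x i) ** \<rho> (y i) \<noteq> 0" using assms by (simp add: seqs_def rho_nonzero flip: hom)
  from red_mult[OF this] show ?thesis using assms by (simp add: r_def hom seqs_def)
qed

lemma r_one: "x \<in> seqs \<Longrightarrow> r x ** \<rho> \<one> = r x" "x \<in> seqs \<Longrightarrow> \<rho> \<one> ** r x = r x"
  unfolding r_def by (rule red_right red_left; simp add: seqs_def rho_nonzero rho_one)+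

lemma r_const: "u \<in> N \<Longrightarrow> \<exists>c. c \<noteq> 0 \<and> r (\<lambda>_. u) = c *\<^sub>m \<rho> u"
  unfolding r_def by (rule red_const) (simp add: rho_nonzero)

lemma r_rho:
  assumes "x \<in> seqs" "u \<in> N" shows "\<exists>c. r x ** \<rho> u = c *\<^sub>m r (\<lambda>i. x i \<otimes> u)"
proof -
  obtain c where c: "c \<noteq> 0" "r (\<lambda>_. u) = c *\<^sub>m \<rho> u" using r_const[OF assms(2)] by blast
  have "(\<lambda>_. u) \<in> seqs" using assms(2) by (simp add: seqs_def)
  then obtain c' where "r x ** r (\<lambda>_. u) = c' *\<^sub>m r (\<lambda>i. x i \<otimes> u)" using r_mult[OF assms(1)] by blast
  then have "inverse c *\<^sub>m c *\<^sub>m (r x ** \<rho> u) = inverse c *\<^sub>m c' *\<^sub>m r (\<lambda>i. x i \<otimes> u)"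
    by (simp add: c(2) smat_simps(2))
  then have "r x ** \<rho> u = (inverse c * c') *\<^sub>m r (\<lambda>i. x i \<otimes> u)"
    using c(1) by (simp add: smat_simps(3,4))
  then show ?thesis by blast
qed

lemma r_rho_r:
  assumes "x \<in> seqs" "u \<in> N" "y \<in> seqs"
  shows "\<exists>c. r x ** \<rho> u ** r y = c *\<^sub>m r (\<lambda>i. x i \<otimes> u \<otimes> y i)"
proof -
  obtain c where c: "r x ** \<rho> u = c *\<^sub>m r (\<lambda>i. x i \<otimes> u)" using r_rho[OF assms(1,2)] by blast
  have "(\<lambda>i. x i \<otimes> u) \<in> seqs" using assms by (simp add: seqs_def)
  then obtain c' where "r (\<lambda>i. x i \<otimes> u) ** r y = c' *\<^sub>m r (\<lambda>i. x i \<otimes> u \<otimes> y i)"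
    using r_mult assms(3) by blast
  then have "r x ** \<rho> u ** r y = (c * c') *\<^sub>m r (\<lambda>i. x i \<otimes> u \<otimes> y i)"
    by (simp add: c smat_simps(1,3))
  then show ?thesis by blast
qed

lemma rho_cancel:
  fixes A :: "'k^'n^'n" assumes "u \<in> N" "A ** \<rho> \<one> = A" "A \<noteq> 0" shows "A ** \<rho> u \<noteq> 0"
proof
  assume "A ** \<rho> u = 0"
  then have "A ** \<rho> u ** \<rho> (inv u) = 0" by simp
  then show False using assms by (simp add: rho_inv flip: matrix_mul_assoc)
qed

text \<open>Good matrices play the role of elements of minimal rank in the semigroup of all
  nonzero multiples of the \<open>r x\<close>: multiplying them on the left by \<open>r x\<close> either kills them
  or does not enlarge the kernel. The property passes to products on either side.\<close>

definition good :: "'k^'n^'n \<Rightarrow> bool" where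
  "good Y \<longleftrightarrow> (\<forall>x\<in>seqs. r x ** Y \<noteq> 0 \<longrightarrow> (\<forall>v. (r x ** Y) *v v = 0 \<longrightarrow> Y *v v = 0))"

lemma goodD: "good Y \<Longrightarrow> x \<in> seqs \<Longrightarrow> r x ** Y \<noteq> 0 \<Longrightarrow> (r x ** Y) *v v = 0 \<Longrightarrow> Y *v v = 0"
  by (auto simp: good_def)

text \<open>A limit with kernel of maximal dimension is good: a nonzero \<open>r y ** r x\<close> is
  a multiple of another limit, and its kernel contains that of \<open>r x\<close>, so both kernels
  agree.\<close>

lemma good_exists: "\<exists>x\<in>seqs. good (r x)"
proof -
  define K where "K M = {v. M *v v = 0}" for M :: "'k^'n^'n"
  have subsp: "vec.subspace (K M)" for M
    by (auto simp: K_def vec.subspace_def matrix_vector_right_distrib vec.scale)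
  have "\<exists>x. x \<in> seqs" using x0 seqsI by blast
  moreover have "vec.dim (K (r x)) < Suc CARD('n)" for x
    using dim_subset_UNIV_cart_gen[of "K (r x)"] by simp
  ultimately obtain x where x: "x \<in> seqs" and max: "\<And>y. y \<in> seqs \<Longrightarrow> vec.dim (K (r y)) \<le> vec.dim (K (r x))"
    using ex_has_greatest_nat[of "\<lambda>x. x \<in> seqs" _ "\<lambda>x. vec.dim (K (r x))" "Suc CARD('n)"] by blast
  have "good (r x)"
    unfolding good_def
  proof (intro ballI impI allI)
    fix y v assume y: "y \<in> seqs" "r y ** r x \<noteq> 0" "(r y ** r x) *v v = 0"
    obtain c where c: "r y ** r x = c *\<^sub>m r (\<lambda>i. y i \<otimes> x i)" using r_mult[OF y(1) x] by blast
    have "K (r x) \<subseteq> K (r y ** r x)"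
      by (auto simp: K_def matrix_vector_mul_assoc[symmetric])
    moreover have "c \<noteq> 0" using c y(2) by auto
    then have "K (r y ** r x) = K (r (\<lambda>i. y i \<otimes> x i))"
      by (simp add: K_def c smat_simps(6) vec.scale_eq_0_iff)
    moreover have "(\<lambda>i. y i \<otimes> x i) \<in> seqs" using x y(1) by (simp add: seqs_def)
    ultimately have "K (r x) = K (r y ** r x)"
      using max vec.subspace_dim_equal[OF subsp subsp] by metis
    then show "r x *v v = 0" using y(3) by (auto simp: K_def)
  qed
  then show ?thesis using x by blast
qed

lemma good_mult_right: "good Y \<Longrightarrow> good (Y ** B)"
  unfolding good_def
proof (intro ballI impI allI)
  fix x v
  assume Y: "\<forall>x\<in>seqs. r x ** Y \<noteq> 0 \<longrightarrow> (\<forall>v. (r x ** Y) *v v = 0 \<longrightarrow> Y *v v = 0)"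
    and x: "x \<in> seqs" "r x ** (Y ** B) \<noteq> 0" "(r x ** (Y ** B)) *v v = 0"
  have "r x ** Y \<noteq> 0" using x(2) by (auto simp: matrix_mul_assoc)
  moreover have "(r x ** Y) *v (B *v v) = 0"
    using x(3) by (simp add: matrix_vector_mul_assoc matrix_mul_assoc)
  ultimately have "Y *v (B *v v) = 0" using Y x(1) by blast
  then show "(Y ** B) *v v = 0" by (simp add: matrix_vector_mul_assoc)
qed

lemma good_mult_left:
  assumes "good Y" "x \<in> seqs" shows "good (r x ** Y)"
  unfolding good_def
proof (intro ballI impI allI)
  fix y v assume y: "y \<in> seqs" "r y ** (r x ** Y) \<noteq> 0" "(r y ** (r x ** Y)) *v v = 0"
  obtain c where c: "r y ** r x = c *\<^sub>m r (\<lambda>i. y i \<otimes> x i)" using r_mult[OF y(1) assms(2)] by blast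
  have e: "r y ** (r x ** Y) = c *\<^sub>m (r (\<lambda>i. y i \<otimes> x i) ** Y)"
    by (simp add: matrix_mul_assoc c smat_simps(1))
  then have "c \<noteq> 0" "r (\<lambda>i. y i \<otimes> x i) ** Y \<noteq> 0" using y(2) by auto
  moreover have "(r (\<lambda>i. y i \<otimes> x i) ** Y) *v v = 0"
    using y(3) \<open>c \<noteq> 0\<close> by (simp add: e smat_simps(6) vec.scale_eq_0_iff)
  moreover have "(\<lambda>i. y i \<otimes> x i) \<in> seqs" using assms(2) y(1) by (simp add: seqs_def)
  ultimately have "Y *v v = 0" using goodD[OF assms(1)] by blast
  then show "(r x ** Y) *v v = 0" by (simp add: matrix_vector_mul_assoc[symmetric])
qed

lemma good_smult: "good Y \<Longrightarrow> good (c *\<^sub>m Y)"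
  unfolding good_def by (auto simp: smat_simps vec.scale_eq_0_iff)

lemma good_r_rho_r:
  assumes "x \<in> seqs" "u \<in> N" "y \<in> seqs" and nz: "r x ** \<rho> u ** r y \<noteq> 0"
    and "good (r x) \<or> good (r y)"
  shows "good (r (\<lambda>i. x i \<otimes> u \<otimes> y i))"
proof -
  obtain c where c: "r x ** \<rho> u ** r y = c *\<^sub>m r (\<lambda>i. x i \<otimes> u \<otimes> y i)"
    using r_rho_r[OF assms(1-3)] by blast
  then have "c \<noteq> 0" using nz by auto
  then have eq: "r (\<lambda>i. x i \<otimes> u \<otimes> y i) = inverse c *\<^sub>m (r x ** \<rho> u ** r y)"
    by (simp add: c smat_simps(3,4))
  have "good (r x ** \<rho> u ** r y)"
    using assms(5)
  proof
    assume "good (r x)" then show ?thesis by (intro good_mult_right)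
  next
    assume g: "good (r y)"
    obtain c' where c': "r x ** \<rho> u = c' *\<^sub>m r (\<lambda>i. x i \<otimes> u)" using r_rho[OF assms(1,2)] by blast
    have "(\<lambda>i. x i \<otimes> u) \<in> seqs" using assms by (simp add: seqs_def)
    then show ?thesis using good_smult[OF good_mult_left[OF g]] by (simp add: c' smat_simps(1))
  qed
  then show ?thesis unfolding eq by (rule good_smult)
qed

text \<open>Induction on \<open>T\<close>: for a generic constant \<open>u\<close>, the sequence
  \<open>z u y\<close> inherits goodness from \<open>z\<close> for the old pairs and from
  \<open>y\<close> for the new one; genericity only has to keep the products of limits
  nonzero.\<close>

lemma good_twists:
  assumes "finite T" "T \<subseteq> carrier G \<times> UNIV"
  shows "\<exists>z\<in>seqs. \<forall>(t, b)\<in>T. good (r (\<lambda>i. cj t (sg b (z i))))"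
  using assms
proof (induction T)
  case empty
  show ?case by (intro bexI[of _ "\<lambda>_. \<one>"]) (auto simp: seqs_def)
next
  case (insert p T)
  obtain t0 b0 where p: "p = (t0, b0)" by (cases p)
  have t0: "t0 \<in> carrier G" using insert.prems p by auto
  obtain z where z: "z \<in> seqs" "\<And>t b. (t, b) \<in> T \<Longrightarrow> good (r (\<lambda>i. cj t (sg b (z i))))"
    using insert by blast
  obtain x where x: "x \<in> seqs" "good (r x)" using good_exists by blast
  define y where "y i = sg b0 (cj (inv t0) (x i))" for i
  have y: "y \<in> seqs" using x(1) t0 by (simp add: seqs_def y_def)
  have y_x: "cj t0 (sg b0 (y i)) = x i" for i
    using x(1) t0 by (simp add: seqs_def y_def sg_sg cj_cancel)
  \<comment> \<open>Inversion reverses the order of factors, so for a negative sign \<open>y\<close>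
    stands on the left and \<open>z\<close> on the right.\<close>
  define L where "L b = (if b then z else y)" for b
  define R where "R b = (if b then y else z)" for b
  have LR: "L b \<in> seqs" "R b \<in> seqs" for b using y z(1) by (simp_all add: L_def R_def)
  define tw where "tw s = (\<lambda>(t, b) i. cj t (sg b (s i)))" for s :: "nat \<Rightarrow> 'a"
  have tw: "tw s (t, b) \<in> seqs" if "s \<in> seqs" "t \<in> carrier G" for s t b
    using that by (simp add: tw_def seqs_def)
  let ?Q = "(\<lambda>(t, b). (r (tw (L b) (t, b)), r (tw (R b) (t, b)), t, b)) ` insert p T"
  have "\<exists>u\<in>N. \<forall>(A, B, t, b)\<in>?Q. A ** \<rho> (cj t (sg b u)) ** B \<noteq> 0"
  proof (rule simultaneous_nonvanishing)
    show "finite ?Q" using insert.hyps by simp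
    fix A B t b assume "(A, B, t, b) \<in> ?Q"
    then have t: "t \<in> carrier G" and AB: "A = r (tw (L b) (t, b))" "B = r (tw (R b) (t, b))"
      using insert.prems by auto
    show "A ** \<rho> \<one> \<noteq> 0 \<and> \<rho> \<one> ** B \<noteq> 0 \<and> t \<in> carrier G"
      using t LR tw by (simp add: AB r_one r_nonzero)
  qed
  then obtain u where u: "u \<in> N" and u': "\<forall>(A, B, t, b)\<in>?Q. A ** \<rho> (cj t (sg b u)) ** B \<noteq> 0"
    by blast
  have nz: "r (tw (L b) (t, b)) ** \<rho> (cj t (sg b u)) ** r (tw (R b) (t, b)) \<noteq> 0"
    if "(t, b) \<in> insert p T" for t b
    using bspec[OF u' imageI[OF that]] by simp
  have "good (r (\<lambda>i. cj t (sg b (z i \<otimes> u \<otimes> y i))))" if tb: "(t, b) \<in> insert p T" for t b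
  proof -
    have t: "t \<in> carrier G" using insert.prems tb by auto
    have "(\<lambda>i. cj t (sg b (z i \<otimes> u \<otimes> y i))) =
        (\<lambda>i. tw (L b) (t, b) i \<otimes> cj t (sg b u) \<otimes> tw (R b) (t, b) i)"
      using t u y z(1) by (auto simp: seqs_def sg_mult3 cj_mult tw_def L_def R_def)
    moreover have "good (r (tw (L b) (t, b))) \<or> good (r (tw (R b) (t, b)))"
    proof (cases "(t, b) = p")
      case True
      then have "tw y (t, b) = x" using p y_x by (auto simp: tw_def)
      then show ?thesis using x(2) by (cases b) (auto simp: L_def R_def)
    next
      case False
      then have "good (r (tw z (t, b)))" using z(2)[of t b] tb by (simp add: tw_def)
      then show ?thesis by (cases b) (auto simp: L_def R_def)
    qed
    ultimately show ?thesis
      using good_r_rho_r[OF tw[OF LR(1) t] _ tw[OF LR(2) t] nz[OF tb]] u t by simp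
  qed
  moreover have "(\<lambda>i. z i \<otimes> u \<otimes> y i) \<in> seqs" using z(1) u y by (simp add: seqs_def)
  ultimately show ?case by (intro bexI[of _ "\<lambda>i. z i \<otimes> u \<otimes> y i"]) auto
qed

text \<open>With a right inverse, the limit of \<open>inv (x0 i)\<close> factors through
  \<open>r x\<close>. By goodness, \<open>r x0\<close> does not enlarge the kernel when applied
  after \<open>r x\<close>; yet it annihilates the whole nonzero limit of
  \<open>inv (x0 i)\<close>.\<close>

lemma good_not_right_invertible:
  assumes "x \<in> seqs" "good (r x)" "r x ** M = \<rho> \<one>"
  shows False
proof -
  let ?y = "\<lambda>i. inv (x0 i)"
  have s: "x0 \<in> seqs" "?y \<in> seqs" using x0 by (auto simp: seqs_def)
  have ZM: "r x ** (M ** r ?y) = r ?y" using s(2) by (simp add: matrix_mul_assoc assms(3) r_one)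
  have "r x0 ** r x \<noteq> 0"
  proof
    assume "r x0 ** r x = 0"
    then have "r x0 ** r x ** M = 0" by simp
    then show False using s(1) r_nonzero[OF s(1)] by (simp add: assms(3) r_one flip: matrix_mul_assoc)
  qed
  obtain w where w: "r ?y *v w \<noteq> 0" using matrix_nonzero_vector r_nonzero[OF s(2)] by blast
  have "(r x0 ** r x) *v ((M ** r ?y) *v w) = (r x0 ** r ?y) *v w"
    by (simp add: matrix_vector_mul_assoc ZM flip: matrix_mul_assoc)
  also have "\<dots> = 0" using red_x0 by (simp add: r_def)
  finally have "r x *v ((M ** r ?y) *v w) = 0"
    using goodD[OF assms(2) s(1) \<open>r x0 ** r x \<noteq> 0\<close>] by blast
  then show False using w by (simp add: matrix_vector_mul_assoc ZM)
qed

text \<open>With \<open>h i = inv (y (i, False)) \<otimes> z \<otimes> y (i, True)\<close> the letter \<open>(t, i, b)\<close> contributes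
  \<open>inv (y (i, \<not> b))\<close>, \<open>sg b z\<close>, \<open>y (i, b)\<close> in this order, all conjugated by \<open>t\<close>; in a reduced word
  the parameters of neighbouring letters that meet are therefore different.\<close>

lemma no_twisted_law:
  assumes w: "w \<noteq> []" "reduced w" "\<And>t i b. (t, i, b) \<in> set w \<Longrightarrow> t \<in> carrier G"
    and law: "\<And>h. (\<And>i. h i \<in> N) \<Longrightarrow> twisted_prod w h = \<one>"
  shows False
proof -
  define T where "T = (\<lambda>(t, i, b). (t, b)) ` set w"
  have "finite T" "T \<subseteq> carrier G \<times> UNIV" using w(3) by (auto simp: T_def)
  then obtain z where z: "z \<in> seqs" and "\<forall>(t, b)\<in>T. good (r (\<lambda>i. cj t (sg b (z i))))"
    using good_twists by blast
  moreover define Z where "Z t b = (\<lambda>k. cj t (sg b (z k)))" for t b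
  ultimately have good: "good (r (Z t b))" if "(t, i, b) \<in> set w" for t i b
    using that unfolding T_def by force
  have Z: "Z t b \<in> seqs" if "t \<in> carrier G" for t b using z that by (simp add: Z_def seqs_def)
  \<comment> \<open>One condition for each pair of letters that could be adjacent in a reduced word:
    the limits of the twisted \<open>z\<close> stand outside, the two meeting parameters between
    them.\<close>
  define C where "C = (\<lambda>((t, i, b), (t', j, c)).
      (r (Z t b), t, (i, b), t', (j, \<not> c), r (Z t' c))) `
    {((t, i, b), (t', j, c)). (t, i, b) \<in> set w \<and> (t', j, c) \<in> set w \<and> \<not> (i = j \<and> b \<noteq> c)}"
  have "finite {((t, i, b), (t', j, c)). (t, i, b) \<in> set w \<and> (t', j, c) \<in> set w \<and> \<not> (i = j \<and> b \<noteq> c)}"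
    by (rule finite_subset[of _ "set w \<times> set w"]) auto
  then have "finite C" unfolding C_def by (rule finite_imageI)
  have C': "A ** \<rho> \<one> \<noteq> 0 \<and> \<rho> \<one> ** B \<noteq> 0 \<and> t \<in> carrier G \<and> t' \<in> carrier G \<and> p \<noteq> q"
    if "(A, t, p, t', q, B) \<in> C" for A t p t' q B
    using that Z w(3) r_nonzero by (auto simp: C_def r_one)
  have "\<exists>y. (\<forall>p. y p \<in> N) \<and>
    (\<forall>(A, t, p, t', q, B)\<in>C. A ** \<rho> (cj t (y p)) ** \<rho> (cj t' (inv (y q))) ** B \<noteq> 0)"
    by (rule choose_parameters[OF \<open>finite C\<close>]) (rule C')
  then obtain y where y: "y p \<in> N" and
    yC: "\<forall>(A, t, p, t', q, B)\<in>C. A ** \<rho> (cj t (y p)) ** \<rho> (cj t' (inv (y q))) ** B \<noteq> 0" for p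
    by blast
  have y': "A ** \<rho> (cj t (y p)) ** \<rho> (cj t' (inv (y q))) ** B \<noteq> 0"
    if "(A, t, p, t', q, B) \<in> C" for A t p t' q B
    using bspec[OF yC that] by simp
  define h where "h k i = inv (y (i, False)) \<otimes> z k \<otimes> y (i, True)" for k i
  have zN: "z k \<in> N" for k using z by (simp add: seqs_def)
  have hN: "h k i \<in> N" for k i using y zN by (simp add: h_def)
  have sg_h: "sg b (h k i) = inv (y (i, \<not> b)) \<otimes> sg b (z k) \<otimes> y (i, b)" for b k i
    using y zN by (cases b) (simp_all add: h_def sg_def inv_mult_group m_assoc)
  have tp_N: "twisted_prod v (h k) \<in> N" if "set v \<subseteq> set w" for v k
    using that
    by (induction v) (use hN w(3) in \<open>auto simp: twisted_prod_simps\<close>)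
  \<comment> \<open>The product of the word \<open>(t, i, b) # v\<close> without its leading factor,
    the conjugate of \<open>inv (y (i, \<not> b))\<close>. Its limit keeps \<open>r (Z t b)\<close>
    as a left factor as long as no scalar vanishes.\<close>
  define s where "s t i b v = (\<lambda>k. Z t b k \<otimes> cj t (y (i, b)) \<otimes> twisted_prod v (h k))" for t i b v
  have chain: "\<exists>M. r (s t i b v) = r (Z t b) ** M"
    if "set ((t, i, b) # v) \<subseteq> set w" "reduced ((t, i, b) # v)" for t i b v
    using that
  proof (induction v arbitrary: t i b)
    case Nil
    then have t: "t \<in> carrier G" using w(3) by auto
    obtain c where c: "r (Z t b) ** \<rho> (cj t (y (i, b))) = c *\<^sub>m r (\<lambda>k. Z t b k \<otimes> cj t (y (i, b)))"
      using r_rho[OF Z[OF t] N_cj[OF y t]] by blast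
    have "c \<noteq> 0" using c rho_cancel[of "cj t (y (i, b))" "r (Z t b)"] Z[OF t] y t
      by (auto simp: r_one r_nonzero)
    moreover have "s t i b [] = (\<lambda>k. Z t b k \<otimes> cj t (y (i, b)))"
      using seqsD[OF Z[OF t]] y t by (auto simp: s_def twisted_prod_simps)
    ultimately have "r (s t i b []) = r (Z t b) ** (inverse c *\<^sub>m \<rho> (cj t (y (i, b))))"
      by (simp add: smat_simps c)
    then show ?case by blast
  next
    case (Cons a v)
    obtain t' j d where a: "a = (t', j, d)" by (cases a)
    have t: "t \<in> carrier G" "t' \<in> carrier G" using Cons.prems(1) w(3) a by auto
    have red: "\<not> (i = j \<and> b \<noteq> d)" "reduced ((t', j, d) # v)"
      using Cons.prems(2) by (simp_all add: a reduced_simps)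
    obtain M where M: "r (s t' j d v) = r (Z t' d) ** M"
      using Cons.IH[of t' j d] Cons.prems(1) red(2) a by auto
    have s': "s t' j d v \<in> seqs"
      using Z[OF t(2)] y t tp_N[of v] Cons.prems(1) by (simp add: s_def seqs_def)
    define u where "u = cj t (y (i, b)) \<otimes> cj t' (inv (y (j, \<not> d)))"
    have u: "u \<in> N" using y t by (simp add: u_def)
    obtain c where c: "r (Z t b) ** \<rho> u ** r (s t' j d v) = c *\<^sub>m r (\<lambda>k. Z t b k \<otimes> u \<otimes> s t' j d v k)"
      using r_rho_r[OF Z[OF t(1)] u s'] by blast
    have "(\<lambda>k. Z t b k \<otimes> u \<otimes> s t' j d v k) = s t i b (a # v)"
    proof
      fix k
      have tpk: "twisted_prod v (h k) \<in> N" using tp_N[of v] Cons.prems(1) by simp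
      show "Z t b k \<otimes> u \<otimes> s t' j d v k = s t i b (a # v) k"
        using seqsD[OF Z[OF t(1)]] seqsD[OF Z[OF t(2)]] y t zN tpk
        by (simp add: s_def a twisted_prod_simps sg_h cj_mult u_def m_assoc)
          (simp add: Z_def)
    qed
    moreover have "c \<noteq> 0"
    proof -
      have "((t, i, b), (t', j, d)) \<in> {((t, i, b), (t', j, c)). (t, i, b) \<in> set w \<and> (t', j, c) \<in> set w \<and> \<not> (i = j \<and> b \<noteq> c)}"
        using Cons.prems(1) red(1) a by simp
      then have "(r (Z t b), t, (i, b), t', (j, \<not> d), r (Z t' d)) \<in> C"
        unfolding C_def by (rule rev_image_eqI) simp
      from y'[OF this] have nz: "r (Z t b) ** \<rho> u ** r (Z t' d) \<noteq> 0"
        using y t by (simp add: u_def hom matrix_mul_assoc)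
      obtain c1 where c1: "r (Z t b) ** \<rho> u = c1 *\<^sub>m r (\<lambda>k. Z t b k \<otimes> u)"
        using r_rho[OF Z[OF t(1)] u] by blast
      have c1nz: "c1 \<noteq> 0" "r (\<lambda>k. Z t b k \<otimes> u) ** r (Z t' d) \<noteq> 0"
        using nz by (auto simp: c1 smat_simps)
      have seq: "(\<lambda>k. Z t b k \<otimes> u) \<in> seqs" using Z[OF t(1)] u by (simp add: seqs_def)
      obtain x where x: "r (s t' j d v) *v x \<noteq> 0" using matrix_nonzero_vector r_nonzero[OF s'] by blast
      \<comment> \<open>The parameters make the product of the two neighbouring limits nonzero;
        goodness of the second one keeps it nonzero after the factor \<open>M\<close> contributed by
        the rest of the word.\<close>
      have "good (r (Z t' d))" using good Cons.prems(1) a by auto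
      then have "(r (\<lambda>k. Z t b k \<otimes> u) ** r (Z t' d)) *v (M *v x) \<noteq> 0"
        using goodD[OF _ seq c1nz(2)] x by (metis M matrix_vector_mul_assoc)
      then have "(r (Z t b) ** \<rho> u ** r (s t' j d v)) *v x \<noteq> 0"
        using c1nz(1) by (simp add: c1 M smat_simps matrix_vector_mul_assoc matrix_mul_assoc vec.scale_eq_0_iff)
      then show ?thesis using c by auto
    qed
    ultimately have "r (s t i b (a # v)) = r (Z t b) ** (inverse c *\<^sub>m (\<rho> u ** r (s t' j d v)))"
      using c by (simp add: smat_simps matrix_mul_assoc)
    then show ?case by blast
  qed
  obtain t i b v where w_eq: "w = (t, i, b) # v" using w(1) by (metis neq_Nil_conv prod_cases3)
  have t: "t \<in> carrier G" using w(3)[of t i b] w_eq by simp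
  obtain M where M: "r (s t i b v) = r (Z t b) ** M" using chain[of t i b v] w(2) w_eq by auto
  \<comment> \<open>The law makes this sequence constant, so its limit is a nonzero multiple of a
    matrix in \<open>\<rho> N\<close>. Since \<open>r (Z t b)\<close> is a left factor, it acquires
    a right inverse.\<close>
  have "s t i b v = (\<lambda>_. cj t (y (i, \<not> b)))"
  proof
    fix k
    have tpk: "twisted_prod v (h k) \<in> N" using tp_N[of v] w_eq by auto
    have "\<one> = twisted_prod w (h k)" using law hN by simp
    also have "\<dots> = inv (cj t (y (i, \<not> b))) \<otimes> s t i b v k"
      using y zN t tpk by (simp add: w_eq twisted_prod_simps sg_h s_def Z_def cj_mult cj_inv m_assoc)
    finally have "cj t (y (i, \<not> b)) \<otimes> \<one> = cj t (y (i, \<not> b)) \<otimes> (inv (cj t (y (i, \<not> b))) \<otimes> s t i b v k)"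
      by simp
    then show "s t i b v k = cj t (y (i, \<not> b))"
      using y t tpk seqsD[OF Z[OF t]] by (simp add: inv_cancel s_def)
  qed
  moreover have g: "cj t (y (i, \<not> b)) \<in> N" using y t by simp
  ultimately obtain c where c: "c \<noteq> 0" "r (Z t b) ** M = c *\<^sub>m \<rho> (cj t (y (i, \<not> b)))"
    using r_const[OF g] M by auto
  have "r (Z t b) ** (inverse c *\<^sub>m (M ** \<rho> (inv (cj t (y (i, \<not> b)))))) = \<rho> \<one>"
    using c g by (simp add: smat_simps matrix_mul_assoc rho_inv)
  moreover have "good (r (Z t b))" using good[of t i b] w_eq by simp
  ultimately show False using good_not_right_invertible Z[OF t] by blast
qed

end

section \<open>From coset identities to twisted laws\<close>

context strongly_irreducible_rep
begin

text \<open>Products of an entry of \<open>\<rho> x\<close> and an entry of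
  \<open>\<rho> (inv x)\<close> are unchanged when \<open>\<rho> x\<close> is rescaled, and together
  they determine it up to a scalar. Finitely many values give finitely many cosets of the scalar
  subgroup; infinitely many give the sequence needed for \<open>degeneration\<close>.\<close>

theorem twisted_law_imp_scalars:
  assumes w: "w \<noteq> []" "reduced w" "\<And>t i b. (t, i, b) \<in> set w \<Longrightarrow> t \<in> carrier G"
    and law: "\<And>h. (\<And>i. h i \<in> N) \<Longrightarrow> twisted_prod w h = \<one>"
  shows "fin_idx G (carrier G) {x \<in> N. \<exists>c. \<rho> x = c *\<^sub>m \<rho> \<one>}"
proof (cases "\<forall>p q p' q'. finite ((\<lambda>x. \<rho> x $ p $ q * \<rho> (inv x) $ p' $ q') ` N)")
  case True
  let ?S = "{x \<in> N. \<exists>c. \<rho> x = c *\<^sub>m \<rho> \<one>}"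
  define f where "f x = (\<lambda>(p, q, p', q'). \<rho> x $ p $ q * \<rho> (inv x) $ p' $ q')" for x
  have "f ` N \<subseteq> PiE UNIV (\<lambda>k. (\<lambda>x. f x k) ` N)" by auto
  moreover have "finite ((\<lambda>x. f x k) ` N)" for k
    using True by (cases k) (simp add: f_def)
  ultimately have fin: "finite (f ` N)" by (rule finite_subset[OF _ finite_PiE[OF finite]])
  have S: "subgroup ?S G"
  proof
    show "?S \<subseteq> carrier G" by auto
    show "\<one> \<in> ?S" by (auto intro!: exI[of _ 1] simp: smat_simps)
    fix x y assume "x \<in> ?S" "y \<in> ?S"
    then obtain c d where cd: "x \<in> N" "y \<in> N" "\<rho> x = c *\<^sub>m \<rho> \<one>" "\<rho> y = d *\<^sub>m \<rho> \<one>" by auto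
    have "\<rho> (x \<otimes> y) = (c * d) *\<^sub>m (\<rho> \<one> ** \<rho> \<one>)"
      using cd(1,2) by (simp only: hom cd(3,4) smat_simps mult.commute)
    then show "x \<otimes> y \<in> ?S" using cd rho_one(1)[of \<one>] by auto
  next
    fix x assume "x \<in> ?S"
    then obtain c where c: "x \<in> N" "\<rho> x = c *\<^sub>m \<rho> \<one>" by auto
    have "c \<noteq> 0" using c rho_nonzero[of x] by auto
    have "c *\<^sub>m \<rho> (inv x) = \<rho> \<one>"
      using rho_inv(1)[OF c(1)] rho_one(2)[of "inv x"] c by (simp add: smat_simps)
    then have "inverse c *\<^sub>m c *\<^sub>m \<rho> (inv x) = inverse c *\<^sub>m \<rho> \<one>" by simp
    then have "\<rho> (inv x) = inverse c *\<^sub>m \<rho> \<one>" using \<open>c \<noteq> 0\<close> by (simp add: smat_simps(3,4))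
    then show "inv x \<in> ?S" using c(1) by (intro CollectI conjI exI[of _ "inverse c"]) simp_all
  qed
  have "fin_idx G N ?S"
  proof (rule fin_idxI[OF S _ fin])
    fix x y assume xy: "x \<in> N" "y \<in> N" "f x = f y"
    obtain p' q' where nz: "\<rho> (inv x) $ p' $ q' \<noteq> 0"
      using rho_nonzero[of "inv x"] xy(1) by (auto simp: vec_eq_iff)
    define c where "c = \<rho> (inv y) $ p' $ q' / \<rho> (inv x) $ p' $ q'"
    have "\<rho> x $ p $ q = c * \<rho> y $ p $ q" for p q
      using fun_cong[OF xy(3), of "(p, q, p', q')"] nz by (simp add: f_def c_def field_simps)
    then have x_eq: "\<rho> x = c *\<^sub>m \<rho> y" by (simp add: smat_def vec_eq_iff)
    have "\<rho> (x \<otimes> inv y) = c *\<^sub>m (\<rho> y ** \<rho> (inv y))"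
      using xy by (simp add: hom x_eq smat_simps)
    then show "x \<otimes> inv y \<in> ?S" using xy by (auto simp: rho_inv)
  qed auto
  then show ?thesis using fin_idx_trans[OF fin_N _ subgroup_self] by blast
next
  case False
  then obtain p q p' q' where inf: "infinite ((\<lambda>x. \<rho> x $ p $ q * \<rho> (inv x) $ p' $ q') ` N)" by blast
  define g where "g x = \<rho> x $ p $ q * \<rho> (inv x) $ p' $ q'" for x
  have "infinite (g ` N - {0})" using inf by (simp add: g_def)
  then obtain a :: "nat \<Rightarrow> 'k" where a: "inj a" "range a \<subseteq> g ` N - {0}"
    using infinite_countable_subset by blast
  then have "\<forall>i. \<exists>x. x \<in> N \<and> g x = a i \<and> g x \<noteq> 0" by (auto simp: image_subset_iff) (metis image_iff)
  then obtain x0 where x0: "\<And>i. x0 i \<in> N" "\<And>i. g (x0 i) = a i" "\<And>i. g (x0 i) \<noteq> 0" by metis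
  obtain red :: "(nat \<Rightarrow> 'k^'n^'n) \<Rightarrow> 'k^'n^'n" where red:
    "reduction red"
    "red (\<lambda>i. \<rho> (x0 i)) ** red (\<lambda>i. \<rho> (inv (x0 i))) = 0"
  proof -
    have "\<rho> (x0 i) ** \<rho> (inv (x0 i)) = \<rho> \<one>" for i by (rule rho_inv(1)[OF x0(1)])
    moreover have "inj (\<lambda>i. \<rho> (x0 i) $ p $ q * \<rho> (inv (x0 i)) $ p' $ q')"
      using a(1) by (simp add: x0(2) flip: g_def)
    moreover have "\<rho> (x0 i) $ p $ q * \<rho> (inv (x0 i)) $ p' $ q' \<noteq> 0" for i
      using x0(3)[of i] by (simp add: g_def)
    ultimately show thesis
      using degeneration[of "\<lambda>i. \<rho> (x0 i)" "\<lambda>i. \<rho> (inv (x0 i))" "\<rho> \<one>" p q p' q'] that by blast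
  qed
  interpret degenerate_rep G N \<rho> red x0
    using red x0(1) by unfold_locales
  have False
  proof (rule no_twisted_law[OF w(1,2)])
    show "t \<in> carrier G" if "(t, i, b) \<in> set w" for t i b using w(3)[OF that] .
    show "twisted_prod w h = \<one>" if "\<And>i. h i \<in> N" for h using law[OF that] .
  qed
  then show ?thesis ..
qed

end

text \<open>\<open>P\<close> projects onto a complement of \<open>U'\<close> in \<open>U\<close>, so
  the quotient is realised as the range of a matrix. It is built from a basis of \<open>U'\<close>
  extended to one of \<open>U\<close>, by killing the former and fixing the added vectors.\<close>

lemma subspace_projection:
  fixes U U' :: "('k::field^'n::finite) set"
  assumes U: "vec.subspace U" and U': "vec.subspace U'" and "U' \<subseteq> U"
  obtains P :: "'k^'n^'n" where "P ** P = P" "\<And>v. P *v v \<in> U" "\<And>v. v \<in> U' \<Longrightarrow> P *v v = 0"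
    "\<And>u. u \<in> U \<Longrightarrow> u - P *v u \<in> U'"
proof -
  obtain B where B: "B \<subseteq> U'" "vec.independent B" "U' \<subseteq> vec.span B"
    using vec.maximal_independent_subset by blast
  obtain C where C: "B \<subseteq> C" "C \<subseteq> U" "vec.independent C" "U \<subseteq> vec.span C"
    using vec.maximal_independent_subset_extend[of B U] B assms(3) by blast
  let ?f = "\<lambda>x. if x \<in> B then 0 else x"
  obtain g where g: "Vector_Spaces.linear (*s) (*s) g" "\<forall>x\<in>C. g x = ?f x" "range g = vec.span (?f ` C)"
    using vec.linear_independent_extend_subspace[OF C(3), of ?f] by blast
  define P where "P = matrix g"
  have P: "P *v v = g v" for v using matrix_works[OF g(1)] by (simp add: P_def)
  have fC: "?f ` C \<subseteq> U" using C(2) vec.subspace_0[OF U] by auto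
  have PU: "P *v v \<in> U" for v
    using vec.span_minimal[OF fC U] g(3) P by blast
  have PP: "P *v (P *v v) = P *v v" for v
  proof -
    have "w \<in> vec.span (?f ` C) \<Longrightarrow> P *v w = w" for w
    proof (induction rule: vec.span_induct_alt)
      case base
      show ?case by simp
    next
      case (step c x y)
      have "x = 0 \<or> x \<in> C \<and> x \<notin> B" using step(1) by (auto split: if_splits)
      then have "P *v x = x"
      proof
        assume "x \<in> C \<and> x \<notin> B" then show ?thesis using g(2) by (simp add: P)
      qed simp
      then show ?case using step(2) by (simp add: matrix_vector_right_distrib vec.scale)
    qed
    moreover have "P *v v \<in> vec.span (?f ` C)" using g(3) P by blast
    ultimately show ?thesis by blast
  qed
  have P0: "P *v v = 0" if "v \<in> U'" for v
  proof -
    have "v \<in> vec.span B" using that B(3) by blast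
    then show ?thesis
    proof (induction rule: vec.span_induct_alt)
      case base
      show ?case by simp
    next
      case (step c x y)
      have "P *v x = 0" using step(1) C(1) g(2) by (auto simp: P)
      then show ?case using step(2) by (simp add: matrix_vector_right_distrib vec.scale)
    qed
  qed
  have Pd: "u - P *v u \<in> U'" if "u \<in> U" for u
  proof -
    have "u \<in> vec.span C" using that C(4) by blast
    then show ?thesis
    proof (induction rule: vec.span_induct_alt)
      case base
      show ?case using vec.subspace_0[OF U'] by simp
    next
      case (step c x y)
      have "x - P *v x \<in> U'" using step(1) B(1) g(2) vec.subspace_0[OF U'] by (auto simp: P)
      then have "c *s (x - P *v x) + (y - P *v y) \<in> U'"
        using step(2) by (intro vec.subspace_add[OF U'] vec.subspace_scale[OF U'])
      also have "c *s (x - P *v x) + (y - P *v y) = c *s x + y - P *v (c *s x + y)"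
        by (simp add: matrix_vector_right_distrib vec.scale vec.scale_right_diff_distrib)
      finally show ?case .
    qed
  qed
  have "\<forall>v. (P ** P) *v v = P *v v" using PP by (simp add: matrix_vector_mul_assoc[symmetric])
  then have "P ** P = P" by (simp add: matrix_eq)
  then show ?thesis using that PU P0 Pd by blast
qed

section \<open>Pulling the coset representatives out of a word\<close>

context group
begin

text \<open>\<open>p\<close> is the prefix already read, evaluated at \<open>g\<close>. In
  \<open>g h\<close> the variable follows its representative and is conjugated by the new prefix; in
  \<open>h^-1 g^-1\<close> it precedes it and is conjugated by the old one.\<close>

primrec twists :: "'a \<Rightarrow> word \<Rightarrow> (nat \<Rightarrow> 'a) \<Rightarrow> ('a \<times> nat \<times> bool) list" where
  "twists p [] g = []"
| "twists p (a # W) g = (if snd a then (p \<otimes> g (fst a), a) # twists (p \<otimes> g (fst a)) W g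
     else (p, a) # twists (p \<otimes> inv (g (fst a))) W g)"

lemma map_snd_twists: "map snd (twists p W g) = W"
  by (induction W arbitrary: p) auto

lemma reduced_twists: "reduced_word W \<Longrightarrow> reduced (twists p W g)"
proof -
  have "reduced w \<longleftrightarrow> reduced_word (map snd w)" for w :: "('a \<times> nat \<times> bool) list"
    unfolding reduced_def reduced_word_def successively_map
    by (rule arg_cong[where f = "\<lambda>P. successively P w"]) (auto simp: fun_eq_iff)
  then show "reduced_word W \<Longrightarrow> reduced (twists p W g)" by (simp add: map_snd_twists)
qed

lemma word_eval_Cons:
  "word_eval G ((i, b) # W) x = sg b (x i) \<otimes> word_eval G W x"
  by (simp add: word_eval_def sg_def)

lemma word_eval_closed:
  "(\<And>i b. (i, b) \<in> set W \<Longrightarrow> x i \<in> carrier G) \<Longrightarrow> word_eval G W x \<in> carrier G"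
proof (induction W)
  case (Cons a W)
  obtain i b where a: "a = (i, b)" by (cases a)
  have "x i \<in> carrier G" using Cons.prems[of i b] by (simp add: a)
  moreover have "word_eval G W x \<in> carrier G"
  proof (rule Cons.IH)
    show "x j \<in> carrier G" if "(j, c) \<in> set W" for j c using Cons.prems[of j c] that by simp
  qed
  ultimately show ?case by (simp add: a word_eval_Cons)
qed (simp add: word_eval_def)

lemma twists_closed:
  "p \<in> carrier G \<Longrightarrow> (\<And>i b. (i, b) \<in> set W \<Longrightarrow> g i \<in> carrier G) \<Longrightarrow> (t, i, b) \<in> set (twists p W g) \<Longrightarrow>
    t \<in> carrier G"
proof (induction W arbitrary: p)
  case (Cons a W)
  have "g (fst a) \<in> carrier G" using Cons.prems(2)[of "fst a" "snd a"] by simp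
  then show ?case using Cons.prems Cons.IH[of "p \<otimes> g (fst a)"] Cons.IH[of "p \<otimes> inv (g (fst a))"]
    by (auto split: if_splits)
qed simp

lemma twisted_prod_closed:
  "(\<And>t i b. (t, i, b) \<in> set w \<Longrightarrow> t \<in> carrier G) \<Longrightarrow> (\<And>i. h i \<in> carrier G) \<Longrightarrow>
    twisted_prod w h \<in> carrier G"
proof (induction w)
  case (Cons a w)
  obtain t i b where a: "a = (t, i, b)" by (cases a)
  have "t \<in> carrier G" using Cons.prems(1)[of t i b] by (simp add: a)
  moreover have "twisted_prod w h \<in> carrier G"
  proof (rule Cons.IH[OF _ Cons.prems(2)])
    show "t \<in> carrier G" if "(t, j, c) \<in> set w" for t j c using Cons.prems(1)[of t j c] that by simp
  qed
  ultimately show ?case using Cons.prems(2) by (simp add: a twisted_prod_simps)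
qed (simp add: twisted_prod_simps)

lemma word_eval_twists:
  assumes "p \<in> carrier G" "\<And>i b. (i, b) \<in> set W \<Longrightarrow> g i \<in> carrier G" "\<And>i. h i \<in> carrier G"
  shows "p \<otimes> word_eval G W (\<lambda>i. g i \<otimes> h i) = twisted_prod (twists p W g) h \<otimes> (p \<otimes> word_eval G W g)"
  using assms(1,2)
proof (induction W arbitrary: p)
  case Nil
  then show ?case by (simp add: word_eval_def twisted_prod_simps)
next
  case (Cons a W)
  obtain i b where a: "a = (i, b)" by (cases a)
  have gi: "g i \<in> carrier G" using Cons.prems(2)[of i b] a by simp
  have hi: "h i \<in> carrier G" by (rule assms(3))
  have W: "\<And>i b. (i, b) \<in> set W \<Longrightarrow> g i \<in> carrier G" using Cons.prems(2) by auto
  have E: "word_eval G W (\<lambda>i. g i \<otimes> h i) \<in> carrier G" "word_eval G W g \<in> carrier G"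
    using W assms(3) by (auto intro!: word_eval_closed)
  define p' where "p' = p \<otimes> sg b (g i)"
  have p': "p' \<in> carrier G" using Cons.prems(1) gi by (simp add: p'_def)
  have T: "twisted_prod (twists p' W g) h \<in> carrier G"
    using twists_closed[OF p' W] by (rule twisted_prod_closed) (use assms(3) in auto)
  have IH: "p' \<otimes> word_eval G W (\<lambda>i. g i \<otimes> h i) = twisted_prod (twists p' W g) h \<otimes> (p' \<otimes> word_eval G W g)"
    by (rule Cons.IH[OF p' W])
  show ?case
  proof (cases b)
    case True
    have "p \<otimes> word_eval G (a # W) (\<lambda>i. g i \<otimes> h i) = cj p' (h i) \<otimes> (p' \<otimes> word_eval G W (\<lambda>i. g i \<otimes> h i))"
      using True gi hi Cons.prems(1) E by (simp add: a word_eval_Cons sg_def p'_def cj_def m_assoc inv_cancel inv_mult_group)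
    then show ?thesis
      using True gi hi Cons.prems(1) E T p' unfolding IH
      by (simp add: a word_eval_Cons sg_def p'_def twisted_prod_simps m_assoc)
  next
    case False
    have "p \<otimes> word_eval G (a # W) (\<lambda>i. g i \<otimes> h i) = cj p (inv (h i)) \<otimes> (p' \<otimes> word_eval G W (\<lambda>i. g i \<otimes> h i))"
      using False gi hi Cons.prems(1) E by (simp add: a word_eval_Cons sg_def p'_def cj_def m_assoc inv_cancel inv_mult_group)
    then show ?thesis
      using False gi hi Cons.prems(1) E T p' unfolding IH
      by (simp add: a word_eval_Cons sg_def p'_def twisted_prod_simps m_assoc)
  qed
qed

lemma coset_identity_twisted_law:
  assumes "coset_identity G H" "subgroup H G"
  obtains w where "w \<noteq> []" "reduced w" "\<And>t i b. (t, i, b) \<in> set w \<Longrightarrow> t \<in> carrier G"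
    "\<And>h. (\<And>i. h i \<in> H) \<Longrightarrow> twisted_prod w h = \<one>"
proof -
  obtain l W g where W: "W \<noteq> []" "reduced_word W" "\<forall>(i, b)\<in>set W. i < l" "\<forall>i<l. g i \<in> carrier G"
    and id: "\<forall>h. (\<forall>i<l. h i \<in> H) \<longrightarrow> word_eval G W (\<lambda>i. g i \<otimes> h i) = \<one>"
    using assms(1) unfolding coset_identity_def by blast
  have g: "g i \<in> carrier G" if "(i, b) \<in> set W" for i b using W(3,4) that by auto
  have cong: "word_eval G V (\<lambda>i. g i \<otimes> \<one>) = word_eval G V g" if "set V \<subseteq> set W" for V
    using that by (induction V) (auto simp: word_eval_def g)
  \<comment> \<open>As \<open>\<one>\<close> lies in \<open>H\<close>, the identity holds at
    \<open>g\<close> itself, which removes the last factor in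
    \<open>word_eval_twists\<close>.\<close>
  have one: "word_eval G W g = \<one>"
    using id[rule_format, of "\<lambda>_. \<one>"] cong[of W] subgroup.one_closed[OF assms(2)] by simp
  show ?thesis
  proof
    show "twists \<one> W g \<noteq> []" using W(1) map_snd_twists[of \<one> W g] by auto
    show "reduced (twists \<one> W g)" using W(2) by (rule reduced_twists)
    show "t \<in> carrier G" if "(t, i, b) \<in> set (twists \<one> W g)" for t i b
      using twists_closed[OF one_closed g that] .
    fix h :: "nat \<Rightarrow> 'a" assume h: "\<And>i. h i \<in> H"
    have hc: "h i \<in> carrier G" for i using h subgroup.mem_carrier[OF assms(2)] by blast
    have "twisted_prod (twists \<one> W g) h \<in> carrier G"
      using twists_closed[OF one_closed g] by (rule twisted_prod_closed) (use hc in auto)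
    moreover have "word_eval G W (\<lambda>i. g i \<otimes> h i) = \<one>" using id h by blast
    ultimately show "twisted_prod (twists \<one> W g) h = \<one>"
      using word_eval_twists[OF one_closed, of W g h] g hc by (simp add: one)
  qed
qed

end

section \<open>Virtual solvability\<close>

locale matrix_rep = group G for G :: "('a, 'b) monoid_scheme" (structure) +
  fixes \<rho>0 :: "'a \<Rightarrow> 'k::field^'n::finite^'n"
  assumes rho0_mult: "\<And>x y. x \<in> carrier G \<Longrightarrow> y \<in> carrier G \<Longrightarrow> \<rho>0 (x \<otimes> y) = \<rho>0 x ** \<rho>0 y"
    and rho0_one: "\<rho>0 \<one> = mat 1"
begin

definition preserves :: "'a set \<Rightarrow> ('k^'n) set \<Rightarrow> bool" where
  "preserves M U \<longleftrightarrow> (\<forall>x\<in>M. \<forall>u\<in>U. \<rho>0 x *v u \<in> U)"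

definition trivial_on :: "'a set \<Rightarrow> ('k^'n) set \<Rightarrow> ('k^'n) set \<Rightarrow> bool" where
  "trivial_on M U' U \<longleftrightarrow> (\<forall>x\<in>M. \<forall>u\<in>U. \<rho>0 x *v u - u \<in> U')"

lemma preserves_mono: "preserves M U \<Longrightarrow> L \<subseteq> M \<Longrightarrow> preserves L U"
  by (auto simp: preserves_def)

lemma trivial_on_mono: "trivial_on M U' U \<Longrightarrow> L \<subseteq> M \<Longrightarrow> trivial_on L U' U"
  by (auto simp: trivial_on_def)

lemma rho0_mult_vec:
  "x \<in> carrier G \<Longrightarrow> y \<in> carrier G \<Longrightarrow> \<rho>0 (x \<otimes> y) *v v = \<rho>0 x *v (\<rho>0 y *v v)"
  by (simp add: rho0_mult matrix_vector_mul_assoc)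

lemma rho0_inv_vec: "x \<in> carrier G \<Longrightarrow> \<rho>0 x *v (\<rho>0 (inv x) *v v) = v"
  by (simp add: rho0_one flip: rho0_mult_vec)

text \<open>The commutator of \<open>x\<close> and \<open>y\<close> sends \<open>y x v\<close> to
  \<open>x y v\<close>, so it acts trivially modulo \<open>U'\<close> as soon as \<open>x\<close>
  and \<open>y\<close> commute there.\<close>

lemma derived_trivial_on:
  assumes D: "subgroup D G" and U': "vec.subspace U'" and pres: "preserves D U" "preserves D U'"
    and comm: "\<And>x y v. x \<in> D \<Longrightarrow> y \<in> D \<Longrightarrow> v \<in> U \<Longrightarrow>
      \<rho>0 x *v (\<rho>0 y *v v) - \<rho>0 y *v (\<rho>0 x *v v) \<in> U'"
  shows "trivial_on (derived G D) U' U"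
proof -
  have Dc: "x \<in> carrier G" if "x \<in> D" for x using that subgroup.mem_carrier[OF D] by blast
  define E where "E = {x \<in> D. \<forall>u\<in>U. \<rho>0 x *v u - u \<in> U'}"
  have "subgroup E G"
  proof
    show "E \<subseteq> carrier G" using Dc by (auto simp: E_def)
    show "\<one> \<in> E" using subgroup.one_closed[OF D] vec.subspace_0[OF U'] by (simp add: E_def rho0_one)
    fix x y assume xy: "x \<in> E" "y \<in> E"
    then have D2: "x \<in> D" "y \<in> D" by (auto simp: E_def)
    have "\<rho>0 (x \<otimes> y) *v u - u \<in> U'" if "u \<in> U" for u
    proof -
      have "\<rho>0 y *v u \<in> U" using pres(1) D2 that by (auto simp: preserves_def)
      then have "(\<rho>0 x *v (\<rho>0 y *v u) - \<rho>0 y *v u) + (\<rho>0 y *v u - u) \<in> U'"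
        using xy that by (intro vec.subspace_add[OF U']) (auto simp: E_def)
      then show ?thesis using D2 Dc by (simp add: rho0_mult_vec)
    qed
    then show "x \<otimes> y \<in> E" using subgroup.m_closed[OF D D2] by (simp add: E_def)
  next
    fix x assume x: "x \<in> E"
    then have xD: "x \<in> D" "inv x \<in> D" using subgroup.m_inv_closed[OF D] by (auto simp: E_def)
    have "\<rho>0 (inv x) *v u - u \<in> U'" if "u \<in> U" for u
    proof -
      have "\<rho>0 (inv x) *v u \<in> U" using pres(1) xD(2) that by (auto simp: preserves_def)
      then have "\<rho>0 x *v (\<rho>0 (inv x) *v u) - \<rho>0 (inv x) *v u \<in> U'" using x by (auto simp: E_def)
      then have "- (u - \<rho>0 (inv x) *v u) \<in> U'"
        using Dc[OF xD(1)] by (intro vec.subspace_neg[OF U']) (simp add: rho0_inv_vec)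
      then show ?thesis by simp
    qed
    then show "inv x \<in> E" using xD(2) by (simp add: E_def)
  qed
  moreover have "derived_set G D \<subseteq> E"
  proof
    fix c assume "c \<in> derived_set G D"
    then obtain x y where xy: "x \<in> D" "y \<in> D" "c = x \<otimes> y \<otimes> inv x \<otimes> inv y" by blast
    have D4: "y \<otimes> x \<in> D" "inv (y \<otimes> x) \<in> D" "x \<otimes> y \<otimes> inv (y \<otimes> x) \<in> D"
      using xy subgroup.m_closed[OF D] subgroup.m_inv_closed[OF D] by auto
    have c: "c = x \<otimes> y \<otimes> inv (y \<otimes> x)"
      using xy Dc by (simp add: inv_mult_group m_assoc)
    have "\<rho>0 c *v u - u \<in> U'" if u: "u \<in> U" for u
    proof -
      define v where "v = \<rho>0 (inv (y \<otimes> x)) *v u"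
      have v: "v \<in> U" using pres(1) D4(2) u by (auto simp: preserves_def v_def)
      have "\<rho>0 c *v u = \<rho>0 x *v (\<rho>0 y *v v)"
        unfolding c v_def using xy(1,2) D4(2) Dc by (simp add: rho0_mult_vec)
      moreover have "u = \<rho>0 y *v (\<rho>0 x *v v)"
        using rho0_inv_vec[of "y \<otimes> x" u] xy Dc by (simp add: v_def rho0_mult_vec)
      ultimately show ?thesis using comm[OF xy(1,2) v] by simp
    qed
    then show "c \<in> E" using D4(3) by (simp add: E_def c)
  qed
  ultimately have "derived G D \<subseteq> E" unfolding derived_def by (rule generate_subgroup_incl[rotated])
  then show ?thesis by (auto simp: trivial_on_def E_def)
qed

lemma derived_power_decreasing:
  assumes "subgroup M G" "k \<le> l" shows "(derived G ^^ l) M \<subseteq> (derived G ^^ k) M"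
  using assms(2)
proof (induction l rule: dec_induct)
  case (step l)
  have "derived G ((derived G ^^ l) M) \<subseteq> (derived G ^^ l) M"
    by (rule derived_incl[OF subset_refl exp_of_derived_is_subgroup[OF assms(1)]])
  then show ?case using step by auto
qed simp

text \<open>Elements trivial on both layers differ from the identity by a map sending
  \<open>U\<close> into \<open>W\<close> and \<open>W\<close> into \<open>U'\<close>. Two of them
  commute on \<open>U\<close> modulo \<open>U'\<close>, which costs one derived step beyond
  \<open>max k l\<close>.\<close>

lemma trivial_on_extension:
  assumes M: "subgroup M G" and pres: "preserves M U'" "preserves M W" "preserves M U"
    and sub: "vec.subspace U'" "vec.subspace W" "U' \<subseteq> W" "W \<subseteq> U"
    and "trivial_on ((derived G ^^ k) M) U' W" "trivial_on ((derived G ^^ l) M) W U"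
  shows "trivial_on ((derived G ^^ Suc (max k l)) M) U' U"
proof -
  define D where "D = (derived G ^^ max k l) M"
  have D: "subgroup D G" "D \<subseteq> M"
    using exp_of_derived_is_subgroup[OF M] derived_power_decreasing[OF M, of 0 "max k l"] by (auto simp: D_def)
  have tW: "trivial_on D U' W" and tU: "trivial_on D W U"
    using assms(9,10) derived_power_decreasing[OF M, of k "max k l"] derived_power_decreasing[OF M, of l "max k l"]
    by (auto simp: D_def intro: trivial_on_mono)
  have "trivial_on (derived G D) U' U"
  proof (rule derived_trivial_on[OF D(1) sub(1)])
    show "preserves D U" "preserves D U'" using pres D(2) preserves_mono by blast+
    fix x y v assume xy: "x \<in> D" "y \<in> D" and v: "v \<in> U"
    define a where "a = \<rho>0 x *v v - v"
    define b where "b = \<rho>0 y *v v - v"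
    have ab: "a \<in> W" "b \<in> W" using tU xy v by (auto simp: trivial_on_def a_def b_def)
    have "\<rho>0 x *v b - b \<in> U'" "\<rho>0 y *v a - a \<in> U'" using tW xy ab by (auto simp: trivial_on_def)
    then have "(\<rho>0 x *v b - b) - (\<rho>0 y *v a - a) \<in> U'" by (rule vec.subspace_diff[OF sub(1)])
    moreover have "\<rho>0 x *v (\<rho>0 y *v v) = \<rho>0 x *v b + (a + v)"
      by (simp add: a_def b_def matrix_vector_mult_diff_distrib)
    moreover have "\<rho>0 y *v (\<rho>0 x *v v) = \<rho>0 y *v a + (b + v)"
      by (simp add: a_def b_def matrix_vector_mult_diff_distrib)
    ultimately show "\<rho>0 x *v (\<rho>0 y *v v) - \<rho>0 y *v (\<rho>0 x *v v) \<in> U'"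
      by (simp add: algebra_simps)
  qed
  then show ?thesis by (simp add: D_def)
qed

end

locale matrix_rep_law = matrix_rep G \<rho>0
  for G :: "('a, 'b) monoid_scheme" (structure)
    and \<rho>0 :: "'a \<Rightarrow> 'k::alg_closed_field^'n::finite^'n" +
  fixes H :: "'a set" and w :: "('a \<times> nat \<times> bool) list"
  assumes fin_H: "fin_idx G (carrier G) H"
    and w: "w \<noteq> []" "reduced w" "\<And>t i b. (t, i, b) \<in> set w \<Longrightarrow> t \<in> carrier G"
    and law: "\<And>h. (\<And>i. h i \<in> H) \<Longrightarrow> twisted_prod w h = \<one>"
begin

text \<open>The action on the quotient is transported to the range of a projection, where it becomes
  \<open>P ** \<rho>0 x ** P\<close>; \<open>irr\<close> makes it strongly irreducible.\<close>

lemma scalars_on_irreducible_section: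
  assumes sub: "vec.subspace U'" "vec.subspace U" "U' \<subseteq> U" "\<not> U \<subseteq> U'"
    and M0: "fin_idx G (carrier G) M0" "preserves M0 U'" "preserves M0 U"
    and irr: "\<And>W M. vec.subspace W \<Longrightarrow> U' \<subseteq> W \<Longrightarrow> W \<subseteq> U \<Longrightarrow> fin_idx G (carrier G) M \<Longrightarrow>
      preserves M W \<Longrightarrow> W = U' \<or> W = U"
  obtains M where "fin_idx G (carrier G) M" "M \<subseteq> M0"
    "\<And>x. x \<in> M \<Longrightarrow> \<exists>c. \<forall>u\<in>U. \<rho>0 x *v u - c *s u \<in> U'"
proof -
  \<comment> \<open>Inside \<open>M0\<close> both subspaces are preserved, inside \<open>H\<close>
    the law holds, and normality allows the twists.\<close>
  obtain N where core: "fin_idx G (carrier G) N" "N \<subseteq> M0 \<inter> H"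
    "\<And>x t. x \<in> N \<Longrightarrow> t \<in> carrier G \<Longrightarrow> t \<otimes> x \<otimes> inv t \<in> N"
    using fin_idx_normal_core[OF fin_idx_Int[OF M0(1) fin_H subgroup_self]] by blast
  obtain P where P: "P ** P = P" "\<And>v. P *v v \<in> U" "\<And>v. v \<in> U' \<Longrightarrow> P *v v = 0"
    "\<And>u. u \<in> U \<Longrightarrow> u - P *v u \<in> U'"
    using subspace_projection[OF sub(2,1,3)] by metis
  have PP: "P *v (P *v v) = P *v v" for v by (simp add: matrix_vector_mul_assoc P(1))
  have Nc: "x \<in> carrier G" if "x \<in> N" for x
    using that subgroup.mem_carrier[OF fin_idx_subgroup[OF core(1)]] by blast
  have NU: "\<rho>0 x *v u \<in> U" if "x \<in> N" "u \<in> U" for x u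
    using that M0(3) core(2) by (auto simp: preserves_def)
  have NU': "\<rho>0 x *v u \<in> U'" if "x \<in> N" "u \<in> U'" for x u
    using that M0(2) core(2) by (auto simp: preserves_def)
  have key: "P *v (\<rho>0 x *v (P *v u)) = P *v (\<rho>0 x *v u)" if "x \<in> N" "u \<in> U" for x u
  proof -
    have "P *v (\<rho>0 x *v (u - P *v u)) = 0" using P(3)[OF NU'[OF that(1) P(4)[OF that(2)]]] .
    then show ?thesis by (simp add: matrix_vector_mult_diff_distrib)
  qed
  define \<rho> where "\<rho> x = P ** \<rho>0 x ** P" for x
  have \<rho>_vec: "\<rho> x *v v = P *v (\<rho>0 x *v (P *v v))" for x v
    by (simp add: \<rho>_def matrix_vector_mul_assoc matrix_mul_assoc)
  have \<rho>1: "\<rho> \<one> = P" by (simp add: \<rho>_def rho0_one P(1))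
  interpret strongly_irreducible_rep G N \<rho>
  proof unfold_locales
    show "fin_idx G (carrier G) N" "\<And>x t. x \<in> N \<Longrightarrow> t \<in> carrier G \<Longrightarrow> t \<otimes> x \<otimes> inv t \<in> N"
      using core by auto
    show "\<rho> (x \<otimes> y) = \<rho> x ** \<rho> y" if "x \<in> N" "y \<in> N" for x y
    proof -
      have "\<rho> (x \<otimes> y) *v v = (\<rho> x ** \<rho> y) *v v" for v
        using key[OF that(1) NU[OF that(2) P(2)]] that Nc
        by (simp add: \<rho>_vec rho0_mult_vec PP flip: matrix_vector_mul_assoc)
      then show ?thesis by (simp add: matrix_eq)
    qed
    show "\<rho> \<one> \<noteq> 0"
    proof
      assume "\<rho> \<one> = 0"
      then have "u - 0 \<in> U'" if "u \<in> U" for u using P(4)[OF that] \<rho>1 by simp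
      then show False using sub(4) by auto
    qed
    fix M :: "'a set" and A B :: "'k^'n^'n"
    assume M: "fin_idx G (carrier G) M" "M \<subseteq> N" and AB: "A ** \<rho> \<one> \<noteq> 0" "\<rho> \<one> ** B \<noteq> 0"
    show "\<exists>x\<in>M. A ** \<rho> x ** B \<noteq> 0"
    proof (rule ccontr)
      assume "\<not> ?thesis"
      then have zero: "A ** \<rho> x ** B = 0" if "x \<in> M" for x using that by blast
      obtain b where b: "(P ** B) *v b \<noteq> 0" using matrix_nonzero_vector[OF AB(2)] \<rho>1 by metis
      define v where "v = P *v (B *v b)"
      have v: "v \<noteq> 0" "P *v v = v" "v \<in> U" 
        using b P(2) PP by (simp_all add: v_def) (simp add: matrix_vector_mul_assoc)
      have vU': "v \<notin> U'" using P(3) v by metis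
      \<comment> \<open>The vectors of \<open>U\<close> whose \<open>M\<close>-orbit is killed by
        \<open>A ** P\<close> form an \<open>M\<close>-invariant space containing \<open>U'\<close>
        and also \<open>v\<close>, which lies outside \<open>U'\<close>. So it is all of
        \<open>U\<close>, and the identity of \<open>M\<close> gives
        \<open>A ** P = 0\<close>.\<close>
      define W where "W = {u \<in> U. \<forall>x\<in>M. A *v (P *v (\<rho>0 x *v u)) = 0}"
      have "vec.subspace W"
        using sub(2) by (auto simp: W_def vec.subspace_def matrix_vector_right_distrib vec.scale)
      moreover have "U' \<subseteq> W"
        using sub(3) P(3) NU' M(2) by (auto simp: W_def)
      moreover have "W \<subseteq> U" by (auto simp: W_def)
      moreover have "preserves M W"
        unfolding preserves_def
      proof (intro ballI)
        fix y u assume y: "y \<in> M" and u: "u \<in> W"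
        have "A *v (P *v (\<rho>0 x *v (\<rho>0 y *v u))) = 0" if x: "x \<in> M" for x
        proof -
          have "x \<otimes> y \<in> M" using subgroup.m_closed[OF fin_idx_subgroup[OF M(1)]] x y by blast
          then have "A *v (P *v (\<rho>0 (x \<otimes> y) *v u)) = 0" using u by (auto simp: W_def)
          then show ?thesis using x y Nc M(2) by (simp add: rho0_mult_vec subset_iff)
        qed
        then show "\<rho>0 y *v u \<in> W" using u y NU M(2) by (auto simp: W_def)
      qed
      moreover have "v \<in> W"
      proof -
        have "A *v (P *v (\<rho>0 x *v v)) = 0" if "x \<in> M" for x
        proof -
          have "A *v (P *v (\<rho>0 x *v v)) = (A ** \<rho> x ** B) *v b"
            by (simp add: v_def \<rho>_vec flip: matrix_vector_mul_assoc)
          then show ?thesis using zero[OF that] by simp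
        qed
        then show ?thesis using v(3) by (simp add: W_def)
      qed
      ultimately have "W = U" using irr M(1) vU' by blast
      then have "A *v (P *v (\<rho>0 \<one> *v u)) = 0" if "u \<in> U" for u
        using that subgroup.one_closed[OF fin_idx_subgroup[OF M(1)]] by (auto simp: W_def)
      then have "(A ** P) *v u = 0" for u
        using P(2)[of u] by (simp add: rho0_one PP flip: matrix_vector_mul_assoc)
          (metis PP)
      then show False using AB(1) \<rho>1 matrix_nonzero_vector by metis
    qed
  qed
  have "fin_idx G (carrier G) {x \<in> N. \<exists>c. \<rho> x = c *\<^sub>m \<rho> \<one>}"
  proof (rule twisted_law_imp_scalars[OF w(1,2)])
    show "t \<in> carrier G" if "(t, i, b) \<in> set w" for t i b using w(3)[OF that] .
    show "twisted_prod w h = \<one>" if "\<And>i. h i \<in> N" for h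
      by (rule law) (use that core(2) in blast)
  qed
  moreover have "\<exists>c. \<forall>u\<in>U. \<rho>0 x *v u - c *s u \<in> U'" if x: "x \<in> N" "\<rho> x = c *\<^sub>m \<rho> \<one>" for x c
  proof (intro exI ballI)
    fix u assume u: "u \<in> U"
    have "P *v (\<rho>0 x *v u) = c *s (P *v u)"
      using key[OF x(1) u] \<rho>_vec[of x u] by (simp add: x(2) \<rho>1 smat_simps(6))
    then have "P *v (\<rho>0 x *v u - c *s u) = 0"
      by (simp add: matrix_vector_mult_diff_distrib vec.scale)
    moreover have "\<rho>0 x *v u - c *s u \<in> U"
      using NU[OF x(1) u] u sub(2) by (intro vec.subspace_diff vec.subspace_scale)
    ultimately show "\<rho>0 x *v u - c *s u \<in> U'" using P(4) by fastforce
  qed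
  moreover have "{x \<in> N. \<exists>c. \<rho> x = c *\<^sub>m \<rho> \<one>} \<subseteq> M0" using core(2) by blast
  ultimately show ?thesis using that by blast
qed

text \<open>Induction on the dimension of the section. The case distinction ranges over all
  finite-index subgroups at once, so an irreducible section stays irreducible under shrinking; there
  the action becomes scalar, hence commutative, and one derived step trivialises it.\<close>

lemma virtually_trivial_on_section:
  assumes "vec.subspace U'" "vec.subspace U" "U' \<subseteq> U"
    and "fin_idx G (carrier G) M0" "preserves M0 U'" "preserves M0 U"
  shows "\<exists>M k. fin_idx G (carrier G) M \<and> trivial_on ((derived G ^^ k) M) U' U"
  using assms
proof (induction "vec.dim U - vec.dim U'" arbitrary: U' U M0 rule: less_induct)
  case less
  note sub = less.prems(1-3) and M0 = less.prems(4-6)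
  have dim_less: "vec.dim E < vec.dim F" if "vec.subspace E" "vec.subspace F" "E \<subset> F" for E F :: "('k^'n) set"
    using that vec.dim_psubset[of E F] by (simp add: vec.span_eq_iff[THEN iffD2])
  show ?case
  proof (cases "\<exists>W M. vec.subspace W \<and> U' \<subset> W \<and> W \<subset> U \<and> fin_idx G (carrier G) M \<and> preserves M W")
    case True
    then obtain W M1 where W: "vec.subspace W" "U' \<subset> W" "W \<subset> U" "fin_idx G (carrier G) M1" "preserves M1 W"
      by blast
    have d: "vec.dim U' < vec.dim W" "vec.dim W < vec.dim U" using dim_less W sub by blast+
    let ?M = "M0 \<inter> M1"
    have M: "fin_idx G (carrier G) ?M" using fin_idx_Int[OF M0(1) W(4) subgroup_self] .
    have pres: "preserves ?M U'" "preserves ?M W" "preserves ?M U"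
      using M0 W preserves_mono by blast+
    have "\<exists>M k. fin_idx G (carrier G) M \<and> trivial_on ((derived G ^^ k) M) U' W"
      by (rule less.hyps[OF _ sub(1) W(1) _ M pres(1,2)]) (use d W in auto)
    then obtain M2 k where M2: "fin_idx G (carrier G) M2" "trivial_on ((derived G ^^ k) M2) U' W" by blast
    have "\<exists>M k. fin_idx G (carrier G) M \<and> trivial_on ((derived G ^^ k) M) W U"
      by (rule less.hyps[OF _ W(1) sub(2) _ M pres(2,3)]) (use d W in auto)
    then obtain M3 l where M3: "fin_idx G (carrier G) M3" "trivial_on ((derived G ^^ l) M3) W U" by blast
    let ?L = "?M \<inter> (M2 \<inter> M3)"
    have L: "fin_idx G (carrier G) ?L"
      by (intro fin_idx_Int M M2(1) M3(1) subgroup_self)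
    have "trivial_on ((derived G ^^ Suc (max k l)) ?L) U' U"
    proof (rule trivial_on_extension[OF fin_idx_subgroup[OF L] _ _ _ sub(1) W(1)])
      show "preserves ?L U'" "preserves ?L W" "preserves ?L U"
        by (rule preserves_mono[OF pres(1)] preserves_mono[OF pres(2)] preserves_mono[OF pres(3)], blast)+
      show "trivial_on ((derived G ^^ k) ?L) U' W"
        by (rule trivial_on_mono[OF M2(2) mono_exp_of_derived]) blast
      show "trivial_on ((derived G ^^ l) ?L) W U"
        by (rule trivial_on_mono[OF M3(2) mono_exp_of_derived]) blast
    qed (use W in auto)
    then show ?thesis using L by blast
  next
    case False
    show ?thesis
    proof (cases "U \<subseteq> U'")
      case True
      then have "trivial_on ((derived G ^^ 0) M0) U' U"
        using M0(3) sub by (auto simp: trivial_on_def preserves_def intro!: vec.subspace_diff)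
      then show ?thesis using M0(1) by blast
    next
      case False': False
      have irr: "W = U' \<or> W = U" if "vec.subspace W" "U' \<subseteq> W" "W \<subseteq> U" "fin_idx G (carrier G) M" "preserves M W" for W M
        using False that by blast
      obtain M where M: "fin_idx G (carrier G) M" "M \<subseteq> M0"
        "\<And>x. x \<in> M \<Longrightarrow> \<exists>c. \<forall>u\<in>U. \<rho>0 x *v u - c *s u \<in> U'"
        using scalars_on_irreducible_section[OF sub(1,2,3) False' M0] irr by metis
      have "trivial_on (derived G M) U' U"
      proof (rule derived_trivial_on[OF fin_idx_subgroup[OF M(1)] sub(1)])
        show "preserves M U" "preserves M U'" using M0 M(2) preserves_mono by blast+
        fix x y v assume xy: "x \<in> M" "y \<in> M" and v: "v \<in> U"
        obtain c where c: "\<And>u. u \<in> U \<Longrightarrow> \<rho>0 x *v u - c *s u \<in> U'" using M(3)[OF xy(1)] by blast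
        obtain d where d: "\<And>u. u \<in> U \<Longrightarrow> \<rho>0 y *v u - d *s u \<in> U'" using M(3)[OF xy(2)] by blast
        have U2: "\<rho>0 x *v v \<in> U" "\<rho>0 y *v v \<in> U"
          using xy v M0(3) M(2) by (auto simp: preserves_def)
        have "(\<rho>0 x *v (\<rho>0 y *v v) - c *s (\<rho>0 y *v v)) + c *s (\<rho>0 y *v v - d *s v) \<in> U'"
          by (intro vec.subspace_add[OF sub(1)] vec.subspace_scale[OF sub(1)] c d U2 v)
        moreover have "(\<rho>0 y *v (\<rho>0 x *v v) - d *s (\<rho>0 x *v v)) + d *s (\<rho>0 x *v v - c *s v) \<in> U'"
          by (intro vec.subspace_add[OF sub(1)] vec.subspace_scale[OF sub(1)] c d U2 v)
        ultimately have "((\<rho>0 x *v (\<rho>0 y *v v) - c *s (\<rho>0 y *v v)) + c *s (\<rho>0 y *v v - d *s v)) -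
          ((\<rho>0 y *v (\<rho>0 x *v v) - d *s (\<rho>0 x *v v)) + d *s (\<rho>0 x *v v - c *s v)) \<in> U'"
          by (rule vec.subspace_diff[OF sub(1)])
        then show "\<rho>0 x *v (\<rho>0 y *v v) - \<rho>0 y *v (\<rho>0 x *v v) \<in> U'"
          by (simp add: vec.scale_right_diff_distrib mult.commute)
      qed
      then have "trivial_on ((derived G ^^ 1) M) U' U" by simp
      then show ?thesis using M(1) by blast
    qed
  qed
qed

text \<open>On the section from \<open>{0}\<close> to \<open>UNIV\<close>, acting trivially means
  acting as the identity matrix, so faithfulness makes a term of the derived series of
  \<open>M\<close> trivial.\<close>

theorem virtually_solvable_of_faithful:
  assumes inj: "inj_on \<rho>0 (carrier G)"
  shows "virtually_solvable G"
proof -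
  have "preserves (carrier G) {0}" "preserves (carrier G) UNIV" by (auto simp: preserves_def)
  then obtain M k where M: "fin_idx G (carrier G) M" "trivial_on ((derived G ^^ k) M) {0} UNIV"
    using virtually_trivial_on_section[of "{0}" UNIV "carrier G"] fin_idx_refl[OF subgroup_self]
    by (auto simp: vec.subspace_0 vec.subspace_UNIV vec.subspace_single_0)
  have sM: "subgroup M G" using M(1) by (rule fin_idx_subgroup)
  let ?D = "(derived G ^^ k) M"
  have D: "subgroup ?D G" by (rule exp_of_derived_is_subgroup[OF sM])
  have "x = \<one>" if "x \<in> ?D" for x
  proof -
    have "\<forall>v. \<rho>0 x *v v = mat 1 *v v" using M(2) that by (auto simp: trivial_on_def)
    then have "\<rho>0 x = \<rho>0 \<one>" by (simp add: matrix_eq rho0_one)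
    then show ?thesis using inj that subgroup.mem_carrier[OF D] by (auto dest: inj_onD)
  qed
  then have D1: "?D = {\<one>}" using subgroup.one_closed[OF D] by blast
  interpret M: group "G\<lparr>carrier := M\<rparr>" by (rule subgroup_imp_group[OF sM])
  have "(derived (G\<lparr>carrier := M\<rparr>) ^^ j) M = (derived G ^^ j) M" for j
  proof (induction j)
    case (Suc j)
    have "(derived G ^^ j) M \<subseteq> M" using derived_power_decreasing[OF sM, of 0 j] by simp
    then show ?case using Suc by (simp add: derived_consistent[OF _ sM])
  qed simp
  then have "(derived (G\<lparr>carrier := M\<rparr>) ^^ k) (carrier (G\<lparr>carrier := M\<rparr>)) = {\<one>\<^bsub>G\<lparr>carrier := M\<rparr>\<^esub>}"
    using D1 by simp
  then have "solvable (G\<lparr>carrier := M\<rparr>)" unfolding M.solvable_iff_trivial_derived_seq by blast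
  moreover have "finite_index G M"
    unfolding finite_index_def using M(1) sM fin_idx_iff_finite_rcosets[OF sM] by simp
  ultimately show ?thesis unfolding virtually_solvable_def by blast
qed

end

lemma group_GL: "group (GL :: ('k::field^'n::finite^'n) monoid)"
proof (rule groupI)
  fix A :: "'k^'n^'n" assume "A \<in> carrier GL"
  then obtain B where "A ** B = mat 1" "B ** A = mat 1" by (auto simp: GL_def invertible_def)
  then show "\<exists>B\<in>carrier GL. B \<otimes>\<^bsub>GL\<^esub> A = \<one>\<^bsub>GL\<^esub>"
    by (intro bexI[of _ B]) (auto simp: GL_def invertible_def)
qed (auto simp: GL_def invertible_mult matrix_mul_assoc invertible_def[of "mat 1"])

definition mat_to_ac :: "'k::field^'n^'m \<Rightarrow> 'k alg_closure^'n^'m" where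
  "mat_to_ac A = (\<chi> i j. to_ac (A $ i $ j))"

theorem theorem7p4:
  fixes \<Gamma> \<Delta> :: "('k::field ^'n::finite ^'n) set"
  assumes "subgroup \<Gamma> GL"
    and "\<exists>S. finite S \<and> S \<subseteq> \<Gamma> \<and> generate GL S = \<Gamma>"
    and "finite_index (GL\<lparr>carrier := \<Gamma>\<rparr>) \<Delta>"
    and "coset_identity (GL\<lparr>carrier := \<Gamma>\<rparr>) \<Delta>"
  shows "virtually_solvable (GL\<lparr>carrier := \<Gamma>\<rparr>)"
proof -
  let ?G = "GL\<lparr>carrier := \<Gamma>\<rparr>"
  interpret group ?G by (rule group.subgroup_imp_group[OF group_GL assms(1)])
  have \<Delta>: "subgroup \<Delta> ?G" "fin_idx ?G (carrier ?G) \<Delta>"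
    using assms(3) fin_idx_iff_finite_rcosets unfolding finite_index_def by auto
  obtain w where w: "w \<noteq> []" "reduced w" "\<And>t i b. (t, i, b) \<in> set w \<Longrightarrow> t \<in> carrier ?G"
    "\<And>h. (\<And>i. h i \<in> \<Delta>) \<Longrightarrow> twisted_prod w h = \<one>\<^bsub>?G\<^esub>"
    using coset_identity_twisted_law[OF assms(4) \<Delta>(1)] by blast
  \<comment> \<open>The representation is the inclusion of \<Gamma> followed by extension of scalars
    to the algebraic closure, faithful because field embeddings are injective.\<close>
  interpret matrix_rep_law ?G mat_to_ac \<Delta> w
  proof unfold_locales
    show "mat_to_ac (x \<otimes>\<^bsub>?G\<^esub> y) = mat_to_ac x ** mat_to_ac y" for x y
      by (simp add: GL_def mat_to_ac_def matrix_matrix_mult_def vec_eq_iff to_ac_sum)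
    show "mat_to_ac \<one>\<^bsub>?G\<^esub> = mat 1"
      by (simp add: GL_def mat_to_ac_def mat_def vec_eq_iff)
  qed (use w \<Delta> in auto)
  have "inj_on mat_to_ac (carrier ?G)"
    by (auto simp: inj_on_def mat_to_ac_def vec_eq_iff)
  then show ?thesis by (rule virtually_solvable_of_faithful)
qed

end
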